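(* Assume the standing assumptions in the context, let $f\in AC(I)$, and suppose the finite limits $a_1:=\lim_{x\to x_0}f_1^*(x)$ and $a_2:=\lim_{x\to x_0}f_2^*(x)$ exist (i.e. the graph of $f$ admits $y=a_1\phi_1(x)+a_2\phi_2(x)$ as limit tangent curve in $\mathrm{span}(\phi_1,\phi_2)$). Put $\gamma:=\lim_{x\to x_0}F^*(x)$ (which exists) and $R(x):=f(x)-a_1\phi_1(x)-a_2\phi_2(x)$. (I) $R(x)=-\phi_1(x)\int_x^{x_0}W(t)\phi_1(t)^{-2}[f_2^*(t)-a_2]\,dt=-\phi_1(x)\int_x^{x_0}(\phi_2(t)/\phi_1(t))'[f_2^*(t)-a_2]\,dt$ for $x\in[T,x_0)$, and $R(x)=-\Phi(x)\int_x^{x_0}W(t)\Phi(t)^{-2}[F^*(t)-\gamma]\,dt$ for $x\in(T,x_0)$. If moreover $\phi_1,\phi_2\in AC^1(I)$ and $f\in AC^1(I)$, then $$R(x)=\phi_1(x)\int_x^{x_0}\Big(\frac{\phi_2(t)}{\phi_1(t)}\Big)'dt\int_t^{x_0}\phi_1(s)W(s)^{-1}L[f(s)]\,ds,\quad x\in[T,x_0),$$ $$R(x)=-\phi_2(x)\int_x^{x_0}\Big(\frac{\phi_1(t)}{\phi_2(t)}\Big)'dt\int_t^{x_0}\phi_2(s)W(s)^{-1}L[f(s)]\,ds,\quad x\in[T,x_0),$$ $$R(x)=\Phi(x)\int_x^{x_0}W(t)\Phi(t)^{-2}dt\int_t^{x_0}\Phi(s)W(s)^{-1}L[f(s)]\,ds,\quad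 x\in(T,x_0).$$ (II) For $x\in[T,x_0)$: $$|R(x)|\le|\phi_2(x)|\cdot\operatorname*{ess\,sup}_{x<t<x_0}|f_2^*(t)-a_2|,\qquad |R(x)|\le\Big|\frac{\phi_2(x)}{\phi_2(T)}\Big|\cdot\operatorname*{ess\,sup}_{x<t<x_0}|F^*(t)-\gamma|;$$ and if moreover $\phi_1,\phi_2,f\in AC^1(I)$, then $$|R(x)|\le|\phi_2(x)|\int_x^{x_0}\big|\phi_1(t)W(t)^{-1}L[f(t)]\big|\,dt,\quad x\in[T,x_0),$$ $$|R(x)|\le\Big|\frac{\phi_2(x)}{\phi_2(T)}\Big|\int_x^{x_0}\big|\Phi(t)W(t)^{-1}L[f(t)]\big|\,dt,\quad x\in(T,x_0).$$ (III) If $f\in C^1(I)$, then for each $x\in[T,x_0)$ there exists $\xi_1\in[x,x_0]$ (in the extended reals) with $R(x)=\phi_2(x)\,(f_2^*(\xi_1)-a_2)$, where $f_2^*(x_0):=a_2$; and for each $x\in(T,x_0)$ there exists $\xi_2\in[x,x_0]$ with $R(x)=\frac{\phi_2(x)}{\phi_2(T)}(F^*(\xi_2)-\gamma)$, where $F^*(x_0):=\gamma$. If moreover $\phi_1,\phi_2,f\in AC^1(I)$, these read, for $x\in(T,x_0)$, $$R(x)=-\phi_2(x)\int_{\xi_1}^{x_0}\phi_1(t)W(t)^{-1}L[f(t)]\,dt,\qquad R(x)=-\frac{\phi_2(x)}{\phi_2(T)}\int_{\xi_2}^{x_0}\Phi(t)W(t)^{-1}L[f(t)]\,dt,$$ with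 the convention $\int_{x_0}^{x_0}=0$.
   Context: Let $x_0\in\mathbb{R}\cup\{+\infty\}$, $T\in\mathbb{R}$ with $T<x_0$, and $I:=[T,x_0)$. Limits as $x\to x_0$ are taken for $x\in I$ (over points where the functions are defined). For differentiable $g,h$ put $W(g,h;x):=g(x)h'(x)-g'(x)h(x)$. Standing assumptions: $\phi_1,\phi_2\in C^1(I)$; $\phi_2(x)=o(\phi_1(x))$ as $x\to x_0$; $\phi_1(x)\neq0$, $\phi_2(x)\neq0$ for all $x\in I$; $W(x):=W(\phi_1,\phi_2;x)\neq0$ for all $x\in I$. $AC(I)$: absolutely continuous on every compact subinterval of $I$; $AC^1(I)$: $C^1$ functions whose derivative is in $AC(I)$. For $f\in AC(I)$ and $t$ where $f$ is differentiable: $f_1^*(t):=W(f,\phi_2;t)/W(t)$, $f_2^*(t):=-W(f,\phi_1;t)/W(t)$; $\Phi(x):=\phi_2(T)\phi_1(x)-\phi_1(T)\phi_2(x)$; $F^*(t):=\phi_1(T)f_1^*(t)+\phi_2(T)f_2^*(t)=W(\Phi,f;t)/W(t)$. When $\phi_1,\phi_2\in AC^1(I)$, $L$ is the unique operator $L[u]=u''+a_1(x)u'+a_2(x)u$ ($a_i$ locally integrable) with kernel $\mathrm{span}(\phi_1,\phi_2)$; equivalently $L[u]=\frac{W}{\phi_1}\big[\frac{\phi_1^2}{W}(u/\phi_1)'\big]'$. *)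

theory Defs
  imports "HOL-Analysis.Analysis" "HOL-Library.Landau_Symbols"
begin

definition Ivl :: "real \<Rightarrow> ereal \<Rightarrow> real set" where
  "Ivl T x0 = {x. T \<le> x \<and> ereal x < x0}"

definition OIvl :: "real \<Rightarrow> ereal \<Rightarrow> real set" where
  "OIvl a x0 = {x. a < x \<and> ereal x < x0}"

definition at_x0 :: "ereal \<Rightarrow> real filter" where
  "at_x0 x0 = (if x0 = \<infinity> then at_top else at_left (real_of_ereal x0))"

definition C1_on :: "real set \<Rightarrow> (real \<Rightarrow> real) \<Rightarrow> (real \<Rightarrow> real) \<Rightarrow> bool" where
  "C1_on S g g' \<longleftrightarrow> continuous_on S g' \<and> (\<forall>t\<in>S. (g has_real_derivative g' t) (at t within S))"

definition abs_cont_on :: "real \<Rightarrow> real \<Rightarrow> (real \<Rightarrow> real) \<Rightarrow> bool" where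
  "abs_cont_on a b g \<longleftrightarrow>
     (\<forall>\<epsilon>>0. \<exists>\<delta>>0. \<forall>(n::nat) (u::nat \<Rightarrow> real) (v::nat \<Rightarrow> real).
        (\<forall>i<n. a \<le> u i \<and> u i \<le> v i \<and> v i \<le> b) \<and>
        (\<forall>i<n. \<forall>j<n. i \<noteq> j \<longrightarrow> v i \<le> u j \<or> v j \<le> u i) \<and>
        (\<Sum>i<n. v i - u i) < \<delta>
        \<longrightarrow> (\<Sum>i<n. \<bar>g (v i) - g (u i)\<bar>) < \<epsilon>)"

definition AC_on :: "real set \<Rightarrow> (real \<Rightarrow> real) \<Rightarrow> bool" where
  "AC_on S g \<longleftrightarrow> (\<forall>a b. a \<le> b \<longrightarrow> {a..b} \<subseteq> S \<longrightarrow> abs_cont_on a b g)"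

definition AC1_on :: "real set \<Rightarrow> (real \<Rightarrow> real) \<Rightarrow> (real \<Rightarrow> real) \<Rightarrow> bool" where
  "AC1_on S g g' \<longleftrightarrow> C1_on S g g' \<and> AC_on S g'"

definition imp_int :: "ereal \<Rightarrow> (real \<Rightarrow> real) \<Rightarrow> real \<Rightarrow> real \<Rightarrow> bool" where
  "imp_int x0 g x v \<longleftrightarrow>
     (\<forall>b. x \<le> b \<and> ereal b < x0 \<longrightarrow> g absolutely_integrable_on {x..b}) \<and>
     ((\<lambda>b. integral {x..b} g) \<longlongrightarrow> v) (at_x0 x0)"

definition imp_int_ext :: "ereal \<Rightarrow> (real \<Rightarrow> real) \<Rightarrow> ereal \<Rightarrow> real \<Rightarrow> bool" where
  "imp_int_ext x0 g \<xi> v \<longleftrightarrow>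
     (\<xi> = x0 \<and> v = 0) \<or> (\<xi> < x0 \<and> imp_int x0 g (real_of_ereal \<xi>) v)"

definition ext_at :: "ereal \<Rightarrow> (real \<Rightarrow> real) \<Rightarrow> real \<Rightarrow> ereal \<Rightarrow> real" where
  "ext_at x0 g c \<xi> = (if \<xi> = x0 then c else g (real_of_ereal \<xi>))"

definition ess_sup_on :: "real set \<Rightarrow> (real \<Rightarrow> real) \<Rightarrow> ereal" where
  "ess_sup_on S g = Inf {z. AE t in lebesgue. t \<in> S \<longrightarrow> ereal (g t) \<le> z}"

definition Wr :: "(real \<Rightarrow> real) \<Rightarrow> (real \<Rightarrow> real) \<Rightarrow> (real \<Rightarrow> real) \<Rightarrow> (real \<Rightarrow> real) \<Rightarrow> real \<Rightarrow> real" where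
  "Wr g g' h h' x = g x * h' x - g' x * h x"

(* L[u](x) = W/phi1 * [ phi1^2/W * (u/phi1)' ]'  (the operator with kernel span(phi1,phi2)) *)
definition Lop :: "(real \<Rightarrow> real) \<Rightarrow> (real \<Rightarrow> real) \<Rightarrow> (real \<Rightarrow> real) \<Rightarrow> real \<Rightarrow> real" where
  "Lop \<phi>1 W u x = W x / \<phi>1 x * deriv (\<lambda>t. \<phi>1 t ^ 2 / W t * deriv (\<lambda>s. u s / \<phi>1 s) t) x"

end

theory Submission
  imports Defs
begin

text \<open>
  On the set where \<open>f\<close> is differentiable, \<open>f\<close> and \<open>f'\<close> are the combinations of
  \<open>\<phi>1, \<phi>2\<close> and of \<open>\<phi>1', \<phi>2'\<close> with coefficients \<open>f1s, f2s\<close> (variation of constants).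
  Hence for \<open>\<psi> = p \<phi>1 + q \<phi>2\<close> the quotient \<open>u = R / \<psi>\<close> has the a.e. derivative
  \<open>W / \<psi>\<^sup>2 * (p (f2s - a2) - q (f1s - a1))\<close>, while \<open>\<phi>2 / \<psi>\<close> has derivative \<open>p W / \<psi>\<^sup>2\<close>.
  For \<open>\<psi> = \<phi>1\<close> and \<open>\<psi> = \<Phi>\<close> both quotients vanish at \<open>x0\<close>, so that we have two functions with
  \<open>u' = w' k\<close>, \<open>w'\<close> of constant sign, and limit 0: integration gives (I), the estimate
  \<open>\<bar>u\<bar> \<le> \<bar>w\<bar> ess sup \<bar>k\<bar>\<close> gives (II), and Rolle's theorem on \<open>[x, x0)\<close> applied to
  \<open>u - (u x / w x) w\<close> gives (III), even with \<open>\<xi>\<close> in the open interval.  The formula based on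
  \<open>\<psi> = \<phi>2\<close> needs in addition \<open>R = o(\<phi>2)\<close>, which follows from (II).  The statements involving
  \<open>L\<close> reduce to these because \<open>f2s' = \<phi>1 / W L[f]\<close> and \<open>f1s' = - \<phi>2 / W L[f]\<close> a.e.

  The underlying Lebesgue theory is the fundamental theorem of calculus for absolutely continuous
  functions.  Differentiability a.e. is proved by a variation argument of Austin and Botsko,
  the integral formula directly from the definition of the gauge integral.
\<close>

section \<open>Differentiability of absolutely continuous functions\<close>

text \<open>The obstacle is that \<open>f\<close> is only absolutely continuous: \<open>f1s\<close>,
  \<open>f2s\<close> and \<open>Fs\<close> carry information on \<open>D\<close> alone, and their
  limits are taken along \<open>D\<close>. The quotients of \<open>R\<close> are continuous,
  however, and a null set contains no nonempty open set, so limits of these quotients along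
  \<open>D\<close> are full limits at \<open>x0\<close>. \<open>\<Phi>\<close> is the combination of
  \<open>\<phi>1\<close> and \<open>\<phi>2\<close> that vanishes at \<open>T\<close>: with p =
  \<phi>2 T and q = - \<phi>1 T the factor p (f2s - a2) - q (f1s - a1) becomes Fs - \<gamma>. Since
  \<phi>2 / \<phi>1 has a derivative without zeros, \<open>T\<close> is the only zero of
  \<open>\<Phi>\<close>. Hence formulas that divide by \<open>\<Phi>\<close> live on the open
  interval, and the corresponding estimate in (II) is recovered at \<open>T\<close> by continuity.
  The integrals up to \<open>x0\<close> may converge only conditionally, so integrands are compared
  on compact intervals before the limit is taken.\<close>

definition interval_incr :: "(real \<Rightarrow> real) \<Rightarrow> real set \<Rightarrow> real" where
  "interval_incr h K = h (Sup K) - h (Inf K)"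

lemma interval_incr_Icc [simp]: "u \<le> v \<Longrightarrow> interval_incr h {u..v} = h v - h u"
  by (simp add: interval_incr_def)

lemma division_of_realE:
  fixes d :: "real set set"
  assumes "d division_of S" "K \<in> d"
  obtains u v where "K = {u..v}" "u \<le> v"
  using division_ofD(3,4)[OF assms] by (metis atLeastatMost_empty_iff2 cbox_interval linorder_not_le)

lemma sum_interval_incr:
  assumes "a \<le> b" "d division_of {a..b}"
  shows "(\<Sum>K\<in>d. interval_incr h K) = h b - h a"
proof -
  \<comment> \<open>Additivity needs the value 0 on the empty set, where
    \<open>interval_incr\<close> depends on the unspecified \<open>Sup {}\<close> and
    \<open>Inf {}\<close>. The two functions agree on the nonempty members of a division.\<close>
  let ?f = "(\<lambda>K::real set. if K = {} then 0 else h(interval_upperbound K) - h(interval_lowerbound K))"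
  interpret operative_real plus 0 ?f
    rewrites "comm_monoid_set.F (+) 0 = sum"
    by standard[1] (auto simp add: sum_def)
  have "(\<Sum>K\<in>d. interval_incr h K) = sum ?f d"
  proof (rule sum.cong)
    fix K assume "K \<in> d"
    then obtain u v where "K = {u..v}" "u \<le> v"
      using division_of_realE assms by metis
    then show "interval_incr h K = ?f K" by simp
  qed simp
  also have "\<dots> = ?f {a..b}"
    using division[of d a b] assms by simp
  finally show ?thesis using assms by simp
qed

lemma sum_Sup_Inf_le:
  fixes a b :: real
  assumes "d division_of S" "S \<subseteq> {a..b}" "a \<le> b"
  shows "(\<Sum>K\<in>d. Sup K - Inf K) \<le> b - a"
proof -
  have "(\<Sum>K\<in>d. Sup K - Inf K) = sum (measure lborel) d"
  proof (rule sum.cong)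
    fix K assume "K \<in> d"
    then obtain u v where "K = {u..v}" "u \<le> v"
      using division_of_realE assms by metis
    then show "Sup K - Inf K = measure lborel K" by simp
  qed simp
  also have "\<dots> \<le> measure lborel (cbox a b)"
    using subadditive_content_division[of d S a b] assms by simp
  finally show ?thesis using assms by simp
qed

text \<open>A bridge: the definition speaks of indexed families of intervals lying side by side,
  whereas the Vitali and gauge arguments produce divisions.\<close>

lemma abs_cont_on_division:
  assumes "abs_cont_on a b h" "0 < e"
  obtains \<delta> where "0 < \<delta>"
    "\<And>d S. \<lbrakk>d division_of S; S \<subseteq> {a..b}; (\<Sum>K\<in>d. Sup K - Inf K) < \<delta>\<rbrakk>
      \<Longrightarrow> (\<Sum>K\<in>d. \<bar>interval_incr h K\<bar>) < e"
proof -
  from assms(1)[unfolded abs_cont_on_def, THEN spec, THEN mp, OF assms(2)]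
  obtain \<delta> where "\<delta> > 0" and \<delta>: "\<forall>(n::nat) u v. (\<forall>i<n. a \<le> u i \<and> u i \<le> v i \<and> v i \<le> b) \<and>
        (\<forall>i<n. \<forall>j<n. i \<noteq> j \<longrightarrow> v i \<le> u j \<or> v j \<le> u i) \<and>
        (\<Sum>i<n. v i - u i) < \<delta> \<longrightarrow> (\<Sum>i<n. \<bar>h (v i) - h (u i)\<bar>) < e"
    by (elim exE conjE)
  show thesis
  proof (rule that[OF \<open>\<delta> > 0\<close>])
    fix d S assume d: "d division_of S" "S \<subseteq> {a..b}" and small: "(\<Sum>K\<in>d. Sup K - Inf K) < \<delta>"
    \<comment> \<open>Degenerate members must go: since only interiors are disjoint, a one-point
      interval may lie inside another member, and then the two are not side by side. They contribute
      nothing to either sum.\<close>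
    define d' where "d' = {K\<in>d. Inf K < Sup K}"
    have fin: "finite d" "finite d'" using d unfolding d'_def by auto
    obtain g where g: "bij_betw g {..<card d'} d'"
      using ex_bij_betw_nat_finite[OF fin(2)] atLeast0LessThan by metis
    have mem: "g i \<in> d'" if "i < card d'" for i
      using g that by (auto simp: bij_betw_def)
    have Icc: "\<exists>u v. K = {u..v} \<and> u \<le> v \<and> K \<subseteq> {a..b}" if "K \<in> d" for K
      using division_of_realE[OF d(1) that] division_ofD(2)[OF d(1) that] d(2) by (metis order_trans)
    have 1: "\<forall>i<card d'. a \<le> Inf (g i) \<and> Inf (g i) \<le> Sup (g i) \<and> Sup (g i) \<le> b"
    proof safe
      fix i assume "i < card d'"
      then have "g i \<in> d" using mem d'_def by auto
      from Icc[OF this] obtain u v where "g i = {u..v}" "u \<le> v" "g i \<subseteq> {a..b}" by blast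
      then show "a \<le> Inf (g i)" "Inf (g i) \<le> Sup (g i)" "Sup (g i) \<le> b" by auto
    qed
    have 2: "\<forall>i<card d'. \<forall>j<card d'. i \<noteq> j \<longrightarrow> Sup (g i) \<le> Inf (g j) \<or> Sup (g j) \<le> Inf (g i)"
    proof (intro allI impI)
      fix i j assume ij: "i < card d'" "j < card d'" "i \<noteq> j"
      then have ne: "g i \<noteq> g j" using g by (auto simp: bij_betw_def inj_on_def)
      have m: "g i \<in> d" "g j \<in> d" "Inf (g i) < Sup (g i)" "Inf (g j) < Sup (g j)"
        using mem ij d'_def by auto
      obtain u v where uv: "g i = {u..v}" "u \<le> v" using Icc m by blast
      obtain s t where st: "g j = {s..t}" "s \<le> t" using Icc m by blast
      have "{u<..<v} \<inter> {s<..<t} = {}"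
        using division_ofD(5)[OF d(1) m(1,2) ne] uv st by (simp add: interior_atLeastAtMost_real)
      then have "\<not> max u s < min v t"
        using dense[of "max u s" "min v t"] by (metis Int_iff empty_iff greaterThanLessThan_iff max_less_iff_conj min_less_iff_conj)
      then show "Sup (g i) \<le> Inf (g j) \<or> Sup (g j) \<le> Inf (g i)"
        using uv st m by (auto simp: max_def min_def split: if_splits)
    qed
    have sub: "sum F d' = sum F d" if "\<And>K. K \<in> d \<Longrightarrow> Inf K = Sup K \<Longrightarrow> F K = 0" for F :: "real set \<Rightarrow> real"
    proof (rule sum.mono_neutral_left[OF fin(1)])
      show "\<forall>K\<in>d - d'. F K = 0"
      proof
        fix K assume K: "K \<in> d - d'"
        then obtain u v where "K = {u..v}" "u \<le> v" using Icc by blast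
        then show "F K = 0" using K that[of K] unfolding d'_def by auto
      qed
    qed (auto simp: d'_def)
    have re: "(\<Sum>i<card d'. F (g i)) = sum F d'" for F :: "real set \<Rightarrow> real"
      using sum.reindex_bij_betw[OF g] .
    have 3: "(\<Sum>i<card d'. Sup (g i) - Inf (g i)) < \<delta>"
      unfolding re[of "\<lambda>K. Sup K - Inf K"] using small by (subst sub) auto
    have "(\<Sum>i<card d'. \<bar>h (Sup (g i)) - h (Inf (g i))\<bar>) < e"
      using \<delta>[THEN spec[of _ "card d'"], THEN spec[of _ "\<lambda>i. Inf (g i)"], THEN spec[of _ "\<lambda>i. Sup (g i)"]] 1 2 3
      by (elim mp) (intro conjI)
    then show "(\<Sum>K\<in>d. \<bar>interval_incr h K\<bar>) < e"
      unfolding interval_incr_def re[of "\<lambda>K. \<bar>h (Sup K) - h (Inf K)\<bar>"] by (subst (asm) sub) auto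
  qed
qed

text \<open>A countable disjoint subfamily of the intervals covers \<open>S\<close> up to a null
  set. Each finite part of it is a division, so \<open>bnd\<close> limits its length by
  \<open>B\<close>, and the bound passes to the countable union. \<open>S\<close> is not assumed
  measurable, hence the measurable superset.\<close>

lemma Vitali_cover_bound:
  fixes S :: "real set"
  assumes cov: "\<And>x \<delta>. \<lbrakk>x \<in> S; 0 < \<delta>\<rbrakk> \<Longrightarrow> \<exists>u v. u < v \<and> v - u < \<delta> \<and> u \<le> x \<and> x \<le> v \<and> P {u..v}"
    and bnd: "\<And>F. \<lbrakk>F division_of \<Union>F; \<And>K. K \<in> F \<Longrightarrow> P K \<and> Inf K < Sup K\<rbrakk> \<Longrightarrow> (\<Sum>K\<in>F. Sup K - Inf K) \<le> B"
  shows "\<exists>T. S \<subseteq> T \<and> T \<in> lmeasurable \<and> measure lebesgue T \<le> B"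
proof -
  \<comment> \<open>The covering theorem is about balls over an index set, so an interval is indexed
    by its pair of end points and viewed as the ball around its midpoint.\<close>
  define K where "K = {(u,v). u < v \<and> P {u..v}}"
  let ?m = "\<lambda>i. (fst i + snd i)/2 :: real" and ?r = "\<lambda>i. (snd i - fst i)/2 :: real"
  define I where "I = (\<lambda>i. cball (?m i) (?r i))"
  have cb: "I i = {fst i..snd i}" for i
    unfolding I_def by (auto simp: cball_eq_atLeastAtMost field_simps)
  have r: "0 < ?r i" if "i \<in> K" for i using that by (auto simp: K_def)
  have S: "\<exists>i. i \<in> K \<and> x \<in> cball (?m i) (?r i) \<and> ?r i < d" if "x \<in> S" "0 < d" for x d
  proof -
    from cov[OF that] obtain u v where "u < v" "v - u < d" "u \<le> x" "x \<le> v" "P {u..v}" by blast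
    then show ?thesis
      by (intro exI[of _ "(u,v)"]) (auto simp: K_def dist_real_def abs_if field_simps)
  qed
  obtain C where C: "countable C" "C \<subseteq> K" "pairwise (\<lambda>i j. disjnt (I i) (I j)) C"
     and neg: "negligible(S - (\<Union>i \<in> C. I i))"
    unfolding I_def by (rule Vitali_covering_theorem_cballs[OF r S])
  have Int: "\<exists>u v. k = {u..v} \<and> u < v \<and> P k" if "k \<in> I ` C" for k
  proof -
    obtain i where i: "i \<in> C" "k = I i" using \<open>k \<in> I ` C\<close> by blast
    then have "i \<in> K" using C(2) by blast
    then have "fst i < snd i" "P {fst i..snd i}" by (auto simp: K_def)
    then show ?thesis unfolding i(2) cb by blast
  qed
  have dis: "k \<inter> l = {}" if kl: "k \<in> I ` C" "l \<in> I ` C" "k \<noteq> l" for k l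
  proof -
    obtain i j where "i \<in> C" "k = I i" "j \<in> C" "l = I j" using kl by blast
    moreover have "i \<noteq> j" using calculation \<open>k \<noteq> l\<close> by auto
    ultimately show ?thesis using pairwiseD[OF C(3)] by (auto simp: disjnt_def)
  qed
  have fb: "measure lebesgue (\<Union>D') \<le> B" if D': "D' \<subseteq> I ` C" "finite D'" for D'
  proof -
    have div: "D' division_of \<Union>D'"
    proof (rule division_ofI)
      fix k assume "k \<in> D'"
      with Int[of k] D' obtain u v where "k = {u..v}" "u < v" by blast
      then show "k \<noteq> {}" "\<exists>a b. k = cbox a b" by (force, metis box_real(2))
    next
      fix k l assume "k \<in> D'" "l \<in> D'" "k \<noteq> l"
      then have "k \<inter> l = {}" using dis[of k l] D' by blast
      then show "interior k \<inter> interior l = {}" using interior_subset[of k] interior_subset[of l] by auto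
    qed (use D' in auto)
    have "measure lebesgue (\<Union>D') \<le> (\<Sum>k\<in>D'. measure lebesgue k)"
    proof (rule measure_Union_le[OF D'(2)])
      fix k assume "k \<in> D'"
      with Int[of k] D' obtain u v where "k = {u..v}" "u < v" by blast
      then show "k \<in> sets lebesgue" by simp
    qed
    also have "\<dots> = (\<Sum>k\<in>D'. Sup k - Inf k)"
    proof (rule sum.cong)
      fix k assume "k \<in> D'"
      with Int[of k] D' obtain u v where "k = {u..v}" "u < v" by blast
      then show "measure lebesgue k = Sup k - Inf k" by simp
    qed simp
    also have "\<dots> \<le> B"
    proof (rule bnd[OF div])
      fix k assume "k \<in> D'"
      with Int[of k] D' obtain u v where "k = {u..v}" "u < v" "P k" by blast
      then show "P k \<and> Inf k < Sup k" by auto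
    qed
    finally show ?thesis .
  qed
  let ?U = "\<Union>(I ` C)"
  have "countable (I ` C)" using C by auto
  moreover have "k \<in> lmeasurable" if "k \<in> I ` C" for k
    using Int[OF that] by auto
  ultimately have Um: "?U \<in> lmeasurable" "measure lebesgue ?U \<le> B"
    using fmeasurable_Union_bound[OF _ _ fb] measure_Union_bound[OF _ _ fb] by blast+
  define N where "N = S - ?U"
  have N: "N \<in> lmeasurable" "measure lebesgue N = 0" using neg unfolding N_def
    by (simp_all add: negligible_imp_measurable negligible_imp_measure0)
  have "measure lebesgue (?U \<union> N) \<le> B"
    using measure_Un_le[of ?U lebesgue N] Um N by auto
  moreover have "?U \<union> N \<in> lmeasurable" using Um N by auto
  moreover have "S \<subseteq> ?U \<union> N" unfolding N_def by auto
  ultimately show ?thesis by blast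
qed

text \<open>
  Refining a division by subintervals on which the increment has the opposite sign (\<open>\<sigma>\<close> is the
  sign of the total increment) raises the variation by at least twice their increments.
\<close>

lemma sum_abs_incr_refine:
  fixes h :: "real \<Rightarrow> real"
  assumes k: "u \<le> v" and F: "F division_of \<Union>F" "\<Union>F \<subseteq> {u..v}"
    and opp: "\<And>K. K \<in> F \<Longrightarrow> \<sigma> * interval_incr h K \<le> - c * (Sup K - Inf K)"
    and \<sigma>: "\<bar>\<sigma>\<bar> = 1" "\<sigma> * (h v - h u) = \<bar>h v - h u\<bar>"
  shows "\<exists>q. q division_of {u..v} \<and>
    \<bar>interval_incr h {u..v}\<bar> + 2 * c * (\<Sum>K\<in>F. Sup K - Inf K) \<le> (\<Sum>K\<in>q. \<bar>interval_incr h K\<bar>)"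
proof -
  obtain q where q: "F \<subseteq> q" "q division_of {u..v}"
    using partial_division_extend_interval[of F u v] F by auto
  have fin: "finite q" using q by auto
  have "\<bar>h v - h u\<bar> = (\<Sum>K\<in>q. \<sigma> * interval_incr h K)"
    using sum_interval_incr[OF k q(2), of h] \<sigma> by (simp add: sum_distrib_left[symmetric])
  also have "\<dots> = (\<Sum>K\<in>q - F. \<sigma> * interval_incr h K) + (\<Sum>K\<in>F. \<sigma> * interval_incr h K)"
    by (rule sum.subset_diff[OF q(1) fin])
  also have "(\<Sum>K\<in>q - F. \<sigma> * interval_incr h K) \<le> (\<Sum>K\<in>q - F. \<bar>interval_incr h K\<bar>)"
    by (rule sum_mono) (metis \<sigma>(1) abs_ge_self abs_mult mult_1)
  finally have 1: "\<bar>h v - h u\<bar> \<le> (\<Sum>K\<in>q - F. \<bar>interval_incr h K\<bar>) + (\<Sum>K\<in>F. \<sigma> * interval_incr h K)"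
    by simp
  \<comment> \<open>On a member of \<open>F\<close> the signed increment is at most - c times the
    length, so replacing it by its absolute value gains at least 2 c times the length.\<close>
  have "(\<Sum>K\<in>F. \<bar>interval_incr h K\<bar>) \<ge> (\<Sum>K\<in>F. 2 * c * (Sup K - Inf K) + \<sigma> * interval_incr h K)"
  proof (rule sum_mono)
    fix K assume "K \<in> F"
    have "- (\<sigma> * interval_incr h K) \<le> \<bar>interval_incr h K\<bar>"
      by (metis \<sigma>(1) abs_ge_minus_self abs_mult mult_1)
    with opp[OF \<open>K \<in> F\<close>] show "2 * c * (Sup K - Inf K) + \<sigma> * interval_incr h K \<le> \<bar>interval_incr h K\<bar>"
      by (simp add: algebra_simps)
  qed
  then have 2: "(\<Sum>K\<in>F. \<bar>interval_incr h K\<bar>) \<ge> 2 * c * (\<Sum>K\<in>F. Sup K - Inf K) + (\<Sum>K\<in>F. \<sigma> * interval_incr h K)"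
    by (simp add: sum.distrib sum_distrib_left)
  have "(\<Sum>K\<in>q. \<bar>interval_incr h K\<bar>) = (\<Sum>K\<in>q - F. \<bar>interval_incr h K\<bar>) + (\<Sum>K\<in>F. \<bar>interval_incr h K\<bar>)"
    by (rule sum.subset_diff[OF q(1) fin])
  then show ?thesis using 1 2 q(2) k by (intro exI[of _ q]) auto
qed

text \<open>A one-point interval at a common end point may occur in the divisions of two neighbours,
  and the families would overlap. Such members are dropped; \<open>g\<close> vanishes on them, but
  the union may become a proper subset of \<open>S\<close>.\<close>

lemma division_refine:
  fixes g :: "real set \<Rightarrow> real"
  assumes d: "d division_of S" and q: "\<And>K. K \<in> d \<Longrightarrow> q K division_of K"
    and g: "\<And>K. Inf K = Sup K \<Longrightarrow> g K = 0"
  shows "\<exists>Q. Q division_of \<Union>Q \<and> \<Union>Q \<subseteq> S \<and> sum g Q = (\<Sum>K\<in>d. sum g (q K))"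
proof -
  define q' where "q' K = {L\<in>q K. Inf L < Sup L}" for K
  let ?Q = "\<Union>K\<in>d. q' K"
  have fin: "finite d" "\<And>K. K \<in> d \<Longrightarrow> finite (q' K)"
    using division_of_finite[OF d] division_of_finite[OF q] by (auto simp: q'_def)
  have Icc: "\<exists>u v. L = {u..v} \<and> u < v \<and> L \<subseteq> K" if KL: "K \<in> d" "L \<in> q' K" for K L
  proof -
    have L: "L \<in> q K" "Inf L < Sup L" using KL by (auto simp: q'_def)
    obtain u v where uv: "L = {u..v}" "u \<le> v" using division_of_realE[OF q[OF KL(1)] L(1)] .
    moreover have "L \<subseteq> K" using division_ofD(2)[OF q[OF KL(1)] L(1)] .
    ultimately show ?thesis using L by auto
  qed
  have dis: "interior L \<inter> interior M = {}"
    if KL: "K \<in> d" "L \<in> q' K" "K' \<in> d" "M \<in> q' K'" "K \<noteq> K' \<or> L \<noteq> M" for K L K' M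
  proof (cases "K = K'")
    case True
    then show ?thesis using KL division_ofD(5)[OF q[OF KL(1)], of L M] by (auto simp: q'_def)
  next
    case False
    then have "interior K \<inter> interior K' = {}" using division_ofD(5)[OF d] KL by blast
    moreover have "interior L \<subseteq> interior K" "interior M \<subseteq> interior K'"
      using Icc[OF KL(1,2)] Icc[OF KL(3,4)] by (auto intro!: interior_mono)
    ultimately show ?thesis by blast
  qed
  have "?Q division_of \<Union>?Q"
  proof (rule division_ofI)
    show "finite ?Q" using fin by blast
    fix L assume "L \<in> ?Q"
    then obtain K where K: "K \<in> d" "L \<in> q' K" by blast
    then obtain u v where "L = {u..v}" "u < v" using Icc by blast
    then show "L \<noteq> {}" "\<exists>a b. L = cbox a b" by (force, metis box_real(2))
    fix M assume "M \<in> ?Q" "L \<noteq> M"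
    then show "interior L \<inter> interior M = {}" using dis[OF K] by blast
  qed auto
  moreover have "\<Union>?Q \<subseteq> S"
  proof
    fix x assume "x \<in> \<Union>?Q"
    then obtain K L where "K \<in> d" "L \<in> q' K" "x \<in> L" by blast
    then show "x \<in> S" using Icc[of K L] division_ofD(2)[OF d, of K] by blast
  qed
  moreover have "sum g ?Q = (\<Sum>K\<in>d. sum g (q' K))"
  proof (rule sum.UNION_disjoint[OF fin(1)])
    show "\<forall>K\<in>d. finite (q' K)" using fin by auto
    show "\<forall>K\<in>d. \<forall>K'\<in>d. K \<noteq> K' \<longrightarrow> q' K \<inter> q' K' = {}"
    proof (intro ballI impI)
      fix K K' assume K: "K \<in> d" "K' \<in> d" "K \<noteq> K'"
      show "q' K \<inter> q' K' = {}"
      proof (rule equals0I)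
        fix L assume L: "L \<in> q' K \<inter> q' K'"
        then have "interior L = {}" using dis[of K L K' L] K by blast
        moreover obtain u v where "L = {u..v}" "u < v" using Icc K L by blast
        ultimately show False by (simp add: interior_atLeastAtMost_real)
      qed
    qed
  qed
  moreover have "sum g (q' K) = sum g (q K)" if K: "K \<in> d" for K
  proof (rule sum.mono_neutral_left)
    show "finite (q K)" using q[OF K] by auto
    show "q' K \<subseteq> q K" by (auto simp: q'_def)
    show "\<forall>L\<in>q K - q' K. g L = 0"
    proof
      fix L assume L: "L \<in> q K - q' K"
      then obtain u v where "L = {u..v}" "u \<le> v" using division_of_realE[OF q[OF K], of L] by blast
      then show "g L = 0" using L g[of L] by (auto simp: q'_def)
    qed
  qed
  ultimately show ?thesis by (intro exI[of _ ?Q]) (auto intro: sum.cong)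
qed

text \<open>
  Fix a division whose variation is within \<open>c * e\<close> of the supremum.  Around almost every point of
  \<open>S\<close> there are small intervals on which \<open>h\<close> moves against the sign of its increment on the
  surrounding member of the division.  A disjoint family of these can be used to refine the division,
  so that its total length is at most \<open>e\<close>; the Vitali covering theorem then yields the claim.
\<close>

lemma negligible_opposite_slopes:
  fixes h :: "real \<Rightarrow> real"
  assumes bv: "\<And>d S. \<lbrakk>d division_of S; S \<subseteq> {a..b}\<rbrakk> \<Longrightarrow> (\<Sum>K\<in>d. \<bar>interval_incr h K\<bar>) \<le> M"
    and "0 < c" and S: "S \<subseteq> {a<..<b}"
    and up: "\<And>x \<delta>. \<lbrakk>x \<in> S; 0 < \<delta>\<rbrakk> \<Longrightarrow> \<exists>u v. u < v \<and> v - u < \<delta> \<and> u \<le> x \<and> x \<le> v \<and> c * (v - u) \<le> h v - h u"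
    and dn: "\<And>x \<delta>. \<lbrakk>x \<in> S; 0 < \<delta>\<rbrakk> \<Longrightarrow> \<exists>u v. u < v \<and> v - u < \<delta> \<and> u \<le> x \<and> x \<le> v \<and> h v - h u \<le> - c * (v - u)"
  shows "negligible S"
  unfolding negligible_outer_le
proof (intro allI impI)
  fix e :: real assume "0 < e"
  let ?var = "\<lambda>d. \<Sum>K\<in>d. \<bar>interval_incr h K\<bar>"
  \<comment> \<open>The supremum runs over divisions of arbitrary subsets of \<open>{a..b}\<close>,
    because the refinement built below drops degenerate pieces and is only known to lie inside the
    interval.\<close>
  define X where "X = {?var d | d. d division_of \<Union>d \<and> \<Union>d \<subseteq> {a..b}}"
  have ne: "X \<noteq> {}" unfolding X_def by (auto intro!: exI[of _ "{}"])
  have bdd: "bdd_above X" unfolding X_def by (auto intro!: bdd_aboveI[of _ M] bv)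
  have "Sup X - c * e < Sup X" using \<open>0 < c\<close> \<open>0 < e\<close> by simp
  then obtain y where "y \<in> X" "Sup X - c * e < y" using less_cSupE[OF _ ne] by blast
  then obtain d0 where d0: "d0 division_of \<Union>d0" "\<Union>d0 \<subseteq> {a..b}" "Sup X - c * e < ?var d0"
    unfolding X_def by blast
  \<comment> \<open>Extending to all of \<open>{a..b}\<close> does not decrease the variation and
    puts every point of \<open>S\<close> into some member.\<close>
  obtain d where d: "d0 \<subseteq> d" "d division_of {a..b}"
    using partial_division_extend_interval[of d0 a b] d0 by auto
  have fin: "finite d" using d by auto
  have "?var d0 \<le> ?var d" by (rule sum_mono2[OF fin d(1)]) auto
  with d0 have var_d: "Sup X - c * e < ?var d" by simp
  define \<sigma> where "\<sigma> K = (if 0 \<le> interval_incr h K then 1 else - 1 :: real)" for K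
  define P where "P J \<longleftrightarrow> (\<exists>K\<in>d. J \<subseteq> K \<and> \<sigma> K * interval_incr h J \<le> - c * (Sup J - Inf J))" for J
  \<comment> \<open>Away from the end points of the members a small interval around \<open>x\<close>
    stays in a single member, whose sign it has to oppose. The finite set of end points is added
    back at the end.\<close>
  define N where "N = Inf ` d \<union> Sup ` d"
  have N: "negligible N" unfolding N_def using fin by (intro negligible_finite) auto
  have "\<exists>T. S - N \<subseteq> T \<and> T \<in> lmeasurable \<and> measure lebesgue T \<le> e"
  proof (rule Vitali_cover_bound)
    fix x \<delta> :: real assume x: "x \<in> S - N" and "0 < \<delta>"
    then have "x \<in> {a..b}" using S by auto
    then obtain K where K: "K \<in> d" "x \<in> K" using division_ofD(6)[OF d(2)] by blast
    then obtain s t where st: "K = {s..t}" "s \<le> t" using division_of_realE[OF d(2)] by metis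
    then have "s \<in> N" "t \<in> N" using K unfolding N_def by (metis UnI1 cInf_atLeastAtMost imageI, metis UnI2 cSup_atLeastAtMost imageI)
    then have "s \<noteq> x" "t \<noteq> x" using x by auto
    then have "s < x" "x < t" using K st by auto
    define \<eta> where "\<eta> = Min {\<delta>, x - s, t - x}"
    have \<eta>: "0 < \<eta>" "\<eta> \<le> \<delta>" "\<eta> \<le> x - s" "\<eta> \<le> t - x"
      using \<open>s < x\<close> \<open>x < t\<close> \<open>0 < \<delta>\<close> unfolding \<eta>_def by auto
    have "\<exists>u v. u < v \<and> v - u < \<eta> \<and> u \<le> x \<and> x \<le> v \<and> \<sigma> K * (h v - h u) \<le> - c * (v - u)"
    proof (cases "0 \<le> interval_incr h K")
      case True
      then show ?thesis using dn[of x \<eta>] x \<eta> by (simp add: \<sigma>_def)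
    next
      case False
      then show ?thesis using up[of x \<eta>] x \<eta> by (simp add: \<sigma>_def algebra_simps)
    qed
    then obtain u v where uv: "u < v" "v - u < \<eta>" "u \<le> x" "x \<le> v" "\<sigma> K * (h v - h u) \<le> - c * (v - u)"
      by blast
    have "P {u..v}" unfolding P_def
      using uv \<eta> st K(1) by (intro bexI[of _ K]) auto
    then show "\<exists>u v. u < v \<and> v - u < \<delta> \<and> u \<le> x \<and> x \<le> v \<and> P {u..v}"
      using uv \<eta> by (intro exI[of _ u] exI[of _ v]) auto
  next
    fix F assume F: "F division_of \<Union>F" and FP: "\<And>J. J \<in> F \<Longrightarrow> P J \<and> Inf J < Sup J"
    have "\<forall>J\<in>F. \<exists>K. K \<in> d \<and> J \<subseteq> K \<and> \<sigma> K * interval_incr h J \<le> - c * (Sup J - Inf J)"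
      using FP unfolding P_def by blast
    \<comment> \<open>\<open>\<kappa> J\<close> is a member of \<open>d\<close> containing
      \<open>J\<close>; grouping \<open>F\<close> by it lets each member be refined
      separately.\<close>
    then obtain \<kappa> where \<kappa>: "\<And>J. J \<in> F \<Longrightarrow> \<kappa> J \<in> d \<and> J \<subseteq> \<kappa> J \<and> \<sigma> (\<kappa> J) * interval_incr h J \<le> - c * (Sup J - Inf J)"
      by metis
    let ?F = "\<lambda>K. {J\<in>F. \<kappa> J = K}"
    have "\<exists>q. q division_of K \<and>
      \<bar>interval_incr h K\<bar> + 2 * c * (\<Sum>J\<in>?F K. Sup J - Inf J) \<le> ?var q" if K: "K \<in> d" for K
    proof -
      obtain s t where st: "K = {s..t}" "s \<le> t" using division_of_realE[OF d(2) K] .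
      show ?thesis unfolding st(1)
      proof (rule sum_abs_incr_refine[where \<sigma> = "\<sigma> K", OF st(2)])
        show "?F {s..t} division_of \<Union>(?F {s..t})"
          by (rule division_of_subset[OF F]) auto
        show "\<Union>(?F {s..t}) \<subseteq> {s..t}" using \<kappa> by auto
        show "\<sigma> K * interval_incr h J \<le> - c * (Sup J - Inf J)" if "J \<in> ?F {s..t}" for J
          using that \<kappa>[of J] st by auto
        show "\<bar>\<sigma> K\<bar> = 1" "\<sigma> K * (h t - h s) = \<bar>h t - h s\<bar>"
          using st by (auto simp: \<sigma>_def)
      qed
    qed
    then have "\<forall>K\<in>d. \<exists>q. q division_of K \<and>
      \<bar>interval_incr h K\<bar> + 2 * c * (\<Sum>J\<in>?F K. Sup J - Inf J) \<le> ?var q" by (rule ballI)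
    from bchoice[OF this] obtain q where q0: "\<forall>K\<in>d. q K division_of K \<and>
      \<bar>interval_incr h K\<bar> + 2 * c * (\<Sum>J\<in>?F K. Sup J - Inf J) \<le> ?var (q K)" ..
    have q: "q K division_of K"
      and qs: "\<bar>interval_incr h K\<bar> + 2 * c * (\<Sum>J\<in>?F K. Sup J - Inf J) \<le> ?var (q K)" if "K \<in> d" for K
      using q0 that by blast+
    obtain Q where Q: "Q division_of \<Union>Q" "\<Union>Q \<subseteq> {a..b}" "?var Q = (\<Sum>K\<in>d. ?var (q K))"
      using division_refine[OF d(2) q, of "\<lambda>K. \<bar>interval_incr h K\<bar>"] by (auto simp: interval_incr_def)
    have "?var d + 2 * c * (\<Sum>J\<in>F. Sup J - Inf J)
        = (\<Sum>K\<in>d. \<bar>interval_incr h K\<bar> + 2 * c * (\<Sum>J\<in>?F K. Sup J - Inf J))"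
      using sum.group[of F d \<kappa> "\<lambda>J. Sup J - Inf J"] F fin \<kappa>
      by (simp add: sum.distrib sum_distrib_left[symmetric] image_subset_iff division_of_finite)
    also have "\<dots> \<le> ?var Q" unfolding Q(3) by (rule sum_mono) (rule qs)
    also have "?var Q \<in> X" using Q(1,2) unfolding X_def by blast
    then have "?var Q \<le> Sup X" by (rule cSup_upper[OF _ bdd])
    \<comment> \<open>The refined variation is at most \<open>Sup X\<close>, while that of
      \<open>d\<close> exceeds \<open>Sup X - c * e\<close>.\<close>
    finally have "2 * c * (\<Sum>J\<in>F. Sup J - Inf J) \<le> c * e" using var_d by linarith
    then have "2 * (\<Sum>J\<in>F. Sup J - Inf J) \<le> e" using \<open>0 < c\<close> by (simp add: mult.assoc mult.left_commute[of 2])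
    moreover have "0 \<le> (\<Sum>J\<in>F. Sup J - Inf J)" using FP by (intro sum_nonneg) (simp add: less_imp_le)
    ultimately show "(\<Sum>J\<in>F. Sup J - Inf J) \<le> e" by simp
  qed
  then obtain T where T: "S - N \<subseteq> T" "T \<in> lmeasurable" "measure lebesgue T \<le> e" by blast
  have Nm: "N \<in> lmeasurable" "measure lebesgue N = 0" using N
    by (simp_all add: negligible_imp_measurable negligible_imp_measure0)
  have "measure lebesgue (T \<union> N) \<le> e"
    using measure_Un_le[of T lebesgue N] T Nm by auto
  then show "\<exists>T. S \<subseteq> T \<and> T \<in> lmeasurable \<and> measure lebesgue T \<le> e"
    using T Nm by (intro exI[of _ "T \<union> N"]) auto
qed

text \<open>Disjoint intervals whose increments are at least q times their length have total length
  at most M / q, and q is arbitrary.\<close>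

lemma negligible_infinite_slopes:
  fixes h :: "real \<Rightarrow> real"
  assumes bv: "\<And>d S. \<lbrakk>d division_of S; S \<subseteq> {a..b}\<rbrakk> \<Longrightarrow> (\<Sum>K\<in>d. \<bar>interval_incr h K\<bar>) \<le> M"
    and S: "S \<subseteq> {a<..<b}"
    and inf: "\<And>x \<delta> q. \<lbrakk>x \<in> S; 0 < \<delta>; 0 < q\<rbrakk> \<Longrightarrow>
      \<exists>u v. u < v \<and> v - u < \<delta> \<and> u \<le> x \<and> x \<le> v \<and> q * (v - u) \<le> \<bar>h v - h u\<bar>"
  shows "negligible S"
  unfolding negligible_outer_le
proof (intro allI impI)
  fix e :: real assume "0 < e"
  have "0 \<le> M" using bv[of "{}" "{}"] by simp
  \<comment> \<open>Here q e = M + 1 is at least M; the added 1 keeps \<open>q\<close> positive when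
    M = 0.\<close>
  define q where "q = (M + 1) / e"
  have "0 < q" using \<open>0 < e\<close> \<open>0 \<le> M\<close> by (simp add: q_def)
  let ?P = "\<lambda>J. J \<subseteq> {a..b} \<and> q * (Sup J - Inf J) \<le> \<bar>interval_incr h J\<bar>"
  show "\<exists>T. S \<subseteq> T \<and> T \<in> lmeasurable \<and> measure lebesgue T \<le> e"
  proof (rule Vitali_cover_bound)
    fix x \<delta> :: real assume x: "x \<in> S" and "0 < \<delta>"
    have "a < x" "x < b" using x S by auto
    define \<eta> where "\<eta> = Min {\<delta>, x - a, b - x}"
    have \<eta>: "0 < \<eta>" "\<eta> \<le> \<delta>" "\<eta> \<le> x - a" "\<eta> \<le> b - x"
      using \<open>a < x\<close> \<open>x < b\<close> \<open>0 < \<delta>\<close> unfolding \<eta>_def by auto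
    obtain u v where uv: "u < v" "v - u < \<eta>" "u \<le> x" "x \<le> v" "q * (v - u) \<le> \<bar>h v - h u\<bar>"
      using inf[OF x \<eta>(1) \<open>0 < q\<close>] by blast
    then show "\<exists>u v. u < v \<and> v - u < \<delta> \<and> u \<le> x \<and> x \<le> v \<and> ?P {u..v}"
      using \<eta> by (intro exI[of _ u] exI[of _ v]) auto
  next
    fix F assume F: "F division_of \<Union>F" and FP: "\<And>J. J \<in> F \<Longrightarrow> ?P J \<and> Inf J < Sup J"
    have "q * (\<Sum>J\<in>F. Sup J - Inf J) \<le> (\<Sum>J\<in>F. \<bar>interval_incr h J\<bar>)"
      unfolding sum_distrib_left by (rule sum_mono) (use FP in blast)
    also have "\<dots> \<le> M" by (rule bv[OF F]) (use FP in blast)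
    also have "\<dots> \<le> q * e" using \<open>0 < e\<close> by (simp add: q_def)
    finally show "(\<Sum>J\<in>F. Sup J - Inf J) \<le> e" using \<open>0 < q\<close> by simp
  qed
qed

section \<open>Difference quotients and differentiability almost everywhere\<close>

lemma frequently_slope:
  fixes h :: "real \<Rightarrow> real"
  assumes fr: "\<exists>\<^sub>F y in at x. R ((h y - h x) / (y - x))" and "0 < \<delta>"
  shows "\<exists>u v. u < v \<and> v - u < \<delta> \<and> u \<le> x \<and> x \<le> v \<and> R ((h v - h u) / (v - u))"
proof -
  have "\<forall>\<^sub>F y in at x. y \<noteq> x \<and> dist y x < \<delta>"
    unfolding eventually_at using \<open>0 < \<delta>\<close> by auto
  from frequently_ex[OF frequently_eventually_frequently[OF fr this]]
  obtain y where y: "R ((h y - h x) / (y - x))" "y \<noteq> x" "dist y x < \<delta>" by blast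
  show ?thesis
  proof (cases "x < y")
    case True
    then show ?thesis using y by (intro exI[of _ x] exI[of _ y]) (auto simp: dist_real_def)
  next
    case False
    moreover have "(h x - h y) / (x - y) = (h y - h x) / (y - x)"
      by (metis minus_diff_eq minus_divide_divide)
    ultimately show ?thesis using y by (intro exI[of _ y] exI[of _ x]) (auto simp: dist_real_def)
  qed
qed

text \<open>Compare the lower and upper limits of the difference quotient. If they agree, the common
  value is infinite, as a finite one would be the derivative; otherwise two rationals fit strictly
  in between. Rationals keep the number of exceptional sets countable.\<close>

lemma not_differentiable_slopes:
  fixes h :: "real \<Rightarrow> real"
  assumes nd: "\<not> h differentiable (at x)"
  defines "s \<equiv> \<lambda>y. (h y - h x) / (y - x)"
  shows "(\<forall>q>0. \<exists>\<^sub>F y in at x. q < \<bar>s y\<bar>) \<or>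
    (\<exists>p q::rat. p < q \<and> (\<exists>\<^sub>F y in at x. of_rat q < s y) \<and> (\<exists>\<^sub>F y in at x. s y < of_rat p))"
proof -
  let ?L = "Limsup (at x) (\<lambda>y. ereal (s y))" and ?l = "Liminf (at x) (\<lambda>y. ereal (s y))"
  have le: "?l \<le> ?L" by (rule Liminf_le_Limsup) simp
  show ?thesis
  proof (cases "?l = ?L")
    case True
    then have lim: "((\<lambda>y. ereal (s y)) \<longlongrightarrow> ?l) (at x)"
      by (intro Liminf_eq_Limsup) auto
    have "\<exists>\<^sub>F y in at x. q < \<bar>s y\<bar>" if "0 < q" for q
    proof (cases ?l)
      case (real r)
      then have "(s \<longlongrightarrow> r) (at x)" using lim by simp
      then have "(h has_field_derivative r) (at x)" unfolding s_def by (simp add: has_field_derivative_iff)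
      then show ?thesis using nd real_differentiable_def by blast
    next
      case PInf
      then have "\<forall>\<^sub>F y in at x. ereal q < ereal (s y)" using lim by (simp add: tendsto_PInfty)
      then have "\<forall>\<^sub>F y in at x. q < \<bar>s y\<bar>" by (rule eventually_mono) auto
      then show ?thesis by (intro eventually_frequently) auto
    next
      case MInf
      then have "\<forall>\<^sub>F y in at x. ereal (s y) < ereal (- q)" using lim tendsto_MInfty by metis
      then have "\<forall>\<^sub>F y in at x. q < \<bar>s y\<bar>" by (rule eventually_mono) auto
      then show ?thesis by (intro eventually_frequently) auto
    qed
    then show ?thesis by blast
  next
    case False
    with le have "?l < ?L" by simp
    then obtain p where p: "?l < ereal (of_rat p)" "ereal (of_rat p) < ?L" using ereal_dense3 by blast
    then obtain q where q: "ereal (of_rat p) < ereal (of_rat q)" "ereal (of_rat q) < ?L" using ereal_dense3 by blast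
    have "\<exists>\<^sub>F y in at x. of_rat q < s y"
    proof (rule ccontr)
      assume "\<not> ?thesis"
      then have "\<forall>\<^sub>F y in at x. ereal (s y) \<le> ereal (of_rat q)"
        by (simp add: not_frequently not_less)
      then have "?L \<le> ereal (of_rat q)" by (rule Limsup_bounded)
      then show False using q by simp
    qed
    moreover have "\<exists>\<^sub>F y in at x. s y < of_rat p"
    proof (rule ccontr)
      assume "\<not> ?thesis"
      then have "\<forall>\<^sub>F y in at x. ereal (of_rat p) \<le> ereal (s y)"
        by (simp add: not_frequently not_less)
      then have "ereal (of_rat p) \<le> ?l" by (rule Liminf_bounded)
      then show False using p by simp
    qed
    moreover have "p < q" using q(1) by (simp add: of_rat_less)
    ultimately show ?thesis by blast
  qed
qed

lemma bounded_variation_differentiable_ae: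
  fixes h :: "real \<Rightarrow> real"
  assumes "a < b"
    and bv: "\<And>d S. \<lbrakk>d division_of S; S \<subseteq> {a..b}\<rbrakk> \<Longrightarrow> (\<Sum>K\<in>d. \<bar>interval_incr h K\<bar>) \<le> M"
  shows "negligible {x\<in>{a<..<b}. \<not> h differentiable (at x)}"
proof -
  define s where "s x y = (h y - h x) / (y - x)" for x y
  define Z where "Z = {x\<in>{a<..<b}. \<forall>q>0. \<exists>\<^sub>F y in at x. q < \<bar>s x y\<bar>}"
  define Y where "Y p q = {x\<in>{a<..<b}. (\<exists>\<^sub>F y in at x. of_rat q < s x y) \<and> (\<exists>\<^sub>F y in at x. s x y < of_rat p)}"
    for p q :: rat
  have "negligible Z"
  proof (rule negligible_infinite_slopes[OF bv])
    show "Z \<subseteq> {a<..<b}" by (auto simp: Z_def)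
    fix x \<delta> q :: real assume "x \<in> Z" "0 < \<delta>" "0 < q"
    then have "\<exists>\<^sub>F y in at x. q < \<bar>(h y - h x) / (y - x)\<bar>" unfolding Z_def s_def by blast
    from frequently_slope[where R = "\<lambda>r. q < \<bar>r\<bar>", OF this \<open>0 < \<delta>\<close>]
    obtain u v where uv: "u < v" "v - u < \<delta>" "u \<le> x" "x \<le> v" "q < \<bar>(h v - h u) / (v - u)\<bar>" by blast
    then have "q * (v - u) \<le> \<bar>h v - h u\<bar>" by (simp add: abs_divide pos_less_divide_eq)
    then show "\<exists>u v. u < v \<and> v - u < \<delta> \<and> u \<le> x \<and> x \<le> v \<and> q * (v - u) \<le> \<bar>h v - h u\<bar>"
      using uv by blast
  qed
  moreover have "negligible (Y p q)" if "p < q" for p q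
  proof -
    \<comment> \<open>Subtracting the linear function whose slope is the midpoint of p and q turns
      slopes above q and below p into slopes above c and below - c, the symmetric situation of
      \<open>negligible_opposite_slopes\<close>. The variation grows by at most \<bar>m\<bar> (b -
      a).\<close>
    define m where "m = (of_rat p + of_rat q) / (2::real)"
    define c where "c = (of_rat q - of_rat p) / (2::real)"
    define g where "g x = h x - m * x" for x
    have mc: "m + c = of_rat q" "m - c = of_rat p"
      unfolding m_def c_def by (simp_all add: field_simps)
    have incr: "interval_incr g K = interval_incr h K - m * (Sup K - Inf K)" for K
      by (simp add: interval_incr_def g_def algebra_simps)
    have slope: "(g v - g u) / (v - u) = (h v - h u) / (v - u) - m" if "u < v" for u v
      using that by (simp add: g_def field_simps)
    show ?thesis
    proof (rule negligible_opposite_slopes)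
      show "0 < c" using that by (simp add: c_def of_rat_less)
      show "Y p q \<subseteq> {a<..<b}" by (auto simp: Y_def)
    next
      fix d S assume d: "d division_of S" "S \<subseteq> {a..b}"
      have "(\<Sum>K\<in>d. \<bar>interval_incr g K\<bar>) \<le> (\<Sum>K\<in>d. \<bar>interval_incr h K\<bar> + \<bar>m\<bar> * (Sup K - Inf K))"
      proof (rule sum_mono)
        fix K assume "K \<in> d"
        then obtain u v where "K = {u..v}" "u \<le> v" using division_of_realE[OF d(1)] by metis
        then have "\<bar>m * (Sup K - Inf K)\<bar> = \<bar>m\<bar> * (Sup K - Inf K)" by (simp add: abs_mult)
        then show "\<bar>interval_incr g K\<bar> \<le> \<bar>interval_incr h K\<bar> + \<bar>m\<bar> * (Sup K - Inf K)"
          unfolding incr by linarith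
      qed
      also have "\<dots> = (\<Sum>K\<in>d. \<bar>interval_incr h K\<bar>) + \<bar>m\<bar> * (\<Sum>K\<in>d. Sup K - Inf K)"
        by (simp add: sum.distrib sum_distrib_left)
      also have "\<dots> \<le> M + \<bar>m\<bar> * (b - a)"
        using sum_Sup_Inf_le[OF d] \<open>a < b\<close> by (intro add_mono bv[OF d] mult_left_mono) auto
      finally show "(\<Sum>K\<in>d. \<bar>interval_incr g K\<bar>) \<le> M + \<bar>m\<bar> * (b - a)" .
    next
      fix x \<delta> :: real assume "x \<in> Y p q" "0 < \<delta>"
      then have "\<exists>\<^sub>F y in at x. of_rat q < (h y - h x) / (y - x)" unfolding Y_def s_def by blast
      from frequently_slope[where R = "\<lambda>r. of_rat q < r", OF this \<open>0 < \<delta>\<close>]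
      obtain u v where uv: "u < v" "v - u < \<delta>" "u \<le> x" "x \<le> v" "of_rat q < (h v - h u) / (v - u)" by blast
      then have "c < (g v - g u) / (v - u)" unfolding slope[OF uv(1)] mc(1)[symmetric] by simp
      then have "c * (v - u) \<le> g v - g u" using uv by (simp add: pos_less_divide_eq)
      then show "\<exists>u v. u < v \<and> v - u < \<delta> \<and> u \<le> x \<and> x \<le> v \<and> c * (v - u) \<le> g v - g u"
        using uv by blast
    next
      fix x \<delta> :: real assume "x \<in> Y p q" "0 < \<delta>"
      then have "\<exists>\<^sub>F y in at x. (h y - h x) / (y - x) < of_rat p" unfolding Y_def s_def by blast
      from frequently_slope[where R = "\<lambda>r. r < of_rat p", OF this \<open>0 < \<delta>\<close>]
      obtain u v where uv: "u < v" "v - u < \<delta>" "u \<le> x" "x \<le> v" "(h v - h u) / (v - u) < of_rat p" by blast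
      then have "(g v - g u) / (v - u) < - c" unfolding slope[OF uv(1)] mc(2)[symmetric] by simp
      then have "g v - g u \<le> - c * (v - u)" using uv by (simp add: pos_divide_less_eq)
      then show "\<exists>u v. u < v \<and> v - u < \<delta> \<and> u \<le> x \<and> x \<le> v \<and> g v - g u \<le> - c * (v - u)"
        using uv by blast
    qed
  qed
  then have "negligible (\<Union>((\<lambda>(p,q). Y p q) ` {(p,q). p < q}))"
    by (intro negligible_countable_Union) auto
  ultimately have "negligible (Z \<union> \<Union>((\<lambda>(p,q). Y p q) ` {(p,q). p < q}))"
    by (rule negligible_Un)
  then show ?thesis
  proof (rule negligible_subset)
    show "{x\<in>{a<..<b}. \<not> h differentiable (at x)} \<subseteq> Z \<union> \<Union>((\<lambda>(p,q). Y p q) ` {(p,q). p < q})"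
    proof
      fix x assume x: "x \<in> {x\<in>{a<..<b}. \<not> h differentiable (at x)}"
      with not_differentiable_slopes[of h x]
      have "x \<in> Z \<or> (\<exists>p q. p < q \<and> x \<in> Y p q)" unfolding Z_def Y_def s_def by simp
      then show "x \<in> Z \<union> \<Union>((\<lambda>(p,q). Y p q) ` {(p,q). p < q})" by blast
    qed
  qed
qed

lemma abs_cont_on_subset:
  assumes "abs_cont_on a b h" "a \<le> c" "d \<le> b"
  shows "abs_cont_on c d h"
  unfolding abs_cont_on_def
proof (intro allI impI)
  fix e :: real assume "0 < e"
  from assms(1)[unfolded abs_cont_on_def, THEN spec, THEN mp, OF this]
  obtain \<delta> where "\<delta> > 0" and \<delta>: "\<forall>(n::nat) u v. (\<forall>i<n. a \<le> u i \<and> u i \<le> v i \<and> v i \<le> b) \<and>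
        (\<forall>i<n. \<forall>j<n. i \<noteq> j \<longrightarrow> v i \<le> u j \<or> v j \<le> u i) \<and>
        (\<Sum>i<n. v i - u i) < \<delta> \<longrightarrow> (\<Sum>i<n. \<bar>h (v i) - h (u i)\<bar>) < e"
    by (elim exE conjE)
  have "(\<Sum>i<n. \<bar>h (v i) - h (u i)\<bar>) < e"
    if uv: "(\<forall>i<n. c \<le> u i \<and> u i \<le> v i \<and> v i \<le> d) \<and>
        (\<forall>i<n. \<forall>j<n. i \<noteq> j \<longrightarrow> v i \<le> u j \<or> v j \<le> u i) \<and>
        (\<Sum>i<n. v i - u i) < \<delta>" for n :: nat and u v
  proof -
    have "\<forall>i<n. a \<le> u i \<and> u i \<le> v i \<and> v i \<le> b" using uv assms(2,3) by (meson order_trans)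
    then show ?thesis using \<delta>[THEN spec[of _ n], THEN spec[of _ u], THEN spec[of _ v]] uv
      by (elim mp) (intro conjI; elim conjE; assumption)
  qed
  then show "\<exists>\<delta>>0. \<forall>(n::nat) u v. (\<forall>i<n. c \<le> u i \<and> u i \<le> v i \<and> v i \<le> d) \<and>
        (\<forall>i<n. \<forall>j<n. i \<noteq> j \<longrightarrow> v i \<le> u j \<or> v j \<le> u i) \<and>
        (\<Sum>i<n. v i - u i) < \<delta> \<longrightarrow> (\<Sum>i<n. \<bar>h (v i) - h (u i)\<bar>) < e"
    using \<open>0 < \<delta>\<close> by (intro exI[of _ \<delta>]) (intro conjI allI impI; assumption)
qed

text \<open>The case e = 1 of absolute continuity. Differentiability and absolute integrability are
  local properties, so a variation bound on short intervals is all that they call for.\<close>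

lemma abs_cont_on_bounded_variation:
  assumes "abs_cont_on a b h"
  obtains \<delta> where "0 < \<delta>"
    "\<And>c d D S. \<lbrakk>a \<le> c; c \<le> d; d \<le> b; d - c < \<delta>; D division_of S; S \<subseteq> {c..d}\<rbrakk>
      \<Longrightarrow> (\<Sum>K\<in>D. \<bar>interval_incr h K\<bar>) \<le> 1"
proof -
  obtain \<delta> where \<delta>: "0 < \<delta>"
    "\<And>d S. \<lbrakk>d division_of S; S \<subseteq> {a..b}; (\<Sum>K\<in>d. Sup K - Inf K) < \<delta>\<rbrakk>
      \<Longrightarrow> (\<Sum>K\<in>d. \<bar>interval_incr h K\<bar>) < 1"
    using abs_cont_on_division[OF assms, of 1] by auto
  show thesis
  proof (rule that[OF \<delta>(1)])
    fix c d D S assume D: "a \<le> c" "c \<le> d" "d \<le> b" "d - c < \<delta>" "D division_of S" "S \<subseteq> {c..d}"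
    have "(\<Sum>K\<in>D. \<bar>interval_incr h K\<bar>) < 1"
    proof (rule \<delta>(2)[OF D(5)])
      show "S \<subseteq> {a..b}" using D by (meson atLeastatMost_subset_iff order_trans)
      show "(\<Sum>K\<in>D. Sup K - Inf K) < \<delta>" using sum_Sup_Inf_le[OF D(5,6,2)] D(4) by simp
    qed
    then show "(\<Sum>K\<in>D. \<bar>interval_incr h K\<bar>) \<le> 1" by simp
  qed
qed

lemma abs_cont_on_differentiable_ae:
  assumes "abs_cont_on a b h"
  shows "negligible {x\<in>{a<..<b}. \<not> h differentiable (at x)}" (is "negligible ?S")
  unfolding locally_negligible_alt[of ?S]
proof
  fix x assume x: "x \<in> ?S"
  obtain \<delta> where \<delta>: "0 < \<delta>"
    "\<And>c d D S. \<lbrakk>a \<le> c; c \<le> d; d \<le> b; d - c < \<delta>; D division_of S; S \<subseteq> {c..d}\<rbrakk>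
      \<Longrightarrow> (\<Sum>K\<in>D. \<bar>interval_incr h K\<bar>) \<le> 1"
    by (rule abs_cont_on_bounded_variation[OF assms]) (rule that)
  \<comment> \<open>The interval around \<open>x\<close> has length 2 \<eta>, which must be strictly
    below \<delta>.\<close>
  define \<eta> where "\<eta> = Min {\<delta> / 3, x - a, b - x}"
  have "0 < \<eta>" "\<eta> \<le> \<delta> / 3" "\<eta> \<le> x - a" "\<eta> \<le> b - x"
    using x \<delta>(1) unfolding \<eta>_def by (auto simp: min_def)
  then have \<eta>: "0 < \<eta>" "2 * \<eta> < \<delta>" "a \<le> x - \<eta>" "x + \<eta> \<le> b" "x - \<eta> < x + \<eta>" using \<delta>(1) by auto
  have "negligible {y\<in>{x-\<eta><..<x+\<eta>}. \<not> h differentiable (at y)}"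
    using \<eta> by (intro bounded_variation_differentiable_ae[where M = 1] \<delta>(2)[of "x - \<eta>" "x + \<eta>"]) auto
  then have "negligible (?S \<inter> {x-\<eta><..<x+\<eta>})"
    by (rule negligible_subset) auto
  then show "\<exists>U. openin (top_of_set ?S) U \<and> x \<in> U \<and> negligible U"
    using x \<eta> by (intro exI[of _ "?S \<inter> {x-\<eta><..<x+\<eta>}"]) (auto intro: openin_open_Int)
qed

section \<open>The fundamental theorem of calculus for absolutely continuous functions\<close>

text \<open>At tags in the null set \<open>N\<close> no derivative is available. The radii confine
  their intervals to an open superset of \<open>N\<close> of measure below \<delta>, and absolute
  continuity makes the sum of the increments small. At this point mere bounded variation would not
  do.\<close>

lemma abs_cont_on_sum_tags:
  fixes h :: "real \<Rightarrow> real"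
  assumes ac: "abs_cont_on a b h" and N: "negligible N" and "0 < e"
  shows "\<exists>r. (\<forall>x. 0 < r x) \<and>
    (\<forall>p. p tagged_partial_division_of {a..b} \<and> (\<forall>(x, K)\<in>p. x \<in> N \<and> K \<subseteq> ball x (r x))
      \<longrightarrow> (\<Sum>(x,K)\<in>p. \<bar>interval_incr h K\<bar>) < e)"
proof -
  obtain \<delta> where \<delta>: "0 < \<delta>"
    "\<And>d S. \<lbrakk>d division_of S; S \<subseteq> {a..b}; (\<Sum>K\<in>d. Sup K - Inf K) < \<delta>\<rbrakk>
      \<Longrightarrow> (\<Sum>K\<in>d. \<bar>interval_incr h K\<bar>) < e"
    by (rule abs_cont_on_division[OF ac \<open>0 < e\<close>]) (rule that)
  obtain U where U: "open U" "N \<subseteq> U" "U - N \<in> lmeasurable" "emeasure lebesgue (U - N) < ennreal \<delta>"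
    using sets_lebesgue_outer_open[OF negligible_imp_sets[OF N] \<delta>(1)] .
  have Nm: "N \<in> lmeasurable" "measure lebesgue N = 0" using N
    by (simp_all add: negligible_imp_measurable negligible_imp_measure0)
  have "U = (U - N) \<union> N" using U by blast
  then have Um: "U \<in> lmeasurable" using U(3) Nm(1) by (metis fmeasurable.Un)
  have "measure lebesgue U = measure lebesgue ((U - N) \<union> N)" using U(2) by (simp add: Un_absorb2)
  also have "\<dots> \<le> measure lebesgue (U - N)"
    using measure_Un_le[of "U - N" lebesgue N] U(3) Nm by auto
  also have "\<dots> < \<delta>"
    using U(3,4) \<delta>(1) by (simp add: emeasure_eq_measure2 ennreal_less_iff)
  finally have U\<delta>: "measure lebesgue U < \<delta>" .
  have "\<exists>r>0. x \<in> N \<longrightarrow> ball x r \<subseteq> U" for x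
    using U(1,2) by (cases "x \<in> N") (auto simp: open_contains_ball intro: exI[of _ 1])
  then obtain r where r: "\<And>x. 0 < r x" "\<And>x. x \<in> N \<Longrightarrow> ball x (r x) \<subseteq> U" by metis
  show ?thesis
  proof (intro exI[of _ r] conjI allI impI; (elim conjE)?)
    show "0 < r x" for x by (rule r(1))
    fix p assume p: "p tagged_partial_division_of {a..b}"
      and "\<forall>(x, K)\<in>p. x \<in> N \<and> K \<subseteq> ball x (r x)"
    then have pN: "\<And>x K. (x, K) \<in> p \<Longrightarrow> x \<in> N \<and> K \<subseteq> ball x (r x)" by blast
    let ?d = "snd ` p"
    have d: "?d division_of \<Union>?d" by (rule partial_division_of_tagged_division[OF p])
    have fin: "finite ?d" using d by auto
    have dU: "K \<subseteq> U" "K \<subseteq> {a..b}" if "K \<in> ?d" for K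
    proof -
      obtain x where xK: "(x, K) \<in> p" using \<open>K \<in> ?d\<close> by auto
      then show "K \<subseteq> U" using pN[OF xK] r(2)[of x] by blast
      show "K \<subseteq> {a..b}" using tagged_partial_division_ofD(3)[OF p xK] .
    qed
    have Icc: "\<exists>u v. K = {u..v} \<and> u \<le> v" if "K \<in> ?d" for K
      by (rule division_of_realE[OF d that]) blast
    have "(\<Sum>K\<in>?d. Sup K - Inf K) = (\<Sum>K\<in>?d. measure lebesgue K)"
    proof (rule sum.cong)
      fix K assume "K \<in> ?d"
      then obtain u v where "K = {u..v}" "u \<le> v" using Icc by blast
      then show "Sup K - Inf K = measure lebesgue K" by simp
    qed simp
    also have "\<dots> = measure lebesgue (\<Union>?d)"
    proof (rule measure_negligible_finite_Union[symmetric, OF fin])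
      show "K \<in> lmeasurable" if "K \<in> ?d" for K using Icc[OF that] by auto
      show "pairwise (\<lambda>K L. negligible (K \<inter> L)) ?d"
      proof (rule pairwiseI)
        fix K L assume KL: "K \<in> ?d" "L \<in> ?d" "K \<noteq> L"
        obtain u v where K: "K = {u..v}" using Icc[OF KL(1)] by blast
        obtain s t where L: "L = {s..t}" using Icc[OF KL(2)] by blast
        have "interior K \<inter> interior L = {}" using division_ofD(5)[OF d KL] .
        then show "negligible (K \<inter> L)"
          unfolding K L by (simp add: negligible_convex_interior convex_Int)
      qed
    qed
    also have "\<dots> \<le> measure lebesgue U"
    proof (rule measure_mono_fmeasurable[OF _ _ Um])
      show "\<Union>?d \<subseteq> U" using dU by blast
      show "\<Union>?d \<in> sets lebesgue" 
      proof (rule sets.finite_Union[OF fin], rule subsetI)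
        fix K assume "K \<in> ?d"
        then obtain u v where "K = {u..v}" using Icc by blast
        then show "K \<in> sets lebesgue" by simp
      qed
    qed
    finally have small: "(\<Sum>K\<in>?d. Sup K - Inf K) < \<delta>" using U\<delta> by simp
    \<comment> \<open>Passing from pairs to sets: two tags can share an interval only if it is
      degenerate, where the summand is 0. The case distinction supplies the value 0 on the empty set
      as well.\<close>
    let ?g = "\<lambda>K. if K = {} then 0 else \<bar>interval_incr h K\<bar>"
    have "(\<Sum>(x,K)\<in>p. \<bar>interval_incr h K\<bar>) = (\<Sum>(x,K)\<in>p. ?g K)"
      by (rule sum.cong) (auto dest: tagged_partial_division_ofD(2)[OF p])
    also have "\<dots> = (\<Sum>K\<in>?d. ?g K)"
    proof (rule sum.over_tagged_division_lemma)
      show "p tagged_division_of \<Union>?d" by (rule tagged_partial_division_of_Union_self[OF p])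
      fix u v :: real assume "box u v = {}"
      then have "v \<le> u" by simp
      then show "?g (cbox u v) = 0" by (cases "u = v") (auto simp: interval_incr_def)
    qed
    also have "\<dots> = (\<Sum>K\<in>?d. \<bar>interval_incr h K\<bar>)"
      by (rule sum.cong) (use division_ofD(3)[OF d] in auto)
    also have "\<dots> < e" by (rule \<delta>(2)[OF d _ small]) (use dU in blast)
    finally show "(\<Sum>(x,K)\<in>p. \<bar>interval_incr h K\<bar>) < e" .
  qed
qed

text \<open>At tags outside \<open>N\<close> the gauge comes from differentiability, at tags in
  \<open>N\<close> from \<open>abs_cont_on_sum_tags\<close>. Each of the two parts of a Riemann sum
  differs from the sum of its increments by at most e / 2, the second one strictly less.\<close>

theorem abs_cont_on_has_integral:
  fixes h :: "real \<Rightarrow> real"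
  assumes "a \<le> b" and ac: "abs_cont_on a b h" and N: "negligible N"
    and der: "\<And>t. t \<in> {a..b} - N \<Longrightarrow> (h has_real_derivative h' t) (at t within {a..b})"
  shows "(h' has_integral h b - h a) {a..b}"
proof -
  \<comment> \<open>With the value 0 on \<open>N\<close>, a tag there leaves only the increment to
    be estimated; the change on a null set is undone at the end.\<close>
  define g where "g t = (if t \<in> N then 0 else h' t)" for t
  have "(g has_integral h b - h a) {a..b}"
    unfolding has_integral_real
  proof (intro allI impI)
    fix e :: real assume "0 < e"
    \<comment> \<open>The tags outside \<open>N\<close> contribute at most e1 (b - a); the + 1
      avoids a division by 0 when a = b.\<close>
    define e1 where "e1 = e / (2 * (b - a + 1))"
    have e1: "0 < e1" "e1 * (b - a) \<le> e / 2"
      using \<open>0 < e\<close> \<open>a \<le> b\<close> by (auto simp: e1_def field_simps)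
    have "\<exists>d>0. x \<in> {a..b} - N \<longrightarrow> (\<forall>y\<in>{a..b}. \<bar>y - x\<bar> < d \<longrightarrow> \<bar>h y - h x - h' x * (y - x)\<bar> \<le> e1 * \<bar>y - x\<bar>)" for x
    proof (cases "x \<in> {a..b} - N")
      case True
      from der[OF this] show ?thesis using e1(1)
        unfolding has_field_derivative_def has_derivative_within_alt by (auto simp: dist_real_def)
    qed (auto intro: exI[of _ 1])
    then obtain d where d: "\<And>x. 0 < d x" "\<And>x y. \<lbrakk>x \<in> {a..b} - N; y \<in> {a..b}; \<bar>y - x\<bar> < d x\<rbrakk>
        \<Longrightarrow> \<bar>h y - h x - h' x * (y - x)\<bar> \<le> e1 * \<bar>y - x\<bar>"
      by metis
    have "0 < e / 2" using \<open>0 < e\<close> by simp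
    from abs_cont_on_sum_tags[OF ac N this] obtain r where r1: "\<forall>x. 0 < r x" and
      r2: "\<forall>p. p tagged_partial_division_of {a..b} \<and> (\<forall>(x, K)\<in>p. x \<in> N \<and> K \<subseteq> ball x (r x))
        \<longrightarrow> (\<Sum>(x,K)\<in>p. \<bar>interval_incr h K\<bar>) < e / 2"
      by (elim exE conjE)
    define \<gamma> where "\<gamma> x = ball x (if x \<in> N then r x else d x)" for x
    have "gauge \<gamma>" unfolding \<gamma>_def using r1 d(1) by (intro gauge_ball_dependent) auto
    have est: "norm ((\<Sum>(x,K)\<in>p. measure lborel K *\<^sub>R g x) - (h b - h a)) < e"
      if p: "p tagged_division_of {a..b}" and fine: "\<gamma> fine p" for p
    proof -
      have fin: "finite p" using p by auto
      define A where "A = {(x,K)\<in>p. x \<in> N}"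
      have A: "A \<subseteq> p" by (auto simp: A_def)
      have pt: "p tagged_partial_division_of {a..b}" using p by (simp add: tagged_division_of_def)
      have bad: "(\<Sum>(x,K)\<in>A. \<bar>interval_incr h K\<bar>) < e / 2"
      proof (rule r2[THEN spec, THEN mp], intro conjI ballI, goal_cases)
        case 1
        show ?case by (rule tagged_partial_division_subset[OF pt A])
      next
        case (2 z)
        then show ?case using fineD[OF fine] by (fastforce simp: A_def \<gamma>_def)
      qed
      have good: "\<bar>measure lborel K *\<^sub>R g x - interval_incr h K\<bar> \<le> e1 * (Sup K - Inf K)"
        if xK: "(x, K) \<in> p - A" for x K
      proof -
        have "(x, K) \<in> p" "x \<notin> N" using xK by (auto simp: A_def)
        note K = tagged_division_ofD(2-4)[OF p this(1)]
        obtain u v where "K = cbox u v" using K by blast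
        then have uv: "K = {u..v}" "u \<le> x" "x \<le> v" using K(1) by auto
        have ab: "u \<in> {a..b}" "v \<in> {a..b}" "x \<in> {a..b} - N" using K(1,2) uv \<open>x \<notin> N\<close> by auto
        have "K \<subseteq> ball x (d x)" using fineD[OF fine \<open>(x,K) \<in> p\<close>] \<open>x \<notin> N\<close> by (simp add: \<gamma>_def)
        moreover have "u \<in> K" "v \<in> K" using uv by auto
        ultimately have "u \<in> ball x (d x)" "v \<in> ball x (d x)" by blast+
        then have "\<bar>u - x\<bar> < d x" "\<bar>v - x\<bar> < d x" by (auto simp: dist_real_def)
        from d(2)[OF ab(3,1) this(1)] d(2)[OF ab(3,2) this(2)]
        have "\<bar>h u - h x - h' x * (u - x)\<bar> \<le> e1 * (x - u)" "\<bar>h v - h x - h' x * (v - x)\<bar> \<le> e1 * (v - x)"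
          using uv by auto
        \<comment> \<open>Straddle estimate: the tag lies between u and v, so the errors of the
          linear approximation at the two end points add up to at most e1 (v - u).\<close>
        moreover have "measure lborel K *\<^sub>R g x - interval_incr h K
            = (h u - h x - h' x * (u - x)) - (h v - h x - h' x * (v - x))"
          using uv \<open>x \<notin> N\<close> by (simp add: g_def algebra_simps)
        moreover have "e1 * (Sup K - Inf K) = e1 * (x - u) + e1 * (v - x)"
          using uv by (simp add: algebra_simps)
        ultimately show ?thesis by linarith
      qed
      have "(\<Sum>(x,K)\<in>p - A. e1 * (Sup K - Inf K)) \<le> (\<Sum>(x,K)\<in>p. e1 * (Sup K - Inf K))"
      proof (rule sum_mono2[OF fin])
        fix z assume "z \<in> p - (p - A)"
        then obtain x K where z: "z = (x, K)" "(x, K) \<in> p" by (cases z) auto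
        note K = tagged_division_ofD(2-4)[OF p this(2)]
        obtain u v where "K = cbox u v" using K by blast
        then show "0 \<le> (case z of (x, K) \<Rightarrow> e1 * (Sup K - Inf K))" using K(1) z e1(1) by auto
      qed auto
      also have "\<dots> = e1 * (b - a)"
        using additive_tagged_division_1[OF \<open>a \<le> b\<close> p, of "\<lambda>x. x"]
        by (simp add: sum_distrib_left[symmetric] case_prod_unfold)
      finally have good_sum: "(\<Sum>(x,K)\<in>p - A. e1 * (Sup K - Inf K)) \<le> e / 2" using e1(2) by simp
      have "(\<Sum>(x,K)\<in>p. measure lborel K *\<^sub>R g x) - (h b - h a) = (\<Sum>(x,K)\<in>p. measure lborel K *\<^sub>R g x - interval_incr h K)"
        using additive_tagged_division_1[OF \<open>a \<le> b\<close> p, of h]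
        by (simp add: sum_subtractf case_prod_unfold interval_incr_def)
      also have "\<dots> = (\<Sum>(x,K)\<in>p - A. measure lborel K *\<^sub>R g x - interval_incr h K) + (\<Sum>(x,K)\<in>A. measure lborel K *\<^sub>R g x - interval_incr h K)"
        by (rule sum.subset_diff[OF A fin])
      also have "norm \<dots> \<le> (\<Sum>(x,K)\<in>p - A. e1 * (Sup K - Inf K)) + (\<Sum>(x,K)\<in>A. \<bar>interval_incr h K\<bar>)"
      proof (rule norm_triangle_mono)
        show "norm (\<Sum>(x,K)\<in>p - A. measure lborel K *\<^sub>R g x - interval_incr h K) \<le> (\<Sum>(x,K)\<in>p - A. e1 * (Sup K - Inf K))"
          by (rule sum_norm_le) (use good in auto)
        show "norm (\<Sum>(x,K)\<in>A. measure lborel K *\<^sub>R g x - interval_incr h K) \<le> (\<Sum>(x,K)\<in>A. \<bar>interval_incr h K\<bar>)"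
          by (rule sum_norm_le) (auto simp: A_def g_def)
      qed
      also have "\<dots> < e" using good_sum bad by simp
      finally show ?thesis .
    qed
    show "\<exists>\<gamma>. gauge \<gamma> \<and> (\<forall>p. p tagged_division_of {a..b} \<and> \<gamma> fine p \<longrightarrow>
        norm ((\<Sum>(x,K)\<in>p. measure lborel K *\<^sub>R g x) - (h b - h a)) < e)"
    proof (intro exI[of _ \<gamma>] conjI allI impI)
      show "gauge \<gamma>" by fact
    qed (elim conjE, rule est)
  qed
  then show ?thesis by (rule has_integral_spike[OF N, rotated]) (auto simp: g_def)
qed

text \<open>The integral of \<open>h'\<close> over an interval is the increment of \<open>h\<close>,
  so on short intervals the sums in the bounded variation criterion for absolute integrability are
  at most 1. Bisection extends this to \<open>{a..b}\<close>.\<close>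

theorem abs_cont_on_absolutely_integrable:
  fixes h :: "real \<Rightarrow> real"
  assumes "a \<le> b" and ac: "abs_cont_on a b h" and N: "negligible N"
    and der: "\<And>t. t \<in> {a..b} - N \<Longrightarrow> (h has_real_derivative h' t) (at t within {a..b})"
  shows "h' absolutely_integrable_on {a..b}"
proof -
  obtain \<delta> where \<delta>: "0 < \<delta>"
    "\<And>c d D S. \<lbrakk>a \<le> c; c \<le> d; d \<le> b; d - c < \<delta>; D division_of S; S \<subseteq> {c..d}\<rbrakk>
      \<Longrightarrow> (\<Sum>K\<in>D. \<bar>interval_incr h K\<bar>) \<le> 1"
    by (rule abs_cont_on_bounded_variation[OF ac]) (rule that)
  have int: "(h' has_integral h d - h c) {c..d}" if "a \<le> c" "c \<le> d" "d \<le> b" for c d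
  proof (rule abs_cont_on_has_integral[OF that(2) abs_cont_on_subset[OF ac that(1,3)] N])
    fix t assume "t \<in> {c..d} - N"
    then show "(h has_real_derivative h' t) (at t within {c..d})"
      using that by (intro DERIV_subset[OF der]) auto
  qed
  have small: "h' absolutely_integrable_on {c..d}" if cd: "a \<le> c" "c \<le> d" "d \<le> b" "d - c < \<delta>" for c d
    unfolding box_real[symmetric]
  proof (rule bounded_variation_absolutely_integrable_interval[where B = 1])
    show "h' integrable_on cbox c d" using int[OF cd(1-3)] by auto
    fix D assume D: "D division_of cbox c d"
    have "(\<Sum>K\<in>D. norm (integral K h')) = (\<Sum>K\<in>D. \<bar>interval_incr h K\<bar>)"
    proof (rule sum.cong)
      fix K assume K: "K \<in> D"
      obtain u v where uv: "K = {u..v}" "u \<le> v" using division_of_realE[OF D K] .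
      have "K \<subseteq> {c..d}" using division_ofD(2)[OF D K] by simp
      then have "a \<le> u" "v \<le> b" using uv cd by auto
      from integral_unique[OF int[OF this(1) uv(2) this(2)]] uv
      show "norm (integral K h') = \<bar>interval_incr h K\<bar>" by simp
    qed simp
    also have "\<dots> \<le> 1" by (rule \<delta>(2)[OF cd D]) simp
    finally show "(\<Sum>K\<in>D. norm (integral K h')) \<le> 1" .
  qed
  have "a \<le> a \<and> b \<le> b \<longrightarrow> h' absolutely_integrable_on {a..b}"
    using \<open>a \<le> b\<close>
  proof (induction rule: Bolzano[where P = "\<lambda>c d. a \<le> c \<and> d \<le> b \<longrightarrow> h' absolutely_integrable_on {c..d}"])
    case (trans c d e)
    show ?case
    proof
      assume ce: "a \<le> c \<and> e \<le> b"
      then have "h' absolutely_integrable_on {c..d}" "h' absolutely_integrable_on {d..e}"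
        using trans by auto
      then have "h' absolutely_integrable_on ({c..d} \<union> {d..e})" by (rule absolutely_integrable_Un)
      then show "h' absolutely_integrable_on {c..e}" using trans by (simp add: ivl_disj_un_two_touch(4))
    qed
  next
    case (local x)
    show ?case using \<delta>(1) small by (intro exI[of _ \<delta>]) auto
  qed
  then show ?thesis by simp
qed

section \<open>Closure properties of absolute continuity\<close>

text \<open>The epsilon-delta argument behind the closure properties: it suffices to bound
  increments by those of two functions already known to be absolutely continuous.\<close>

lemma abs_cont_on_dominated:
  assumes f: "abs_cont_on a b f" and g: "abs_cont_on a b g"
    and dom: "\<And>u v. \<lbrakk>a \<le> u; u \<le> v; v \<le> b\<rbrakk> \<Longrightarrow> \<bar>k v - k u\<bar> \<le> M * (\<bar>f v - f u\<bar> + \<bar>g v - g u\<bar>)"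
  shows "abs_cont_on a b k"
  unfolding abs_cont_on_def
proof (intro allI impI)
  fix e :: real assume "0 < e"
  \<comment> \<open>\<open>M\<close> may be 0, as for constants; \<open>B\<close> is a strictly
    positive replacement by which e can be divided.\<close>
  define B where "B = \<bar>M\<bar> + 1"
  have "0 < B" unfolding B_def by simp
  define e' where "e' = e / (2 * B)"
  have "0 < e'" using \<open>0 < e\<close> \<open>0 < B\<close> by (simp add: e'_def)
  from f[unfolded abs_cont_on_def, THEN spec, THEN mp, OF this]
  obtain \<delta>1 where "\<delta>1 > 0" and \<delta>1: "\<forall>(n::nat) u v. (\<forall>i<n. a \<le> u i \<and> u i \<le> v i \<and> v i \<le> b) \<and>
        (\<forall>i<n. \<forall>j<n. i \<noteq> j \<longrightarrow> v i \<le> u j \<or> v j \<le> u i) \<and>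
        (\<Sum>i<n. v i - u i) < \<delta>1 \<longrightarrow> (\<Sum>i<n. \<bar>f (v i) - f (u i)\<bar>) < e'"
    by (elim exE conjE)
  from g[unfolded abs_cont_on_def, THEN spec, THEN mp, OF \<open>0 < e'\<close>]
  obtain \<delta>2 where "\<delta>2 > 0" and \<delta>2: "\<forall>(n::nat) u v. (\<forall>i<n. a \<le> u i \<and> u i \<le> v i \<and> v i \<le> b) \<and>
        (\<forall>i<n. \<forall>j<n. i \<noteq> j \<longrightarrow> v i \<le> u j \<or> v j \<le> u i) \<and>
        (\<Sum>i<n. v i - u i) < \<delta>2 \<longrightarrow> (\<Sum>i<n. \<bar>g (v i) - g (u i)\<bar>) < e'"
    by (elim exE conjE)
  have main: "(\<Sum>i<n. \<bar>k (v i) - k (u i)\<bar>) < e"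
    if uv: "\<forall>i<n. a \<le> u i \<and> u i \<le> v i \<and> v i \<le> b"
        "\<forall>i<n. \<forall>j<n. i \<noteq> j \<longrightarrow> v i \<le> u j \<or> v j \<le> u i"
        "(\<Sum>i<n. v i - u i) < min \<delta>1 \<delta>2" for n :: nat and u v
  proof -
    have 1: "(\<Sum>i<n. \<bar>f (v i) - f (u i)\<bar>) < e'"
      by (rule \<delta>1[THEN spec, THEN spec, THEN spec, THEN mp]) (use uv in \<open>intro conjI; simp\<close>)
    have 2: "(\<Sum>i<n. \<bar>g (v i) - g (u i)\<bar>) < e'"
      by (rule \<delta>2[THEN spec, THEN spec, THEN spec, THEN mp]) (use uv in \<open>intro conjI; simp\<close>)
    have "(\<Sum>i<n. \<bar>k (v i) - k (u i)\<bar>) \<le> (\<Sum>i<n. B * (\<bar>f (v i) - f (u i)\<bar> + \<bar>g (v i) - g (u i)\<bar>))"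
    proof (rule sum_mono)
      fix i assume "i \<in> {..<n}"
      then have "\<bar>k (v i) - k (u i)\<bar> \<le> M * (\<bar>f (v i) - f (u i)\<bar> + \<bar>g (v i) - g (u i)\<bar>)"
        using uv(1) by (intro dom) auto
      also have "\<dots> \<le> B * (\<bar>f (v i) - f (u i)\<bar> + \<bar>g (v i) - g (u i)\<bar>)"
        unfolding B_def by (intro mult_right_mono) auto
      finally show "\<bar>k (v i) - k (u i)\<bar> \<le> B * (\<bar>f (v i) - f (u i)\<bar> + \<bar>g (v i) - g (u i)\<bar>)" .
    qed
    also have "\<dots> = B * ((\<Sum>i<n. \<bar>f (v i) - f (u i)\<bar>) + (\<Sum>i<n. \<bar>g (v i) - g (u i)\<bar>))"
      by (simp only: sum.distrib[symmetric] sum_distrib_left)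
    also have "\<dots> < B * (2 * e')"
      using 1 2 \<open>0 < B\<close> by (intro mult_strict_left_mono) auto
    also have "\<dots> = e" using \<open>0 < B\<close> by (simp add: e'_def)
    finally show ?thesis .
  qed
  show "\<exists>\<delta>>0. \<forall>(n::nat) u v. (\<forall>i<n. a \<le> u i \<and> u i \<le> v i \<and> v i \<le> b) \<and>
        (\<forall>i<n. \<forall>j<n. i \<noteq> j \<longrightarrow> v i \<le> u j \<or> v j \<le> u i) \<and>
        (\<Sum>i<n. v i - u i) < \<delta> \<longrightarrow> (\<Sum>i<n. \<bar>k (v i) - k (u i)\<bar>) < e"
  proof (intro exI[of _ "min \<delta>1 \<delta>2"] conjI allI impI)
    show "0 < min \<delta>1 \<delta>2" using \<open>0 < \<delta>1\<close> \<open>0 < \<delta>2\<close> by simp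
  qed (elim conjE, rule main)
qed

lemma abs_cont_on_ident: "abs_cont_on a b (\<lambda>x. x)"
  unfolding abs_cont_on_def
proof (intro allI impI)
  fix e :: real assume "0 < e"
  have "(\<Sum>i<n. \<bar>v i - u i\<bar>) < e"
    if "\<forall>i<n. a \<le> u i \<and> u i \<le> v i \<and> v i \<le> b" "(\<Sum>i<n. v i - u i) < e" for n :: nat and u v :: "nat \<Rightarrow> real"
  proof -
    have "(\<Sum>i<n. \<bar>v i - u i\<bar>) = (\<Sum>i<n. v i - u i)"
      by (rule sum.cong) (use that in auto)
    then show ?thesis using that by simp
  qed
  then show "\<exists>\<delta>>0. \<forall>(n::nat) u v. (\<forall>i<n. a \<le> u i \<and> u i \<le> v i \<and> v i \<le> b) \<and>
        (\<forall>i<n. \<forall>j<n. i \<noteq> j \<longrightarrow> v i \<le> u j \<or> v j \<le> u i) \<and>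
        (\<Sum>i<n. v i - u i) < \<delta> \<longrightarrow> (\<Sum>i<n. \<bar>v i - u i\<bar>) < e"
    using \<open>0 < e\<close> by (intro exI[of _ e]) auto
qed

lemma abs_cont_on_imp_continuous_on:
  assumes "abs_cont_on a b f"
  shows "continuous_on {a..b} f"
  unfolding continuous_on_iff
proof (intro ballI allI impI)
  fix x e :: real assume x: "x \<in> {a..b}" and "0 < e"
  from assms[unfolded abs_cont_on_def, THEN spec, THEN mp, OF \<open>0 < e\<close>]
  obtain \<delta> where "\<delta> > 0" and \<delta>: "\<forall>(n::nat) u v. (\<forall>i<n. a \<le> u i \<and> u i \<le> v i \<and> v i \<le> b) \<and>
        (\<forall>i<n. \<forall>j<n. i \<noteq> j \<longrightarrow> v i \<le> u j \<or> v j \<le> u i) \<and>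
        (\<Sum>i<n. v i - u i) < \<delta> \<longrightarrow> (\<Sum>i<n. \<bar>f (v i) - f (u i)\<bar>) < e"
    by (elim exE conjE)
  have "dist (f y) (f x) < e" if "y \<in> {a..b}" "dist y x < \<delta>" for y
    \<comment> \<open>The definition is applied to the single interval between \<open>x\<close> and
      \<open>y\<close>, whichever comes first.\<close>
    using \<delta>[THEN spec[of _ 1], THEN spec[of _ "\<lambda>_. min x y"], THEN spec[of _ "\<lambda>_. max x y"]] that x
    by (auto simp: dist_real_def min_def max_def abs_minus_commute split: if_splits)
  then show "\<exists>d>0. \<forall>x'\<in>{a..b}. dist x' x < d \<longrightarrow> dist (f x') (f x) < e"
    using \<open>0 < \<delta>\<close> by blast
qed

lemma abs_cont_on_bounded:
  assumes "abs_cont_on a b f"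
  obtains B where "0 < B" "\<And>x. a \<le> x \<Longrightarrow> x \<le> b \<Longrightarrow> \<bar>f x\<bar> \<le> B"
proof -
  have "bounded (f ` {a..b})"
    using abs_cont_on_imp_continuous_on[OF assms] by (simp add: compact_continuous_image compact_imp_bounded)
  then obtain B where "\<forall>y\<in>f ` {a..b}. norm y \<le> B" unfolding bounded_iff by blast
  then have "\<bar>f x\<bar> \<le> \<bar>B\<bar> + 1" if "a \<le> x" "x \<le> b" for x
    using that by (force dest: bspec[of _ _ "f x"])
  then show thesis by (intro that[of "\<bar>B\<bar> + 1"]) auto
qed

lemma abs_cont_on_add:
  assumes "abs_cont_on a b f" "abs_cont_on a b g"
  shows "abs_cont_on a b (\<lambda>x. f x + g x)"
  by (rule abs_cont_on_dominated[OF assms, where M = 1], unfold mult_1) linarith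

lemma abs_cont_on_diff:
  assumes "abs_cont_on a b f" "abs_cont_on a b g"
  shows "abs_cont_on a b (\<lambda>x. f x - g x)"
  by (rule abs_cont_on_dominated[OF assms, where M = 1], unfold mult_1) linarith

lemma abs_cont_on_const: "abs_cont_on a b (\<lambda>x. c)"
  by (rule abs_cont_on_dominated[OF abs_cont_on_ident abs_cont_on_ident, where M = 0]) simp

lemma abs_cont_on_mult:
  assumes f: "abs_cont_on a b f" and g: "abs_cont_on a b g"
  shows "abs_cont_on a b (\<lambda>x. f x * g x)"
proof -
  obtain A where A: "0 < A" "\<And>x. a \<le> x \<Longrightarrow> x \<le> b \<Longrightarrow> \<bar>f x\<bar> \<le> A"
    by (rule abs_cont_on_bounded[OF f]) (rule that)
  obtain B where B: "0 < B" "\<And>x. a \<le> x \<Longrightarrow> x \<le> b \<Longrightarrow> \<bar>g x\<bar> \<le> B"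
    by (rule abs_cont_on_bounded[OF g]) (rule that)
  show ?thesis
  proof (rule abs_cont_on_dominated[OF f g, where M = "A + B"])
    fix u v assume uv: "a \<le> u" "u \<le> v" "v \<le> b"
    have "f v * g v - f u * g u = f v * (g v - g u) + g u * (f v - f u)" by (simp add: algebra_simps)
    also have "\<bar>\<dots>\<bar> \<le> \<bar>f v\<bar> * \<bar>g v - g u\<bar> + \<bar>g u\<bar> * \<bar>f v - f u\<bar>"
      by (metis abs_mult abs_triangle_ineq)
    also have "\<dots> \<le> (A + B) * \<bar>g v - g u\<bar> + (A + B) * \<bar>f v - f u\<bar>"
      using A(2)[of v] B(2)[of u] A(1) B(1) uv by (intro add_mono mult_right_mono) auto
    finally show "\<bar>f v * g v - f u * g u\<bar> \<le> (A + B) * (\<bar>f v - f u\<bar> + \<bar>g v - g u\<bar>)"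
      by (simp add: algebra_simps)
  qed
qed

lemma abs_cont_on_inverse:
  assumes f: "abs_cont_on a b f" and nz: "\<And>x. a \<le> x \<Longrightarrow> x \<le> b \<Longrightarrow> f x \<noteq> 0"
  shows "abs_cont_on a b (\<lambda>x. inverse (f x))"
proof -
  have "bounded ((\<lambda>x. inverse (f x)) ` {a..b})"
    using abs_cont_on_imp_continuous_on[OF f] nz
    by (intro compact_imp_bounded compact_continuous_image continuous_on_inverse) auto
  then obtain B where B: "\<forall>y\<in>(\<lambda>x. inverse (f x)) ` {a..b}. norm y \<le> B" unfolding bounded_iff by blast
  show ?thesis
  proof (rule abs_cont_on_dominated[OF f f, where M = "B * B"])
    fix u v assume uv: "a \<le> u" "u \<le> v" "v \<le> b"
    have le: "\<bar>inverse (f u)\<bar> \<le> B" "\<bar>inverse (f v)\<bar> \<le> B" using B uv by auto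
    have "inverse (f v) - inverse (f u) = - (inverse (f u) * inverse (f v)) * (f v - f u)"
      using nz[of u] nz[of v] uv by (simp add: field_simps)
    also have "\<bar>\<dots>\<bar> = \<bar>inverse (f u)\<bar> * \<bar>inverse (f v)\<bar> * \<bar>f v - f u\<bar>" by (simp only: abs_mult abs_minus_cancel)
    also have "\<dots> \<le> B * B * \<bar>f v - f u\<bar>"
      using le order_trans[OF abs_ge_zero le(1)] by (intro mult_right_mono mult_mono) auto
    also have "\<dots> \<le> B * B * (\<bar>f v - f u\<bar> + \<bar>f v - f u\<bar>)" by (intro mult_left_mono) auto
    finally show "\<bar>inverse (f v) - inverse (f u)\<bar> \<le> B * B * (\<bar>f v - f u\<bar> + \<bar>f v - f u\<bar>)" .
  qed
qed

lemma AC_on_subset: "AC_on S f \<Longrightarrow> S' \<subseteq> S \<Longrightarrow> AC_on S' f"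
  unfolding AC_on_def by blast

lemma AC_on_const: "AC_on S (\<lambda>x. c)"
  by (simp add: AC_on_def abs_cont_on_const)

lemma AC_on_add: "AC_on S f \<Longrightarrow> AC_on S g \<Longrightarrow> AC_on S (\<lambda>x. f x + g x)"
  by (simp add: AC_on_def abs_cont_on_add)

lemma AC_on_diff: "AC_on S f \<Longrightarrow> AC_on S g \<Longrightarrow> AC_on S (\<lambda>x. f x - g x)"
  by (simp add: AC_on_def abs_cont_on_diff)

lemma AC_on_mult: "AC_on S f \<Longrightarrow> AC_on S g \<Longrightarrow> AC_on S (\<lambda>x. f x * g x)"
  by (simp add: AC_on_def abs_cont_on_mult)

lemma AC_on_minus: "AC_on S f \<Longrightarrow> AC_on S (\<lambda>x. - f x)"
  using AC_on_diff[OF AC_on_const[of S 0], of f] by simp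

lemma AC_on_inverse:
  assumes "AC_on S f" "\<And>x. x \<in> S \<Longrightarrow> f x \<noteq> 0"
  shows "AC_on S (\<lambda>x. inverse (f x))"
  unfolding AC_on_def
proof (intro allI impI)
  fix a b :: real assume ab: "a \<le> b" "{a..b} \<subseteq> S"
  show "abs_cont_on a b (\<lambda>x. inverse (f x))"
  proof (rule abs_cont_on_inverse)
    show "abs_cont_on a b f" using assms(1) ab by (simp add: AC_on_def)
    show "f x \<noteq> 0" if "a \<le> x" "x \<le> b" for x using assms(2)[of x] ab(2) that by auto
  qed
qed

lemma AC_on_divide:
  assumes "AC_on S f" "AC_on S g" "\<And>x. x \<in> S \<Longrightarrow> g x \<noteq> 0"
  shows "AC_on S (\<lambda>x. f x / g x)"
  using AC_on_mult[OF assms(1) AC_on_inverse[OF assms(2,3)]] by (simp add: divide_inverse)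

text \<open>On a compact subinterval the continuous derivative is bounded, so \<open>g\<close> is
  Lipschitz there.\<close>

lemma C1_on_imp_AC_on:
  assumes "C1_on S g g'"
  shows "AC_on S g"
  unfolding AC_on_def
proof (intro allI impI)
  fix a b :: real assume ab: "a \<le> b" "{a..b} \<subseteq> S"
  have "continuous_on {a..b} g'" using assms ab continuous_on_subset unfolding C1_on_def by blast
  then have "bounded (g' ` {a..b})" by (simp add: compact_continuous_image compact_imp_bounded)
  then obtain B where B: "\<forall>y\<in>g' ` {a..b}. norm y \<le> B" unfolding bounded_iff by blast
  show "abs_cont_on a b g"
  proof (rule abs_cont_on_dominated[OF abs_cont_on_ident abs_cont_on_const[of _ _ 0], where M = B])
    fix u v assume uv: "a \<le> u" "u \<le> v" "v \<le> b"
    have "norm (g v - g u) \<le> B * norm (v - u)"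
    proof (rule field_differentiable_bound[where S = "{a..b}" and f' = g'])
      show "(g has_field_derivative g' z) (at z within {a..b})" if "z \<in> {a..b}" for z
        using assms ab that unfolding C1_on_def by (meson DERIV_subset subsetD)
    qed (use B uv in auto)
    then show "\<bar>g v - g u\<bar> \<le> B * (\<bar>v - u\<bar> + \<bar>0 - 0\<bar>)" by simp
  qed
qed

section \<open>Functions on a half-open interval\<close>

text \<open>Treats finite and infinite \<open>x0\<close> alike. The condition c \<le> d keeps the
  whole tail inside the interval on which the functions are controlled.\<close>

lemma eventually_at_x0:
  assumes "ereal c < x0"
  shows "eventually P (at_x0 x0) \<longleftrightarrow> (\<exists>d\<ge>c. ereal d < x0 \<and> (\<forall>y. d < y \<longrightarrow> ereal y < x0 \<longrightarrow> P y))"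
proof (cases x0)
  case (real r)
  with assms have "c < r" by simp
  have "eventually P (at_x0 x0) \<longleftrightarrow> (\<exists>b<r. \<forall>y>b. y < r \<longrightarrow> P y)"
    using eventually_at_left[OF \<open>c < r\<close>] real by (simp add: at_x0_def)
  also have "\<dots> \<longleftrightarrow> (\<exists>d\<ge>c. d < r \<and> (\<forall>y>d. y < r \<longrightarrow> P y))"
  proof safe
    fix b assume "b < r" "\<forall>y>b. y < r \<longrightarrow> P y"
    then show "\<exists>d\<ge>c. d < r \<and> (\<forall>y>d. y < r \<longrightarrow> P y)"
      using \<open>c < r\<close> by (intro exI[of _ "max b c"]) auto
  qed blast
  finally show ?thesis using real by simp
next
  case PInf
  have "eventually P (at_x0 x0) \<longleftrightarrow> (\<exists>b. \<forall>y>b. P y)"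
    using PInf by (simp add: at_x0_def eventually_at_top_dense)
  also have "\<dots> \<longleftrightarrow> (\<exists>d\<ge>c. \<forall>y>d. P y)"
  proof safe
    fix b assume "\<forall>y>b. P y"
    then show "\<exists>d\<ge>c. \<forall>y>d. P y" by (intro exI[of _ "max b c"]) auto
  qed blast
  finally show ?thesis using PInf by simp
qed (use assms in auto)

lemma at_x0_neq_bot: "ereal c < x0 \<Longrightarrow> at_x0 x0 \<noteq> bot"
  by (cases x0) (auto simp: at_x0_def trivial_limit_at_left_real)

lemma eventually_at_x0_Ivl: "ereal c < x0 \<Longrightarrow> \<forall>\<^sub>F y in at_x0 x0. y \<in> OIvl c x0"
  unfolding eventually_at_x0 by (auto simp: OIvl_def)

lemma eventually_at_x0_ge: "ereal c < x0 \<Longrightarrow> \<forall>\<^sub>F y in at_x0 x0. c \<le> y \<and> ereal y < x0"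
  by (rule eventually_mono[OF eventually_at_x0_Ivl]) (auto simp: OIvl_def)

lemma Icc_subset_Ivl: "c \<le> x \<Longrightarrow> ereal b < x0 \<Longrightarrow> {x..b} \<subseteq> Ivl c x0"
  by (auto simp: Ivl_def intro: le_less_trans[of _ "ereal b"])

lemma OIvl_subset_Ivl: "OIvl c x0 \<subseteq> Ivl c x0"
  by (auto simp: Ivl_def OIvl_def)

lemma open_OIvl: "open (OIvl c x0)"
proof (cases x0)
  case (real r)
  then have "OIvl c x0 = {c<..<r}" by (auto simp: OIvl_def)
  then show ?thesis by simp
next
  case PInf
  then have "OIvl c x0 = {c<..}" by (auto simp: OIvl_def)
  then show ?thesis by simp
next
  case MInf
  then have "OIvl c x0 = {}" by (auto simp: OIvl_def)
  then show ?thesis by simp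
qed

lemma at_within_Ivl: "t \<in> OIvl c x0 \<Longrightarrow> at t within Ivl c x0 = at t"
  by (rule at_within_open_subset[OF _ open_OIvl OIvl_subset_Ivl])

lemma AC_on_imp_continuous_on:
  assumes "AC_on (Ivl c x0) h"
  shows "continuous_on (Ivl c x0) h"
  unfolding continuous_on_eq_continuous_within
proof
  fix x assume x: "x \<in> Ivl c x0"
  then obtain b where b: "x < b" "ereal b < x0"
    using ereal_dense2[of "ereal x" x0] by (auto simp: Ivl_def)
  have sub: "{c..b} \<subseteq> Ivl c x0" using b by (intro Icc_subset_Ivl) auto
  have "continuous_on {c..b} h"
    using assms sub x b unfolding AC_on_def by (intro abs_cont_on_imp_continuous_on) (auto simp: Ivl_def)
  then have "continuous (at x within {c..b}) h"
    using x b by (auto simp: continuous_on_eq_continuous_within Ivl_def)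
  moreover have "at x within Ivl c x0 = at x within {c..b}"
  proof (rule at_within_nhd[of _ "{..<b}"])
    show "Ivl c x0 \<inter> {..<b} - {x} = {c..b} \<inter> {..<b} - {x}"
      using sub by (auto simp: Ivl_def)
  qed (use b in auto)
  ultimately show "continuous (at x within Ivl c x0) h" by simp
qed

section \<open>Integrals and limits up to the end point\<close>

lemma AC_on_Ivl_FTC:
  assumes h: "AC_on (Ivl c x0) h" and N: "negligible N"
    and der: "\<And>t. t \<in> OIvl c x0 \<Longrightarrow> t \<notin> N \<Longrightarrow> (h has_real_derivative h' t) (at t)"
    and x: "c \<le> x" "x \<le> b" "ereal b < x0"
  shows "(h' has_integral h b - h x) {x..b}" "h' absolutely_integrable_on {x..b}"
proof -
  have sub: "{x..b} \<subseteq> Ivl c x0" using x by (intro Icc_subset_Ivl) auto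
  have ac: "abs_cont_on x b h" using h sub x unfolding AC_on_def by blast
  \<comment> \<open>Derivatives are known in the open interval only, and \<open>x\<close> may be its
    left end point \<open>c\<close>, so this point joins the null set.\<close>
  have N': "negligible (insert x N)" using N by (simp add: negligible_insert)
  have der': "(h has_real_derivative h' t) (at t within {x..b})" if "t \<in> {x..b} - insert x N" for t
  proof (rule has_field_derivative_at_within[OF der])
    show "t \<in> OIvl c x0" using that sub x by (force simp: OIvl_def Ivl_def)
  qed (use that in auto)
  show "(h' has_integral h b - h x) {x..b}"
    by (rule abs_cont_on_has_integral[OF x(2) ac N' der'])
  show "h' absolutely_integrable_on {x..b}"
    by (rule abs_cont_on_absolutely_integrable[OF x(2) ac N' der'])
qed

lemma AC_on_differentiable_ae:
  assumes h: "AC_on (Ivl c x0) h"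
  shows "negligible {t \<in> OIvl c x0. \<not> h differentiable (at t)}" (is "negligible ?S")
  unfolding locally_negligible_alt[of ?S]
proof
  fix x assume x: "x \<in> ?S"
  then obtain b where b: "x < b" "ereal b < x0"
    using ereal_dense2[of "ereal x" x0] by (auto simp: OIvl_def)
  have "c < x" using x by (simp add: OIvl_def)
  have "{c..b} \<subseteq> Ivl c x0" using b by (intro Icc_subset_Ivl) auto
  then have "abs_cont_on c b h" using h \<open>c < x\<close> b unfolding AC_on_def by simp
  then have "negligible {t \<in> {c<..<b}. \<not> h differentiable (at t)}"
    by (rule abs_cont_on_differentiable_ae)
  then have "negligible (?S \<inter> {c<..<b})"
    by (rule negligible_subset) auto
  then show "\<exists>U. openin (top_of_set ?S) U \<and> x \<in> U \<and> negligible U"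
    using x b \<open>c < x\<close> by (intro exI[of _ "?S \<inter> {c<..<b}"]) (auto intro: openin_open_Int)
qed

text \<open>The source of all improper integrals below: an antiderivative with a limit at
  \<open>x0\<close>. Up to sign it is applied to the quotients of \<open>R\<close> for (I) and to
  \<open>f1s\<close>, \<open>f2s\<close> and \<open>Fs\<close> for the integrals of L[f].\<close>

lemma imp_int_AC_on:
  assumes h: "AC_on (Ivl c x0) h" and N: "negligible N"
    and der: "\<And>t. t \<in> OIvl c x0 \<Longrightarrow> t \<notin> N \<Longrightarrow> (h has_real_derivative h' t) (at t)"
    and lim: "(h \<longlongrightarrow> l) (at_x0 x0)" and x: "x \<in> Ivl c x0"
  shows "imp_int x0 h' x (l - h x)"
  unfolding imp_int_def
proof (intro conjI allI impI)
  have x': "c \<le> x" "ereal x < x0" using x by (auto simp: Ivl_def)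
  show "h' absolutely_integrable_on {x..b}" if "x \<le> b \<and> ereal b < x0" for b
    using that x' by (intro AC_on_Ivl_FTC(2)[OF h N der]) auto
  have "((\<lambda>b. h b - h x) \<longlongrightarrow> l - h x) (at_x0 x0)" by (intro tendsto_intros lim)
  then show "((\<lambda>b. integral {x..b} h') \<longlongrightarrow> l - h x) (at_x0 x0)"
  proof (rule Lim_transform_eventually)
    show "\<forall>\<^sub>F b in at_x0 x0. h b - h x = integral {x..b} h'"
      using eventually_at_x0_ge[OF x'(2)]
    proof eventually_elim
      case (elim b)
      then show ?case using x' integral_unique[OF AC_on_Ivl_FTC(1)[OF h N der, of x b]] by simp
    qed
  qed
qed

text \<open>Connects the possibly conditional integral from \<open>t\<close> with the Lebesgue
  integral of the modulus over the larger set \<open>OIvl x x0\<close>, so that one bound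
  \<open>s\<close> serves all \<open>t\<close> beyond \<open>x\<close>.\<close>

lemma imp_int_abs_le:
  assumes g: "imp_int x0 g t v" and t: "t \<in> OIvl x x0" and "0 \<le> s"
    and le: "(\<integral>\<^sup>+ y \<in> OIvl x x0. ennreal \<bar>g y\<bar> \<partial>lebesgue) \<le> ennreal s"
  shows "\<bar>v\<bar> \<le> s"
proof -
  have t': "x < t" "ereal t < x0" using t by (auto simp: OIvl_def)
  have "norm v \<le> s"
  proof (rule Lim_norm_ubound)
    show "at_x0 x0 \<noteq> bot" using at_x0_neq_bot[OF t'(2)] .
    show "((\<lambda>b. integral {t..b} g) \<longlongrightarrow> v) (at_x0 x0)" using g by (simp add: imp_int_def)
    show "\<forall>\<^sub>F b in at_x0 x0. norm (integral {t..b} g) \<le> s"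
      using eventually_at_x0_ge[OF t'(2)]
    proof eventually_elim
      case (elim b)
      then have ai: "g absolutely_integrable_on {t..b}" using g by (simp add: imp_int_def)
      then have "integral {t..b} g = (\<integral>y. indicator {t..b} y *\<^sub>R g y \<partial>lebesgue)"
        using set_lebesgue_integral_eq_integral(2)[OF ai] by (simp add: set_lebesgue_integral_def)
      then have "ennreal (norm (integral {t..b} g)) \<le> (\<integral>\<^sup>+ y. ennreal (norm (indicator {t..b} y *\<^sub>R g y)) \<partial>lebesgue)"
        using integral_norm_bound_ennreal[OF ai[unfolded set_integrable_def]] by simp
      also have "\<dots> \<le> (\<integral>\<^sup>+ y \<in> OIvl x x0. ennreal \<bar>g y\<bar> \<partial>lebesgue)"
      proof (rule nn_integral_mono)
        fix y
        have "y \<in> OIvl x x0" if "y \<in> {t..b}"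
          using that t' elim le_less_trans[of "ereal y" "ereal b" x0] by (auto simp: OIvl_def)
        then show "ennreal (norm (indicator {t..b} y *\<^sub>R g y)) \<le> ennreal \<bar>g y\<bar> * indicator (OIvl x x0) y"
          by (auto simp: indicator_def)
      qed
      also have "\<dots> \<le> ennreal s" by (rule le)
      finally show ?case using \<open>0 \<le> s\<close> by simp
    qed
  qed
  then show ?thesis by simp
qed

text \<open>Off a null set the modulus of the derivative of u is at most s \<sigma> w', and \<sigma>
  w' is a nonnegative derivative, whose integral over \<open>{c..b}\<close> is \<sigma> (w b - w c).
  The constant sign of w' is what prevents any loss.\<close>

lemma AC_on_weighted_bound:
  assumes c: "ereal c < x0" and u: "AC_on (Ivl c x0) u" and w: "AC_on (Ivl c x0) w" and N: "negligible N"
    and du: "\<And>t. t \<in> OIvl c x0 \<Longrightarrow> t \<notin> N \<Longrightarrow> (u has_real_derivative w' t * k t) (at t)"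
    and dw: "\<And>t. t \<in> OIvl c x0 \<Longrightarrow> t \<notin> N \<Longrightarrow> (w has_real_derivative w' t) (at t)"
    and \<sigma>: "\<bar>\<sigma>\<bar> = 1" "\<And>t. t \<in> OIvl c x0 \<Longrightarrow> 0 \<le> \<sigma> * w' t"
    and bd: "\<And>t. t \<in> OIvl c x0 \<Longrightarrow> t \<notin> N \<Longrightarrow> \<bar>k t\<bar> \<le> s"
    and lim: "(u \<longlongrightarrow> 0) (at_x0 x0)" "(w \<longlongrightarrow> 0) (at_x0 x0)"
  shows "\<bar>u c\<bar> \<le> \<bar>w c\<bar> * s"
proof -
  let ?N = "insert c N"
  have N': "negligible ?N" using N by (simp add: negligible_insert)
  define p where "p t = (if t \<in> ?N then 0 else w' t * k t)" for t
  define q where "q t = (if t \<in> ?N then 0 else \<sigma> * w' t)" for t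
  have *: "\<bar>u b - u c\<bar> \<le> s * (\<sigma> * (w b - w c)) \<and> 0 \<le> \<sigma> * (w b - w c)" if b: "c \<le> b" "ereal b < x0" for b
  proof -
    have "((\<lambda>t. w' t * k t) has_integral u b - u c) {c..b}"
      by (rule AC_on_Ivl_FTC(1)[OF u N du order_refl b])
    then have p: "(p has_integral u b - u c) {c..b}"
      by (rule has_integral_spike[OF N', rotated]) (auto simp: p_def)
    have "(w' has_integral w b - w c) {c..b}"
      by (rule AC_on_Ivl_FTC(1)[OF w N dw order_refl b])
    then have "((\<lambda>t. \<sigma> * w' t) has_integral \<sigma> * (w b - w c)) {c..b}" by (rule has_integral_mult_right)
    then have q: "(q has_integral \<sigma> * (w b - w c)) {c..b}"
      by (rule has_integral_spike[OF N', rotated]) (auto simp: q_def)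
    have O: "t \<in> OIvl c x0" if "t \<in> {c..b}" "t \<notin> ?N" for t
      using that b le_less_trans[of "ereal t" "ereal b" x0] by (auto simp: OIvl_def)
    have pq: "\<bar>p t\<bar> \<le> s * q t" if "t \<in> {c..b}" for t
    proof (cases "t \<in> ?N")
      case False
      have "\<bar>w' t\<bar> = \<sigma> * w' t" using \<sigma>(1) \<sigma>(2)[OF O[OF that False]] by (auto simp: abs_if split: if_splits)
      then have "\<bar>w' t * k t\<bar> = \<sigma> * w' t * \<bar>k t\<bar>" by (simp add: abs_mult)
      also have "\<dots> \<le> \<sigma> * w' t * s"
        using bd[OF O[OF that False]] False \<sigma>(2)[OF O[OF that False]] by (intro mult_left_mono) auto
      finally show ?thesis using False by (simp add: p_def q_def mult.commute)
    qed (simp add: p_def q_def)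
    have q0: "0 \<le> q t" if "t \<in> {c..b}" for t
      using \<sigma>(2) O that by (simp add: q_def)
    have sq: "((\<lambda>t. s * q t) has_integral s * (\<sigma> * (w b - w c))) {c..b}" by (rule has_integral_mult_right[OF q])
    have "u b - u c \<le> s * (\<sigma> * (w b - w c))"
      by (rule has_integral_le[OF p sq]) (use pq in \<open>force simp: abs_le_iff\<close>)
    moreover have "- (u b - u c) \<le> s * (\<sigma> * (w b - w c))"
      by (rule has_integral_le[OF has_integral_neg[OF p] sq]) (use pq in \<open>force simp: abs_le_iff\<close>)
    moreover have "0 \<le> \<sigma> * (w b - w c)" by (rule has_integral_nonneg[OF q q0])
    ultimately show ?thesis by (simp add: abs_le_iff)
  qed
  have ev: "\<forall>\<^sub>F b in at_x0 x0. \<bar>u b - u c\<bar> \<le> s * (\<sigma> * (w b - w c)) \<and> 0 \<le> \<sigma> * (w b - w c)"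
    by (rule eventually_mono[OF eventually_at_x0_ge[OF c]]) (use * in blast)
  have l1: "((\<lambda>b. \<bar>u b - u c\<bar>) \<longlongrightarrow> \<bar>0 - u c\<bar>) (at_x0 x0)" by (intro tendsto_intros lim)
  have l2: "((\<lambda>b. \<sigma> * (w b - w c)) \<longlongrightarrow> \<sigma> * (0 - w c)) (at_x0 x0)" by (intro tendsto_intros lim)
  have l3: "((\<lambda>b. s * (\<sigma> * (w b - w c))) \<longlongrightarrow> s * (\<sigma> * (0 - w c))) (at_x0 x0)" by (intro tendsto_intros lim)
  have "\<bar>0 - u c\<bar> \<le> s * (\<sigma> * (0 - w c))"
    by (rule tendsto_le[OF at_x0_neq_bot[OF c] l3 l1]) (use ev in \<open>auto elim: eventually_mono\<close>)
  moreover have "0 \<le> \<sigma> * (0 - w c)"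
    by (rule tendsto_lowerbound[OF l2 _ at_x0_neq_bot[OF c]]) (use ev in \<open>auto elim: eventually_mono\<close>)
  \<comment> \<open>\<open>w\<close> is monotone with limit 0 at \<open>x0\<close>, and this fixes
    the sign of \<open>w c\<close>.\<close>
  then have "\<sigma> * (0 - w c) = \<bar>w c\<bar>" using \<sigma>(1) by (auto simp: abs_if split: if_splits)
  ultimately have "\<bar>0 - u c\<bar> \<le> s * \<bar>w c\<bar>" by (simp only:)
  then show ?thesis by (simp add: mult.commute)
qed

text \<open>\<open>x0\<close> may be infinite, so a limit replaces the second zero. On both sides of
  a point y with g y \<noteq> 0 the normalised function comes down from 1 to the level 1/2, and the
  classical theorem of Rolle applies between two points of that level.\<close>

lemma Rolle_half_open:
  assumes c: "ereal c < x0" and cont: "continuous_on (Ivl c x0) g"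
    and der: "\<And>t. t \<in> OIvl c x0 \<Longrightarrow> (g has_real_derivative g' t) (at t)"
    and "g c = 0" and lim: "(g \<longlongrightarrow> 0) (at_x0 x0)"
  shows "\<exists>\<xi>\<in>OIvl c x0. g' \<xi> = 0"
proof (cases "\<forall>y\<in>OIvl c x0. g y = 0")
  case True
  obtain \<xi> where "\<xi> \<in> OIvl c x0"
    using eventually_happens[OF eventually_at_x0_Ivl[OF c]] at_x0_neq_bot[OF c] by blast
  moreover have "((\<lambda>x. 0) has_real_derivative g' \<xi>) (at \<xi>)"
    by (rule has_field_derivative_transform_within_open[OF der[OF calculation] open_OIvl calculation])
      (use True in auto)
  then have "g' \<xi> = 0" using DERIV_unique DERIV_const by blast
  ultimately show ?thesis by blast
next
  case False
  then obtain y where y: "y \<in> OIvl c x0" "g y \<noteq> 0" by blast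
  \<comment> \<open>Division by \<open>g y\<close> removes the distinction between positive and
    negative values.\<close>
  define G where "G t = g t / g y" for t
  have y': "c < y" "ereal y < x0" using y by (auto simp: OIvl_def)
  have "(G \<longlongrightarrow> 0 / g y) (at_x0 x0)" unfolding G_def by (intro tendsto_intros lim y)
  then have "\<forall>\<^sub>F b in at_x0 x0. G b < 1 / 2" by (intro order_tendstoD) auto
  with eventually_at_x0_ge[OF y'(2)] have "\<forall>\<^sub>F b in at_x0 x0. (y \<le> b \<and> ereal b < x0) \<and> G b < 1/2"
    by (rule eventually_conj)
  then obtain b where b: "y \<le> b" "ereal b < x0" "G b < 1/2"
    using eventually_happens[of _ "at_x0 x0"] at_x0_neq_bot[OF c] by blast
  have "G y = 1" "G c = 0" using y \<open>g c = 0\<close> by (auto simp: G_def)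
  have cont': "continuous_on {c..b} G"
    unfolding G_def using y b by (intro continuous_intros continuous_on_subset[OF cont] Icc_subset_Ivl) auto
  have "\<exists>p\<ge>c. p \<le> y \<and> G p = 1/2"
    using \<open>G y = 1\<close> \<open>G c = 0\<close> y' b by (intro IVT' continuous_on_subset[OF cont']) auto
  then obtain p where p: "c \<le> p" "p \<le> y" "G p = 1/2" by blast
  have "\<exists>q\<ge>y. q \<le> b \<and> G q = 1/2"
    using \<open>G y = 1\<close> y' b by (intro IVT2' continuous_on_subset[OF cont']) auto
  then obtain q where q: "y \<le> q" "q \<le> b" "G q = 1/2" by blast
  have "p \<noteq> y" "q \<noteq> y" "p \<noteq> c" using p q \<open>G y = 1\<close> \<open>G c = 0\<close> by auto
  then have pq: "c < p" "p < q" using p q by auto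
  have der': "(G has_real_derivative g' t / g y) (at t)" if "p < t" "t < q" for t
  proof -
    have "t \<in> OIvl c x0"
      using that p q b pq le_less_trans[of "ereal t" "ereal b" x0] by (auto simp: OIvl_def)
    then show ?thesis unfolding G_def by (intro DERIV_cdivide der)
  qed
  have "\<exists>z>p. z < q \<and> (\<lambda>v. g' z / g y * v) = (\<lambda>v. 0)"
  proof (rule Rolle_deriv[OF pq(2)])
    show "G p = G q" using p q by simp
    show "continuous_on {p..q} G" using p q by (intro continuous_on_subset[OF cont']) auto
    show "(G has_derivative (\<lambda>v. g' z / g y * v)) (at z)" if "p < z" "z < q" for z
      using der'[OF that] unfolding has_field_derivative_def .
  qed
  then obtain z where z: "p < z" "z < q" "(\<lambda>v. g' z / g y * v) = (\<lambda>v. 0)" by blast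
  then have "g' z = 0" using y fun_cong[OF z(3), of 1] by simp
  moreover have "z \<in> OIvl c x0"
    using z p q b pq le_less_trans[of "ereal z" "ereal b" x0] by (auto simp: OIvl_def)
  ultimately show ?thesis by blast
qed

lemma Cauchy_mean_value_half_open:
  assumes c: "ereal c < x0" and cont: "continuous_on (Ivl c x0) u" "continuous_on (Ivl c x0) w"
    and du: "\<And>t. t \<in> OIvl c x0 \<Longrightarrow> (u has_real_derivative w' t * k t) (at t)"
    and dw: "\<And>t. t \<in> OIvl c x0 \<Longrightarrow> (w has_real_derivative w' t) (at t)"
    and nz: "w c \<noteq> 0" "\<And>t. t \<in> OIvl c x0 \<Longrightarrow> w' t \<noteq> 0"
    and lim: "(u \<longlongrightarrow> 0) (at_x0 x0)" "(w \<longlongrightarrow> 0) (at_x0 x0)"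
  shows "\<exists>\<xi>\<in>OIvl c x0. u c = w c * k \<xi>"
proof -
  define C where "C = u c / w c"
  have "\<exists>\<xi>\<in>OIvl c x0. w' \<xi> * k \<xi> - C * w' \<xi> = 0"
  proof (rule Rolle_half_open[OF c, where g = "\<lambda>t. u t - C * w t"])
    show "continuous_on (Ivl c x0) (\<lambda>t. u t - C * w t)" by (intro continuous_intros cont)
    show "((\<lambda>t. u t - C * w t) has_real_derivative w' t * k t - C * w' t) (at t)" if "t \<in> OIvl c x0" for t
      by (intro DERIV_diff DERIV_cmult du dw that)
    show "u c - C * w c = 0" using nz by (simp add: C_def)
    have "((\<lambda>t. u t - C * w t) \<longlongrightarrow> 0 - C * 0) (at_x0 x0)" by (intro tendsto_intros lim)
    then show "((\<lambda>t. u t - C * w t) \<longlongrightarrow> 0) (at_x0 x0)" by simp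
  qed
  then obtain \<xi> where \<xi>: "\<xi> \<in> OIvl c x0" "w' \<xi> * k \<xi> - C * w' \<xi> = 0" by blast
  have "w' \<xi> * (k \<xi> - C) = 0" using \<xi>(2) by (simp add: algebra_simps)
  then have "k \<xi> = C" using nz(2)[OF \<xi>(1)] by simp
  then show ?thesis using \<xi>(1) nz(1) by (intro bexI[of _ \<xi>]) (auto simp: C_def)
qed

text \<open>If u were farther than e / 2 from l at some point of the tail, it would be so on a
  nonempty open set avoiding \<open>D\<close>, hence contained in the null set
  \<open>N\<close>.\<close>

lemma tendsto_at_x0_dense:
  fixes u :: "real \<Rightarrow> real"
  assumes c: "ereal c < x0" and cont: "continuous_on (Ivl c x0) u" and N: "negligible N"
    and D: "OIvl c x0 - N \<subseteq> D" and lim: "(u \<longlongrightarrow> l) (inf (at_x0 x0) (principal D))"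
  shows "(u \<longlongrightarrow> l) (at_x0 x0)"
proof (rule tendstoI)
  fix e :: real assume "0 < e"
  then have "\<forall>\<^sub>F y in inf (at_x0 x0) (principal D). dist (u y) l < e / 2"
    using lim by (intro tendstoD) auto
  then have "\<forall>\<^sub>F y in at_x0 x0. y \<in> D \<longrightarrow> dist (u y) l < e / 2"
    by (simp add: eventually_inf_principal)
  then obtain d where d: "c \<le> d" "ereal d < x0" "\<And>y. d < y \<Longrightarrow> ereal y < x0 \<Longrightarrow> y \<in> D \<Longrightarrow> dist (u y) l < e / 2"
    unfolding eventually_at_x0[OF c] by blast
  have "dist (u y) l \<le> e / 2" if y: "y \<in> OIvl d x0" for y
  proof (rule ccontr)
    assume far: "\<not> ?thesis"
    let ?V = "OIvl d x0 \<inter> (\<lambda>z. dist (u z) l) -` {e/2<..}"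
    have "OIvl d x0 \<subseteq> Ivl c x0" using d by (auto simp: OIvl_def Ivl_def)
    then have "continuous_on (OIvl d x0) (\<lambda>z. dist (u z) l)"
      by (intro continuous_intros continuous_on_subset[OF cont])
    then have "open ?V" by (rule continuous_open_preimage[OF _ open_OIvl]) simp
    moreover have "?V \<noteq> {}" using far y by auto
    moreover have "?V \<subseteq> N"
    proof
      fix z assume z: "z \<in> ?V"
      then have z': "d < z" "ereal z < x0" "\<not> dist (u z) l < e / 2" by (auto simp: OIvl_def)
      then have "z \<notin> D" using d(3)[of z] by blast
      moreover have "z \<in> OIvl c x0" using z' d(1) by (auto simp: OIvl_def)
      ultimately show "z \<in> N" using D by blast
    qed
    ultimately show False using N open_not_negligible negligible_subset by blast
  qed
  then have "\<forall>y. d < y \<longrightarrow> ereal y < x0 \<longrightarrow> dist (u y) l < e"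
    using \<open>0 < e\<close> by (force simp: OIvl_def)
  then show "\<forall>\<^sub>F y in at_x0 x0. dist (u y) l < e"
    unfolding eventually_at_x0[OF c] using d(1,2) by blast
qed

section \<open>Bounds with values in the extended reals\<close>

lemma ess_sup_on_bound:
  assumes "0 < A" and *: "\<And>s. (AE t in lebesgue. t \<in> S \<longrightarrow> g t \<le> s) \<Longrightarrow> r \<le> A * s"
  shows "ereal r \<le> ereal A * ess_sup_on S g"
proof -
  have "ereal (r / A) \<le> ess_sup_on S g"
    unfolding ess_sup_on_def
  proof (rule Inf_greatest)
    fix z assume z: "z \<in> {z. AE t in lebesgue. t \<in> S \<longrightarrow> ereal (g t) \<le> z}"
    show "ereal (r / A) \<le> z"
    proof (cases z)
      case (real s)
      then show ?thesis using z *[of s] \<open>0 < A\<close> by (simp add: pos_divide_le_eq mult.commute)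
    next
      case MInf
      \<comment> \<open>If minus infinity is an essential bound, every real is an admissible
        \<open>s\<close>; this choice gives the contradiction r \<le> r - 1.\<close>
      then have "AE t in lebesgue. t \<in> S \<longrightarrow> g t \<le> (r - 1) / A" using z by auto
      then have "r \<le> A * ((r - 1) / A)" by (rule *)
      then show ?thesis using \<open>0 < A\<close> by simp
    qed simp
  qed
  then have "ereal A * ereal (r / A) \<le> ereal A * ess_sup_on S g"
    using \<open>0 < A\<close> by (intro ereal_mult_left_mono) auto
  then show ?thesis using \<open>0 < A\<close> by simp
qed

lemma ennreal_le_mult_bound:
  assumes "0 < A" and *: "\<And>s. \<lbrakk>0 \<le> s; n \<le> ennreal s\<rbrakk> \<Longrightarrow> r \<le> A * s"
  shows "ennreal r \<le> ennreal A * n"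
proof (cases n)
  case (real s)
  then have "r \<le> A * s" by (intro *) auto
  then show ?thesis using real \<open>0 < A\<close> by (simp add: ennreal_mult[symmetric] ennreal_leI)
next
  case top
  then show ?thesis using \<open>0 < A\<close> by (simp add: ennreal_mult_top)
qed

section \<open>The remainder of an asymptotic expansion with two terms\<close>

text \<open>The abbreviations of the theorem are parameters fixed by \<open>defines\<close>, so that
  the interpretation in its proof delivers the lemmas in the theorem's own terms. \<open>f'\<close>
  is constrained on \<open>D\<close> only, and \<open>\<gamma>\<close> is the limit of
  \<open>Fs\<close> by linearity.\<close>

locale wronskian_pair =
  fixes T :: real and x0 :: ereal
    and \<phi>1 \<phi>2 \<phi>1' \<phi>2' f f' :: "real \<Rightarrow> real" and a1 a2 :: real
  fixes I W D f1s f2s \<Phi> Fs R \<gamma>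
  defines "I \<equiv> Ivl T x0"
    and "W \<equiv> Wr \<phi>1 \<phi>1' \<phi>2 \<phi>2'"
    and "D \<equiv> {t \<in> I. f differentiable (at t within I)}"
    and "f1s \<equiv> (\<lambda>t. Wr f f' \<phi>2 \<phi>2' t / W t)"
    and "f2s \<equiv> (\<lambda>t. - Wr f f' \<phi>1 \<phi>1' t / W t)"
    and "\<Phi> \<equiv> (\<lambda>x. \<phi>2 T * \<phi>1 x - \<phi>1 T * \<phi>2 x)"
    and "Fs \<equiv> (\<lambda>t. \<phi>1 T * f1s t + \<phi>2 T * f2s t)"
    and "R \<equiv> (\<lambda>x. f x - a1 * \<phi>1 x - a2 * \<phi>2 x)"
    and "\<gamma> \<equiv> \<phi>1 T * a1 + \<phi>2 T * a2"
  assumes T_lt: "ereal T < x0"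
    and phi1_C1: "C1_on I \<phi>1 \<phi>1'" and phi2_C1: "C1_on I \<phi>2 \<phi>2'"
    and small_o: "\<phi>2 \<in> o[at_x0 x0](\<phi>1)"
    and phi1_nz: "\<And>x. x \<in> I \<Longrightarrow> \<phi>1 x \<noteq> 0" and phi2_nz: "\<And>x. x \<in> I \<Longrightarrow> \<phi>2 x \<noteq> 0"
    and W_nz: "\<And>x. x \<in> I \<Longrightarrow> W x \<noteq> 0"
    and f_AC: "AC_on I f"
    and f'_deriv: "\<And>t. t \<in> D \<Longrightarrow> (f has_real_derivative f' t) (at t within I)"
    and lim1: "(f1s \<longlongrightarrow> a1) (inf (at_x0 x0) (principal D))"
    and lim2: "(f2s \<longlongrightarrow> a2) (inf (at_x0 x0) (principal D))"
begin

text \<open>Two-sided differentiability in the open interval, where it coincides with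
  differentiability within \<open>I\<close>; the point \<open>T\<close> only ever occurs as an end
  point of integration.\<close>

definition N where "N = {t \<in> OIvl T x0. \<not> f differentiable (at t)}"

lemma negligible_N: "negligible N"
  using AC_on_differentiable_ae f_AC unfolding N_def I_def .

lemma T_in_I: "T \<in> I"
  using T_lt by (simp add: I_def Ivl_def)

lemma OIvl_I: "t \<in> OIvl T x0 \<Longrightarrow> t \<in> I"
  using OIvl_subset_Ivl I_def by blast

lemma Ivl_sub_I: "x \<in> I \<Longrightarrow> Ivl x x0 \<subseteq> I"
  by (auto simp: I_def Ivl_def)

lemma OIvl_sub: "x \<in> I \<Longrightarrow> OIvl x x0 \<subseteq> OIvl T x0"
  by (auto simp: I_def Ivl_def OIvl_def)

lemma I_less: "x \<in> I \<Longrightarrow> ereal x < x0"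
  by (simp add: I_def Ivl_def)

lemma OIvl_minus_N_subset_D: "OIvl T x0 - N \<subseteq> D"
  unfolding N_def D_def using OIvl_I by (auto simp: I_def at_within_Ivl)

section \<open>Derivatives of the quotients\<close>

lemma der_phi1: "t \<in> OIvl T x0 \<Longrightarrow> (\<phi>1 has_real_derivative \<phi>1' t) (at t)"
  using phi1_C1 OIvl_I unfolding C1_on_def I_def by (metis at_within_Ivl)

lemma der_phi2: "t \<in> OIvl T x0 \<Longrightarrow> (\<phi>2 has_real_derivative \<phi>2' t) (at t)"
  using phi2_C1 OIvl_I unfolding C1_on_def I_def by (metis at_within_Ivl)

lemma der_f: "t \<in> OIvl T x0 \<Longrightarrow> t \<notin> N \<Longrightarrow> (f has_real_derivative f' t) (at t)"
  using f'_deriv[of t] OIvl_minus_N_subset_D unfolding I_def by (auto simp: at_within_Ivl)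

lemma AC_phi1: "AC_on I \<phi>1" and AC_phi2: "AC_on I \<phi>2"
  using phi1_C1 phi2_C1 by (auto intro: C1_on_imp_AC_on)

lemma AC_R: "AC_on I R"
  unfolding R_def by (intro AC_on_diff AC_on_mult AC_on_const f_AC AC_phi1 AC_phi2)

lemma AC_Phi: "AC_on I \<Phi>"
  unfolding \<Phi>_def by (intro AC_on_diff AC_on_mult AC_on_const AC_phi1 AC_phi2)

lemma cont_I: "AC_on I h \<Longrightarrow> continuous_on I h"
  unfolding I_def by (rule AC_on_imp_continuous_on)

text \<open>Cramer's rule for the linear system with determinant \<open>W\<close>. The identities
  are algebraic in \<open>f t\<close> and \<open>f' t\<close>, so they hold at every point of
  \<open>I\<close>, whatever \<open>f'\<close> is outside \<open>D\<close>.\<close>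

lemma f_decomp: "t \<in> I \<Longrightarrow> f t = f1s t * \<phi>1 t + f2s t * \<phi>2 t"
  and f'_decomp: "t \<in> I \<Longrightarrow> f' t = f1s t * \<phi>1' t + f2s t * \<phi>2' t"
  using W_nz[of t] unfolding f1s_def f2s_def
  by (auto simp: divide_simps) (auto simp: W_def Wr_def algebra_simps)

lemma R_decomp: "t \<in> I \<Longrightarrow> R t = (f1s t - a1) * \<phi>1 t + (f2s t - a2) * \<phi>2 t"
  unfolding R_def by (subst f_decomp) (simp_all add: algebra_simps)

lemma der_R_quotient:
  assumes t: "t \<in> OIvl T x0" "t \<notin> N" and nz: "p * \<phi>1 t + q * \<phi>2 t \<noteq> 0"
  shows "((\<lambda>s. R s / (p * \<phi>1 s + q * \<phi>2 s)) has_real_derivative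
    W t / (p * \<phi>1 t + q * \<phi>2 t)\<^sup>2 * (p * (f2s t - a2) - q * (f1s t - a1))) (at t)"
proof -
  have R': "(R has_real_derivative f' t - a1 * \<phi>1' t - a2 * \<phi>2' t) (at t)"
    unfolding R_def by (intro DERIV_diff DERIV_cmult der_f der_phi1 der_phi2 t)
  have eq: "f' t - a1 * \<phi>1' t - a2 * \<phi>2' t = (f1s t - a1) * \<phi>1' t + (f2s t - a2) * \<phi>2' t"
    by (subst f'_decomp[OF OIvl_I[OF t(1)]]) (simp add: algebra_simps)
  have \<psi>: "((\<lambda>s. p * \<phi>1 s + q * \<phi>2 s) has_real_derivative p * \<phi>1' t + q * \<phi>2' t) (at t)"
    by (intro DERIV_add DERIV_cmult der_phi1 der_phi2 t)
  \<comment> \<open>The numerator is the Wronskian of two combinations of \<open>\<phi>1\<close> and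
    \<open>\<phi>2\<close>, the second one with its coefficients frozen at \<open>t\<close>. It
    equals \<open>W t\<close> times the determinant of the coefficients.\<close>
  have num: "((f1s t - a1) * \<phi>1' t + (f2s t - a2) * \<phi>2' t) * (p * \<phi>1 t + q * \<phi>2 t) - (p * \<phi>1' t + q * \<phi>2' t) * R t
    = W t * (p * (f2s t - a2) - q * (f1s t - a1))"
    by (subst R_decomp[OF OIvl_I[OF t(1)]]) (simp add: W_def Wr_def algebra_simps)
  show ?thesis
    by (rule DERIV_cong[OF DERIV_quotient[OF R'[unfolded eq] \<psi> nz]])
      (simp only: num power2_eq_square power_Suc power_0 mult_1_right times_divide_eq_left)
qed

lemma der_quotient:
  assumes t: "t \<in> OIvl T x0" and nz: "p * \<phi>1 t + q * \<phi>2 t \<noteq> 0"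
  shows "((\<lambda>s. \<phi>2 s / (p * \<phi>1 s + q * \<phi>2 s)) has_real_derivative p * (W t / (p * \<phi>1 t + q * \<phi>2 t)\<^sup>2)) (at t)"
proof -
  have \<psi>: "((\<lambda>s. p * \<phi>1 s + q * \<phi>2 s) has_real_derivative p * \<phi>1' t + q * \<phi>2' t) (at t)"
    by (intro DERIV_add DERIV_cmult der_phi1 der_phi2 t)
  have num: "\<phi>2' t * (p * \<phi>1 t + q * \<phi>2 t) - (p * \<phi>1' t + q * \<phi>2' t) * \<phi>2 t = p * W t"
    by (simp add: W_def Wr_def algebra_simps)
  show ?thesis
    by (rule DERIV_cong[OF DERIV_quotient[OF der_phi2[OF t] \<psi> nz]])
      (simp only: num power2_eq_square power_Suc power_0 mult_1_right times_divide_eq_right)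
qed

lemma der_R_phi1:
  "t \<in> OIvl T x0 \<Longrightarrow> t \<notin> N \<Longrightarrow>
    ((\<lambda>s. R s / \<phi>1 s) has_real_derivative W t / (\<phi>1 t)\<^sup>2 * (f2s t - a2)) (at t)"
  using der_R_quotient[of t 1 0] phi1_nz OIvl_I by simp

lemma der_R_phi2:
  assumes "t \<in> OIvl T x0" "t \<notin> N"
  shows "((\<lambda>s. R s / \<phi>2 s) has_real_derivative - (W t / (\<phi>2 t)\<^sup>2) * (f1s t - a1)) (at t)"
proof -
  have "((\<lambda>s. R s / \<phi>2 s) has_real_derivative W t * (a1 - f1s t) / (\<phi>2 t)\<^sup>2) (at t)"
    using der_R_quotient[OF assms, of 0 1] phi2_nz[OF OIvl_I[OF assms(1)]] by simp
  moreover have "W t * (a1 - f1s t) / (\<phi>2 t)\<^sup>2 = - (W t / (\<phi>2 t)\<^sup>2) * (f1s t - a1)"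
    using phi2_nz[OF OIvl_I[OF assms(1)]] by (simp add: field_simps)
  ultimately show ?thesis by (simp only:)
qed

lemma der_phi2_phi1:
  "t \<in> OIvl T x0 \<Longrightarrow> ((\<lambda>s. \<phi>2 s / \<phi>1 s) has_real_derivative W t / (\<phi>1 t)\<^sup>2) (at t)"
  using der_quotient[of t 1 0] phi1_nz OIvl_I by simp

lemma der_phi1_phi2:
  assumes t: "t \<in> OIvl T x0"
  shows "((\<lambda>s. \<phi>1 s / \<phi>2 s) has_real_derivative - (W t / (\<phi>2 t)\<^sup>2)) (at t)"
proof -
  have num: "\<phi>1' t * \<phi>2 t - \<phi>2' t * \<phi>1 t = - W t"
    by (simp add: W_def Wr_def algebra_simps)
  show ?thesis
    by (rule DERIV_cong[OF DERIV_quotient[OF der_phi1[OF t] der_phi2[OF t] phi2_nz[OF OIvl_I[OF t]]]])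
      (simp add: num power2_eq_square)
qed

text \<open>\<open>W\<close> is continuous without zeros, so by the intermediate value theorem it
  keeps the sign that it has at \<open>T\<close>.\<close>

lemma W_sign: "\<exists>\<sigma>. \<bar>\<sigma>\<bar> = 1 \<and> (\<forall>t\<in>I. 0 < \<sigma> * W t)"
proof (intro exI conjI ballI)
  show "\<bar>sgn (W T)\<bar> = 1" using W_nz[OF T_in_I] by (simp add: abs_sgn_eq)
  fix t assume t: "t \<in> I"
  have pos: "0 < sgn (W T) * W T" using W_nz[OF T_in_I] by (simp add: sgn_mult_self_eq flip: abs_sgn mult.commute)
  show "0 < sgn (W T) * W t"
  proof (rule ccontr)
    assume neg: "\<not> ?thesis"
    have sub: "{T..t} \<subseteq> I" using t unfolding I_def by (intro Icc_subset_Ivl) (auto simp: Ivl_def)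
    have "continuous_on I W"
      unfolding W_def Wr_def using phi1_C1 phi2_C1 cont_I[OF AC_phi1] cont_I[OF AC_phi2]
      by (intro continuous_intros) (auto simp: C1_on_def)
    then have "continuous_on {T..t} W" by (rule continuous_on_subset[OF _ sub])
    then have "continuous_on {T..t} (\<lambda>s. sgn (W T) * W s)" by (rule continuous_on_mult_left)
    then have "\<exists>s\<ge>T. s \<le> t \<and> sgn (W T) * W s = 0"
      using neg pos t by (intro IVT2') (auto simp: I_def Ivl_def)
    then obtain s where "T \<le> s" "s \<le> t" "sgn (W T) * W s = 0" by blast
    then show False using sub W_nz[of s] W_nz[OF T_in_I] by (auto simp: sgn_zero_iff)
  qed
qed

text \<open>A zero beyond \<open>T\<close> would give \<phi>2 / \<phi>1 the same value at two
  points, and Rolle's theorem a zero of its derivative W / \<phi>1^2.\<close>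

lemma Phi_nz:
  assumes t: "t \<in> OIvl T x0"
  shows "\<Phi> t \<noteq> 0"
proof
  assume "\<Phi> t = 0"
  have tT: "T < t" "ereal t < x0" using t by (auto simp: OIvl_def)
  have sub: "{T..t} \<subseteq> I" unfolding I_def using tT by (intro Icc_subset_Ivl) auto
  have "\<exists>z>T. z < t \<and> (\<lambda>v. W z / (\<phi>1 z)\<^sup>2 * v) = (\<lambda>v. 0)"
  proof (rule Rolle_deriv[OF tT(1)])
    show "\<phi>2 T / \<phi>1 T = \<phi>2 t / \<phi>1 t"
      using \<open>\<Phi> t = 0\<close> phi1_nz[OF T_in_I] phi1_nz[OF OIvl_I[OF t]] by (simp add: \<Phi>_def field_simps)
    show "continuous_on {T..t} (\<lambda>s. \<phi>2 s / \<phi>1 s)"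
      using sub phi1_nz by (intro continuous_intros continuous_on_subset[OF cont_I] AC_phi1 AC_phi2) auto
    fix z assume "T < z" "z < t"
    then have "z \<in> OIvl T x0" using tT le_less_trans[of "ereal z" "ereal t" x0] by (auto simp: OIvl_def)
    from der_phi2_phi1[OF this]
    show "((\<lambda>s. \<phi>2 s / \<phi>1 s) has_derivative (\<lambda>v. W z / (\<phi>1 z)\<^sup>2 * v)) (at z)"
      unfolding has_field_derivative_def .
  qed
  then obtain z where z: "T < z" "z < t" "(\<lambda>v. W z / (\<phi>1 z)\<^sup>2 * v) = (\<lambda>v. 0)" by blast
  then have "z \<in> I" using sub by auto
  then show False using fun_cong[OF z(3), of 1] W_nz phi1_nz by simp
qed

lemma der_R_Phi:
  assumes "t \<in> OIvl T x0" "t \<notin> N"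
  shows "((\<lambda>s. R s / \<Phi> s) has_real_derivative W t / (\<Phi> t)\<^sup>2 * (Fs t - \<gamma>)) (at t)"
proof -
  have "\<phi>2 T * (f2s t - a2) - - \<phi>1 T * (f1s t - a1) = Fs t - \<gamma>"
    by (simp add: Fs_def \<gamma>_def algebra_simps)
  then show ?thesis
    using der_R_quotient[OF assms, of "\<phi>2 T" "- \<phi>1 T"] Phi_nz[OF assms(1)] by (simp add: \<Phi>_def)
qed

text \<open>Dividing by \<phi>2 T makes the derivative exactly the weight in
  \<open>der_R_Phi\<close>. This is the origin of the factor \<phi>2 x / \<phi>2 T in (II) and
  (III).\<close>

lemma der_phi2_Phi:
  assumes "t \<in> OIvl T x0"
  shows "((\<lambda>s. \<phi>2 s / \<Phi> s / \<phi>2 T) has_real_derivative W t / (\<Phi> t)\<^sup>2) (at t)"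
proof -
  have "((\<lambda>s. \<phi>2 s / \<Phi> s) has_real_derivative \<phi>2 T * (W t / (\<Phi> t)\<^sup>2)) (at t)"
    using der_quotient[OF assms, of "\<phi>2 T" "- \<phi>1 T"] Phi_nz[OF assms] by (simp add: \<Phi>_def)
  from DERIV_cdivide[OF this, of "\<phi>2 T"] show ?thesis using phi2_nz[OF T_in_I] by simp
qed

section \<open>Limits at the end point\<close>

lemma eventually_I: "\<forall>\<^sub>F t in at_x0 x0. t \<in> I"
  by (rule eventually_mono[OF eventually_at_x0_Ivl[OF T_lt]]) (rule OIvl_I)

lemma lim_phi2_phi1: "((\<lambda>t. \<phi>2 t / \<phi>1 t) \<longlongrightarrow> 0) (at_x0 x0)"
  using small_o by (rule smalloD_tendsto)

text \<open>After division by \<open>\<phi>1\<close> the remainder is (f1s - a1) + (f2s - a2)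
  \<phi>2 / \<phi>1, which tends to 0 along \<open>D\<close>; continuity of the quotient removes the
  restriction to \<open>D\<close>.\<close>

lemma lim_R_phi1: "((\<lambda>t. R t / \<phi>1 t) \<longlongrightarrow> 0) (at_x0 x0)"
proof (rule tendsto_at_x0_dense[OF T_lt _ negligible_N OIvl_minus_N_subset_D])
  let ?F = "inf (at_x0 x0) (principal D)"
  show "continuous_on (Ivl T x0) (\<lambda>t. R t / \<phi>1 t)"
    using cont_I[OF AC_R] cont_I[OF AC_phi1] phi1_nz unfolding I_def by (intro continuous_intros) auto
  have "((\<lambda>t. \<phi>2 t / \<phi>1 t) \<longlongrightarrow> 0) ?F" by (rule tendsto_mono[OF _ lim_phi2_phi1]) simp
  then have "((\<lambda>t. (f1s t - a1) + (f2s t - a2) * (\<phi>2 t / \<phi>1 t)) \<longlongrightarrow> (a1 - a1) + (a2 - a2) * 0) ?F"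
    by (intro tendsto_intros lim1 lim2)
  moreover have "\<forall>\<^sub>F t in ?F. (f1s t - a1) + (f2s t - a2) * (\<phi>2 t / \<phi>1 t) = R t / \<phi>1 t"
    unfolding eventually_inf_principal using eventually_I
    by eventually_elim (auto simp: R_decomp add_divide_distrib phi1_nz)
  ultimately show "((\<lambda>t. R t / \<phi>1 t) \<longlongrightarrow> 0) ?F"
    using Lim_transform_eventually by force
qed

text \<open>\<Phi> / \<phi>1 tends to \<phi>2 T, which is nonzero, so \<open>\<Phi>\<close> and
  \<open>\<phi>1\<close> have the same order at \<open>x0\<close>.\<close>

lemma lim_div_Phi:
  assumes "((\<lambda>t. u t / \<phi>1 t) \<longlongrightarrow> 0) (at_x0 x0)"
  shows "((\<lambda>t. u t / \<Phi> t) \<longlongrightarrow> 0) (at_x0 x0)"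
proof -
  have "((\<lambda>t. (u t / \<phi>1 t) / (\<phi>2 T - \<phi>1 T * (\<phi>2 t / \<phi>1 t))) \<longlongrightarrow> 0 / (\<phi>2 T - \<phi>1 T * 0)) (at_x0 x0)"
    by (intro tendsto_intros assms lim_phi2_phi1) (simp add: phi2_nz T_in_I)
  moreover have "\<forall>\<^sub>F t in at_x0 x0. (u t / \<phi>1 t) / (\<phi>2 T - \<phi>1 T * (\<phi>2 t / \<phi>1 t)) = u t / \<Phi> t"
    using eventually_I
  proof eventually_elim
    case (elim t)
    then have "\<Phi> t = \<phi>1 t * (\<phi>2 T - \<phi>1 T * (\<phi>2 t / \<phi>1 t))" using phi1_nz by (simp add: \<Phi>_def field_simps)
    then show ?case by simp
  qed
  ultimately show ?thesis using Lim_transform_eventually by force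
qed

lemmas lim_R_Phi = lim_div_Phi[OF lim_R_phi1]

lemma lim_phi2_Phi: "((\<lambda>t. \<phi>2 t / \<Phi> t / \<phi>2 T) \<longlongrightarrow> 0) (at_x0 x0)"
  using tendsto_divide[OF lim_div_Phi[OF lim_phi2_phi1] tendsto_const, of "\<phi>2 T"] phi2_nz[OF T_in_I] by simp

lemma lim_Fs: "(Fs \<longlongrightarrow> \<gamma>) (inf (at_x0 x0) (principal D))"
  unfolding Fs_def \<gamma>_def by (intro tendsto_intros lim1 lim2)

lemma AC_R_phi1: "AC_on I (\<lambda>t. R t / \<phi>1 t)" and AC_R_phi2: "AC_on I (\<lambda>t. R t / \<phi>2 t)"
  and AC_phi2_phi1: "AC_on I (\<lambda>t. \<phi>2 t / \<phi>1 t)"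
  by (intro AC_on_divide AC_R AC_phi1 AC_phi2 phi1_nz phi2_nz; assumption)+

lemma Phi_nz_Ivl: "x \<in> OIvl T x0 \<Longrightarrow> t \<in> Ivl x x0 \<Longrightarrow> \<Phi> t \<noteq> 0"
  by (rule Phi_nz) (auto simp: OIvl_def Ivl_def)

lemma AC_R_Phi:
  assumes "x \<in> OIvl T x0"
  shows "AC_on (Ivl x x0) (\<lambda>t. R t / \<Phi> t)"
  using AC_on_subset[OF _ Ivl_sub_I[OF OIvl_I[OF assms]]] Phi_nz_Ivl[OF assms]
  by (intro AC_on_divide) (auto intro: AC_R AC_Phi)

lemma AC_phi2_Phi:
  assumes "x \<in> OIvl T x0"
  shows "AC_on (Ivl x x0) (\<lambda>t. \<phi>2 t / \<Phi> t / \<phi>2 T)"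
  using AC_on_subset[OF _ Ivl_sub_I[OF OIvl_I[OF assms]]] Phi_nz_Ivl[OF assms] phi2_nz[OF T_in_I]
  by (intro AC_on_divide AC_on_const) (auto intro: AC_phi2 AC_Phi)

text \<open>The integrand is prescribed off \<open>N\<close> in the open interval only. This admits
  both forms of the weight: \<open>deriv\<close> of the quotient is two-sided and therefore
  uncontrolled at \<open>T\<close>.\<close>

lemma imp_int_R_phi1:
  assumes "x \<in> I"
    and "\<And>t. t \<in> OIvl T x0 \<Longrightarrow> t \<notin> N \<Longrightarrow> g t = W t / (\<phi>1 t)\<^sup>2 * (f2s t - a2)"
  shows "imp_int x0 g x (- (R x / \<phi>1 x))"
  using imp_int_AC_on[OF AC_R_phi1[unfolded I_def] negligible_N _ lim_R_phi1, of g x] der_R_phi1 assms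
  by (simp add: I_def)

lemma imp_int_R_phi1':
  assumes "x \<in> I"
    and "\<And>t. t \<in> OIvl T x0 \<Longrightarrow> t \<notin> N \<Longrightarrow> g t = - (W t / (\<phi>1 t)\<^sup>2 * (f2s t - a2))"
  shows "imp_int x0 g x (R x / \<phi>1 x)"
  using imp_int_AC_on[OF AC_on_minus[OF AC_R_phi1[unfolded I_def]] negligible_N _ tendsto_minus[OF lim_R_phi1], of g x]
    DERIV_minus[OF der_R_phi1] assms
  by (simp add: I_def)

text \<open>The free null set \<open>M\<close> lets one lemma serve the essential supremum, the
  limit of R / \<phi>2 and the estimate with L[f]. The divisor \<phi>1 x cancels on the two
  sides.\<close>

lemma bound_f2s:
  assumes x: "x \<in> I" and M: "negligible M" and bd: "\<And>t. t \<in> OIvl x x0 \<Longrightarrow> t \<notin> M \<Longrightarrow> \<bar>f2s t - a2\<bar> \<le> s"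
  shows "\<bar>R x\<bar> \<le> \<bar>\<phi>2 x\<bar> * s"
proof -
  obtain \<sigma> where \<sigma>: "\<bar>\<sigma>\<bar> = 1" "\<And>t. t \<in> I \<Longrightarrow> 0 < \<sigma> * W t" using W_sign by blast
  note sub = Ivl_sub_I[OF x] OIvl_sub[OF x]
  have "\<bar>R x / \<phi>1 x\<bar> \<le> \<bar>\<phi>2 x / \<phi>1 x\<bar> * s"
  proof (rule AC_on_weighted_bound[OF I_less[OF x] _ _ _ _ _ \<sigma>(1) _ _ lim_R_phi1 lim_phi2_phi1])
    show "AC_on (Ivl x x0) (\<lambda>t. R t / \<phi>1 t)" "AC_on (Ivl x x0) (\<lambda>t. \<phi>2 t / \<phi>1 t)"
      using AC_on_subset[OF AC_R_phi1 sub(1)] AC_on_subset[OF AC_phi2_phi1 sub(1)] .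
    show "negligible (N \<union> M)" using negligible_N M by simp
    fix t assume t: "t \<in> OIvl x x0"
    then have t': "t \<in> OIvl T x0" using sub by blast
    show "((\<lambda>t. \<phi>2 t / \<phi>1 t) has_real_derivative W t / (\<phi>1 t)\<^sup>2) (at t)"
      by (rule der_phi2_phi1[OF t'])
    show "0 \<le> \<sigma> * (W t / (\<phi>1 t)\<^sup>2)" using \<sigma>(2)[OF OIvl_I[OF t']] by (simp add: less_imp_le)
    assume "t \<notin> N \<union> M"
    then show "((\<lambda>t. R t / \<phi>1 t) has_real_derivative W t / (\<phi>1 t)\<^sup>2 * (f2s t - a2)) (at t)"
      and "\<bar>f2s t - a2\<bar> \<le> s"
      using der_R_phi1[OF t'] bd[OF t] by auto
  qed
  then show ?thesis using phi1_nz[OF x] by (simp add: abs_divide divide_le_cancel)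
qed

lemma bound_Fs_aux:
  assumes x: "x \<in> OIvl T x0" and M: "negligible M" and bd: "\<And>t. t \<in> OIvl x x0 \<Longrightarrow> t \<notin> M \<Longrightarrow> \<bar>Fs t - \<gamma>\<bar> \<le> s"
  shows "\<bar>R x\<bar> \<le> \<bar>\<phi>2 x / \<phi>2 T\<bar> * s"
proof -
  obtain \<sigma> where \<sigma>: "\<bar>\<sigma>\<bar> = 1" "\<And>t. t \<in> I \<Longrightarrow> 0 < \<sigma> * W t" using W_sign by blast
  note sub = OIvl_sub[OF OIvl_I[OF x]]
  have "\<bar>R x / \<Phi> x\<bar> \<le> \<bar>\<phi>2 x / \<Phi> x / \<phi>2 T\<bar> * s"
  proof (rule AC_on_weighted_bound[OF I_less[OF OIvl_I[OF x]] AC_R_Phi[OF x] AC_phi2_Phi[OF x] _ _ _ \<sigma>(1) _ _ lim_R_Phi lim_phi2_Phi])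
    show "negligible (N \<union> M)" using negligible_N M by simp
    fix t assume t: "t \<in> OIvl x x0"
    then have t': "t \<in> OIvl T x0" using sub by blast
    show "((\<lambda>t. \<phi>2 t / \<Phi> t / \<phi>2 T) has_real_derivative W t / (\<Phi> t)\<^sup>2) (at t)"
      by (rule der_phi2_Phi[OF t'])
    show "0 \<le> \<sigma> * (W t / (\<Phi> t)\<^sup>2)" using \<sigma>(2)[OF OIvl_I[OF t']] by (simp add: less_imp_le)
    assume "t \<notin> N \<union> M"
    then show "((\<lambda>t. R t / \<Phi> t) has_real_derivative W t / (\<Phi> t)\<^sup>2 * (Fs t - \<gamma>)) (at t)"
      and "\<bar>Fs t - \<gamma>\<bar> \<le> s"
      using der_R_Phi[OF t'] bd[OF t] by auto
  qed
  then have "\<bar>R x\<bar> / \<bar>\<Phi> x\<bar> \<le> (\<bar>\<phi>2 x / \<phi>2 T\<bar> * s) / \<bar>\<Phi> x\<bar>"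
    by (simp add: abs_divide abs_mult mult.commute)
  then show ?thesis using Phi_nz[OF x] by (simp only: divide_le_cancel)
qed

text \<open>\<open>\<Phi>\<close> vanishes at \<open>T\<close>, where \<open>bound_Fs_aux\<close>
  says nothing. Both sides are continuous, and a bound \<open>s\<close> beyond \<open>x\<close> is
  also one beyond every later point, so the inequality passes to the left end.\<close>

lemma bound_Fs:
  assumes x: "x \<in> I" and M: "negligible M" and bd: "\<And>t. t \<in> OIvl x x0 \<Longrightarrow> t \<notin> M \<Longrightarrow> \<bar>Fs t - \<gamma>\<bar> \<le> s"
  shows "\<bar>R x\<bar> \<le> \<bar>\<phi>2 x / \<phi>2 T\<bar> * s"
proof -
  obtain b where b: "x < b" "ereal b < x0"
    using ereal_dense2[OF I_less[OF x]] by auto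
  have sub: "{x..b} \<subseteq> I" using x b unfolding I_def by (intro Icc_subset_Ivl) (auto simp: Ivl_def)
  have cl: "closure {x<..<b} = {x..b}" using b by simp
  have "0 \<le> \<bar>\<phi>2 x / \<phi>2 T\<bar> * s - \<bar>R x\<bar>"
  proof (rule continuous_ge_on_closure[where S = "{x<..<b}" and f = "\<lambda>y. \<bar>\<phi>2 y / \<phi>2 T\<bar> * s - \<bar>R y\<bar>"])
    show "continuous_on (closure {x<..<b}) (\<lambda>y. \<bar>\<phi>2 y / \<phi>2 T\<bar> * s - \<bar>R y\<bar>)"
      unfolding cl using phi2_nz[OF T_in_I]
      by (intro continuous_intros continuous_on_subset[OF cont_I sub] AC_phi2 AC_R) auto
    show "x \<in> closure {x<..<b}" unfolding cl using b by simp
    fix y assume y: "y \<in> {x<..<b}"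
    have yO: "y \<in> OIvl T x0"
      using y x b le_less_trans[of "ereal y" "ereal b" x0] by (auto simp: OIvl_def I_def Ivl_def)
    have "\<bar>R y\<bar> \<le> \<bar>\<phi>2 y / \<phi>2 T\<bar> * s"
      by (rule bound_Fs_aux[OF yO M bd]) (use y in \<open>auto simp: OIvl_def\<close>)
    then show "0 \<le> \<bar>\<phi>2 y / \<phi>2 T\<bar> * s - \<bar>R y\<bar>" by simp
  qed
  then show ?thesis by simp
qed

text \<open>Stronger than \<open>lim_R_phi1\<close>, as \<phi>2 = o(\<phi>1). The inequality of
  \<open>bound_f2s\<close> is not strict, whence the use of e / 2.\<close>

lemma lim_R_phi2: "((\<lambda>t. R t / \<phi>2 t) \<longlongrightarrow> 0) (at_x0 x0)"
proof (rule tendstoI)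
  fix e :: real assume "0 < e"
  then have "\<forall>\<^sub>F t in inf (at_x0 x0) (principal D). dist (f2s t) a2 < e / 2"
    by (intro tendstoD[OF lim2]) auto
  then have "\<forall>\<^sub>F t in at_x0 x0. t \<in> D \<longrightarrow> dist (f2s t) a2 < e / 2"
    by (simp add: eventually_inf_principal)
  then obtain d where d: "T \<le> d" "ereal d < x0" "\<And>t. d < t \<Longrightarrow> ereal t < x0 \<Longrightarrow> t \<in> D \<Longrightarrow> dist (f2s t) a2 < e / 2"
    unfolding eventually_at_x0[OF T_lt] by blast
  have "dist (R x / \<phi>2 x) 0 < e" if x: "d < x" "ereal x < x0" for x
  proof -
    have xI: "x \<in> I" using x d by (simp add: I_def Ivl_def)
    have "\<bar>R x\<bar> \<le> \<bar>\<phi>2 x\<bar> * (e / 2)"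
    proof (rule bound_f2s[OF xI negligible_N])
      fix t assume t: "t \<in> OIvl x x0" "t \<notin> N"
      then have "t \<in> D" using OIvl_sub[OF xI] OIvl_minus_N_subset_D by blast
      then show "\<bar>f2s t - a2\<bar> \<le> e / 2" using d(3)[of t] t x by (auto simp: OIvl_def dist_real_def)
    qed
    then have "\<bar>R x / \<phi>2 x\<bar> \<le> e / 2" using phi2_nz[OF xI] by (simp add: abs_divide pos_divide_le_eq mult.commute)
    also have "\<dots> < e" using \<open>0 < e\<close> by simp
    finally show ?thesis by (simp only: dist_real_def diff_zero)
  qed
  then show "\<forall>\<^sub>F t in at_x0 x0. dist (R t / \<phi>2 t) 0 < e"
    unfolding eventually_at_x0[OF T_lt] using d(1,2) by blast
qed

section \<open>Essential supremum estimates and mean value forms\<close>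

lemma esssup_f2s:
  assumes "x \<in> I"
  shows "ereal \<bar>R x\<bar> \<le> ereal \<bar>\<phi>2 x\<bar> * ess_sup_on (OIvl x x0) (\<lambda>t. \<bar>f2s t - a2\<bar>)"
proof (rule ess_sup_on_bound)
  show "0 < \<bar>\<phi>2 x\<bar>" using phi2_nz[OF assms] by simp
  fix s assume "AE t in lebesgue. t \<in> OIvl x x0 \<longrightarrow> \<bar>f2s t - a2\<bar> \<le> s"
  then obtain M where "M \<in> null_sets lebesgue" "{t \<in> space lebesgue. \<not> (t \<in> OIvl x x0 \<longrightarrow> \<bar>f2s t - a2\<bar> \<le> s)} \<subseteq> M"
    unfolding eventually_ae_filter by blast
  then show "\<bar>R x\<bar> \<le> \<bar>\<phi>2 x\<bar> * s"
    by (intro bound_f2s[OF assms, of M]) (auto simp: negligible_iff_null_sets)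
qed

lemma esssup_Fs:
  assumes "x \<in> I"
  shows "ereal \<bar>R x\<bar> \<le> ereal \<bar>\<phi>2 x / \<phi>2 T\<bar> * ess_sup_on (OIvl x x0) (\<lambda>t. \<bar>Fs t - \<gamma>\<bar>)"
proof (rule ess_sup_on_bound)
  show "0 < \<bar>\<phi>2 x / \<phi>2 T\<bar>" using phi2_nz[OF assms] phi2_nz[OF T_in_I] by simp
  fix s assume "AE t in lebesgue. t \<in> OIvl x x0 \<longrightarrow> \<bar>Fs t - \<gamma>\<bar> \<le> s"
  then obtain M where "M \<in> null_sets lebesgue" "{t \<in> space lebesgue. \<not> (t \<in> OIvl x x0 \<longrightarrow> \<bar>Fs t - \<gamma>\<bar> \<le> s)} \<subseteq> M"
    unfolding eventually_ae_filter by blast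
  then show "\<bar>R x\<bar> \<le> \<bar>\<phi>2 x / \<phi>2 T\<bar> * s"
    by (intro bound_Fs[OF assms, of M]) (auto simp: negligible_iff_null_sets)
qed

lemma N_empty_if_C1: "C1_on I f f' \<Longrightarrow> N = {}"
  unfolding C1_on_def N_def using OIvl_I
  by (auto simp: I_def real_differentiable_def) (metis at_within_Ivl)

lemma mean_value_f2s:
  assumes C1: "C1_on I f f'" and x: "x \<in> I"
  shows "\<exists>\<xi>\<in>OIvl x x0. R x = \<phi>2 x * (f2s \<xi> - a2)"
proof -
  note sub = Ivl_sub_I[OF x] OIvl_sub[OF x]
  have "\<exists>\<xi>\<in>OIvl x x0. R x / \<phi>1 x = \<phi>2 x / \<phi>1 x * (f2s \<xi> - a2)"
  proof (rule Cauchy_mean_value_half_open[OF I_less[OF x]])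
    show "continuous_on (Ivl x x0) (\<lambda>t. R t / \<phi>1 t)" "continuous_on (Ivl x x0) (\<lambda>t. \<phi>2 t / \<phi>1 t)"
      using continuous_on_subset[OF cont_I[OF AC_R_phi1] sub(1)] continuous_on_subset[OF cont_I[OF AC_phi2_phi1] sub(1)] .
    show "\<phi>2 x / \<phi>1 x \<noteq> 0" using phi1_nz[OF x] phi2_nz[OF x] by simp
    fix t assume "t \<in> OIvl x x0"
    then have t: "t \<in> OIvl T x0" using sub by blast
    show "((\<lambda>t. R t / \<phi>1 t) has_real_derivative W t / (\<phi>1 t)\<^sup>2 * (f2s t - a2)) (at t)"
      using der_R_phi1[OF t] N_empty_if_C1[OF C1] by simp
    show "((\<lambda>t. \<phi>2 t / \<phi>1 t) has_real_derivative W t / (\<phi>1 t)\<^sup>2) (at t)"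
      by (rule der_phi2_phi1[OF t])
    show "W t / (\<phi>1 t)\<^sup>2 \<noteq> 0" using W_nz phi1_nz OIvl_I[OF t] by simp
  qed (rule lim_R_phi1 lim_phi2_phi1)+
  then show ?thesis using phi1_nz[OF x] by (auto simp: divide_simps)
qed

lemma mean_value_Fs:
  assumes C1: "C1_on I f f'" and x: "x \<in> OIvl T x0"
  shows "\<exists>\<xi>\<in>OIvl x x0. R x = \<phi>2 x / \<phi>2 T * (Fs \<xi> - \<gamma>)"
proof -
  have "\<exists>\<xi>\<in>OIvl x x0. R x / \<Phi> x = \<phi>2 x / \<Phi> x / \<phi>2 T * (Fs \<xi> - \<gamma>)"
  proof (rule Cauchy_mean_value_half_open[OF I_less[OF OIvl_I[OF x]]])
    show "continuous_on (Ivl x x0) (\<lambda>t. R t / \<Phi> t)" "continuous_on (Ivl x x0) (\<lambda>t. \<phi>2 t / \<Phi> t / \<phi>2 T)"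
      using AC_on_imp_continuous_on[OF AC_R_Phi[OF x]] AC_on_imp_continuous_on[OF AC_phi2_Phi[OF x]] .
    show "\<phi>2 x / \<Phi> x / \<phi>2 T \<noteq> 0" using Phi_nz[OF x] phi2_nz[OF OIvl_I[OF x]] phi2_nz[OF T_in_I] by simp
    fix t assume "t \<in> OIvl x x0"
    then have t: "t \<in> OIvl T x0" using OIvl_sub[OF OIvl_I[OF x]] by blast
    show "((\<lambda>t. R t / \<Phi> t) has_real_derivative W t / (\<Phi> t)\<^sup>2 * (Fs t - \<gamma>)) (at t)"
      using der_R_Phi[OF t] N_empty_if_C1[OF C1] by simp
    show "((\<lambda>t. \<phi>2 t / \<Phi> t / \<phi>2 T) has_real_derivative W t / (\<Phi> t)\<^sup>2) (at t)"
      by (rule der_phi2_Phi[OF t])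
    show "W t / (\<Phi> t)\<^sup>2 \<noteq> 0" using W_nz[OF OIvl_I[OF t]] Phi_nz[OF t] by simp
  qed (rule lim_R_Phi lim_phi2_Phi)+
  then show ?thesis using Phi_nz[OF x] phi2_nz[OF T_in_I] by (auto simp: divide_simps)
qed

lemma imp_int_R_Phi:
  assumes "x \<in> OIvl T x0"
    and "\<And>t. t \<in> OIvl x x0 \<Longrightarrow> t \<notin> N \<Longrightarrow> g t = W t / (\<Phi> t)\<^sup>2 * (Fs t - \<gamma>)"
  shows "imp_int x0 g x (- (R x / \<Phi> x))"
proof -
  have x: "x \<in> Ivl x x0" using assms(1) by (simp add: OIvl_def Ivl_def)
  have "((\<lambda>s. R s / \<Phi> s) has_real_derivative g t) (at t)" if "t \<in> OIvl x x0" "t \<notin> N" for t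
    using der_R_Phi[of t] OIvl_sub[OF OIvl_I[OF assms(1)]] assms(2)[OF that] that by auto
  from imp_int_AC_on[OF AC_R_Phi[OF assms(1)] negligible_N this lim_R_Phi x] show ?thesis by simp
qed

end

section \<open>Absolutely continuous derivatives and the operator L\<close>

locale wronskian_pair_AC1 = wronskian_pair +
  fixes Lf
  defines "Lf \<equiv> Lop \<phi>1 W f"
  assumes phi1_AC1: "AC1_on I \<phi>1 \<phi>1'" and phi2_AC1: "AC1_on I \<phi>2 \<phi>2'" and f_AC1: "AC1_on I f f'"
begin

lemma f_C1: "C1_on I f f'"
  using f_AC1 by (simp add: AC1_on_def)

lemma N_empty: "N = {}"
  by (rule N_empty_if_C1[OF f_C1])

lemma AC_W: "AC_on I W"
  unfolding W_def Wr_def using phi1_AC1 phi2_AC1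
  by (intro AC_on_diff AC_on_mult AC_phi1 AC_phi2) (auto simp: AC1_on_def)

lemma AC_f1s: "AC_on I f1s"
  unfolding f1s_def Wr_def using f_AC1 phi2_AC1
  by (intro AC_on_divide AC_on_diff AC_on_mult AC_W W_nz f_AC AC_phi2) (auto simp: AC1_on_def)

lemma AC_f2s: "AC_on I f2s"
  unfolding f2s_def Wr_def using f_AC1 phi1_AC1
  by (intro AC_on_divide AC_on_minus AC_on_diff AC_on_mult AC_W W_nz f_AC AC_phi1) (auto simp: AC1_on_def)

lemma AC_Fs: "AC_on I Fs"
  unfolding Fs_def by (intro AC_on_add AC_on_mult AC_on_const AC_f1s AC_f2s)

text \<open>Now \<open>f1s\<close>, \<open>f2s\<close> and \<open>Fs\<close> are continuous too, so
  their limits along \<open>D\<close> become the full limits that \<open>imp_int_AC_on\<close>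
  requires.\<close>

lemma lim_at_x0:
  assumes "AC_on I h" "(h \<longlongrightarrow> l) (inf (at_x0 x0) (principal D))"
  shows "(h \<longlongrightarrow> l) (at_x0 x0)"
  by (rule tendsto_at_x0_dense[OF T_lt cont_I[OF assms(1), unfolded I_def] negligible_N OIvl_minus_N_subset_D assms(2)])

text \<open>One exceptional set for all three coefficients: in the open interval \<open>f1s\<close>
  and \<open>Fs\<close> are differentiable wherever \<open>f2s\<close> is, by \<open>der_f1s\<close>
  and \<open>der_Fs\<close>.\<close>

definition N2 where "N2 = {t \<in> OIvl T x0. \<not> f2s differentiable (at t)}"

lemma negligible_N2: "negligible N2"
  using AC_on_differentiable_ae AC_f2s unfolding N2_def I_def .

text \<open>The left side is the inner expression of \<open>Lop\<close>, so L[f] is W / \<phi>1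
  times the derivative of \<open>f2s\<close>.\<close>

lemma f2s_eq_quotient_deriv:
  assumes t: "t \<in> OIvl T x0"
  shows "(\<phi>1 t)\<^sup>2 / W t * deriv (\<lambda>s. f s / \<phi>1 s) t = f2s t"
proof -
  have "((\<lambda>s. f s / \<phi>1 s) has_real_derivative (f' t * \<phi>1 t - \<phi>1' t * f t) / (\<phi>1 t ^ Suc (Suc 0))) (at t)"
    by (rule DERIV_quotient[OF der_f der_phi1 phi1_nz[OF OIvl_I[OF t]]]) (use t N_empty in auto)
  then have "deriv (\<lambda>s. f s / \<phi>1 s) t = (f' t * \<phi>1 t - \<phi>1' t * f t) / (\<phi>1 t)\<^sup>2"
    by (simp add: DERIV_imp_deriv power2_eq_square)
  moreover have "(\<phi>1 t)\<^sup>2 / W t * ((f' t * \<phi>1 t - \<phi>1' t * f t) / (\<phi>1 t)\<^sup>2) = (f' t * \<phi>1 t - \<phi>1' t * f t) / W t"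
    using phi1_nz[OF OIvl_I[OF t]] by simp
  ultimately show ?thesis by (simp only:) (simp add: f2s_def Wr_def mult.commute)
qed

lemma der_f2s:
  assumes t: "t \<in> OIvl T x0" "t \<notin> N2"
  shows "(f2s has_real_derivative \<phi>1 t / W t * Lf t) (at t)"
proof -
  have "\<forall>\<^sub>F s in nhds t. s \<in> OIvl T x0" by (rule eventually_nhds_in_open[OF open_OIvl t(1)])
  then have "\<forall>\<^sub>F s in nhds t. (\<phi>1 s)\<^sup>2 / W s * deriv (\<lambda>s. f s / \<phi>1 s) s = f2s s"
    by eventually_elim (rule f2s_eq_quotient_deriv)
  \<comment> \<open>\<open>deriv\<close> depends on the values near \<open>t\<close>, so equality at
    the single point \<open>t\<close> would not do; it is known on a neighbourhood.\<close>
  then have "deriv (\<lambda>s. (\<phi>1 s)\<^sup>2 / W s * deriv (\<lambda>s. f s / \<phi>1 s) s) t = deriv f2s t"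
    by (rule deriv_cong_ev) simp
  then have "\<phi>1 t / W t * Lf t = deriv f2s t"
    using phi1_nz[OF OIvl_I[OF t(1)]] W_nz[OF OIvl_I[OF t(1)]] by (simp add: Lf_def Lop_def)
  moreover have "(f2s has_real_derivative deriv f2s t) (at t)"
    using t by (simp add: N2_def DERIV_deriv_iff_real_differentiable)
  ultimately show ?thesis by simp
qed

text \<open>In variation of constants the derivatives satisfy f1s' \<phi>1 + f2s' \<phi>2 = 0.
  Writing f1s as (f - f2s \<phi>2) / \<phi>1 yields this from the derivative of \<open>f2s\<close>,
  without second derivatives of f.\<close>

lemma der_f1s:
  assumes t: "t \<in> OIvl T x0" "t \<notin> N2"
  shows "(f1s has_real_derivative - (\<phi>2 t / W t * Lf t)) (at t)"
proof -
  have nz: "\<phi>1 t \<noteq> 0" "W t \<noteq> 0" using phi1_nz W_nz OIvl_I[OF t(1)] by auto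
  define L where "L = \<phi>1 t / W t * Lf t"
  have "((\<lambda>s. f s - f2s s * \<phi>2 s) has_real_derivative f' t - (L * \<phi>2 t + \<phi>2' t * f2s t)) (at t)"
    unfolding L_def by (intro DERIV_diff DERIV_mult der_f der_f2s der_phi2 t) (simp add: N_empty)
  from DERIV_quotient[OF this der_phi1[OF t(1)] nz(1)]
  have "((\<lambda>s. (f s - f2s s * \<phi>2 s) / \<phi>1 s) has_real_derivative
    ((f' t - (L * \<phi>2 t + \<phi>2' t * f2s t)) * \<phi>1 t - \<phi>1' t * (f t - f2s t * \<phi>2 t)) / (\<phi>1 t ^ Suc (Suc 0))) (at t)" .
  moreover have "f t - f2s t * \<phi>2 t = f1s t * \<phi>1 t"
    using f_decomp[OF OIvl_I[OF t(1)]] by simp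
  moreover have "f' t - (L * \<phi>2 t + \<phi>2' t * f2s t) = f1s t * \<phi>1' t - L * \<phi>2 t"
    using f'_decomp[OF OIvl_I[OF t(1)]] by (simp add: algebra_simps)
  moreover have "((f1s t * \<phi>1' t - L * \<phi>2 t) * \<phi>1 t - \<phi>1' t * (f1s t * \<phi>1 t)) / (\<phi>1 t ^ Suc (Suc 0)) = - (\<phi>2 t / W t * Lf t)"
    using nz by (simp add: L_def field_simps)
  ultimately have "((\<lambda>s. (f s - f2s s * \<phi>2 s) / \<phi>1 s) has_real_derivative - (\<phi>2 t / W t * Lf t)) (at t)"
    by (simp only:)
  then show ?thesis
  proof (rule has_field_derivative_transform_within_open[OF _ open_OIvl t(1)])
    fix s assume "s \<in> OIvl T x0"
    then show "(f s - f2s s * \<phi>2 s) / \<phi>1 s = f1s s"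
      using f_decomp[OF OIvl_I] phi1_nz[OF OIvl_I] by (simp add: field_simps)
  qed
qed

lemma der_Fs:
  assumes t: "t \<in> OIvl T x0" "t \<notin> N2"
  shows "(Fs has_real_derivative \<Phi> t / W t * Lf t) (at t)"
proof -
  have "(Fs has_real_derivative \<phi>1 T * - (\<phi>2 t / W t * Lf t) + \<phi>2 T * (\<phi>1 t / W t * Lf t)) (at t)"
    unfolding Fs_def by (intro DERIV_add DERIV_cmult der_f1s der_f2s t)
  moreover have "\<phi>1 T * - (\<phi>2 t / W t * Lf t) + \<phi>2 T * (\<phi>1 t / W t * Lf t) = \<Phi> t / W t * Lf t"
    by (simp add: \<Phi>_def diff_divide_distrib left_diff_distrib)
  ultimately show ?thesis by (simp only:)
qed

lemma imp_int_phi1_L: "t \<in> I \<Longrightarrow> imp_int x0 (\<lambda>s. \<phi>1 s / W s * Lf s) t (a2 - f2s t)"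
  unfolding I_def
  by (rule imp_int_AC_on[OF AC_f2s[unfolded I_def] negligible_N2 der_f2s lim_at_x0[OF AC_f2s lim2]])

lemma imp_int_phi2_L:
  assumes "t \<in> I"
  shows "imp_int x0 (\<lambda>s. \<phi>2 s / W s * Lf s) t (f1s t - a1)"
proof -
  have "((\<lambda>s. - f1s s) has_real_derivative \<phi>2 s / W s * Lf s) (at s)" if "s \<in> OIvl T x0" "s \<notin> N2" for s
    using DERIV_minus[OF der_f1s[OF that]] by simp
  from imp_int_AC_on[OF AC_on_minus[OF AC_f1s[unfolded I_def]] negligible_N2 this tendsto_minus[OF lim_at_x0[OF AC_f1s lim1]]
      assms[unfolded I_def]]
  show ?thesis by simp
qed

lemma imp_int_Phi_L: "t \<in> I \<Longrightarrow> imp_int x0 (\<lambda>s. \<Phi> s / W s * Lf s) t (\<gamma> - Fs t)"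
  unfolding I_def
  by (rule imp_int_AC_on[OF AC_Fs[unfolded I_def] negligible_N2 der_Fs lim_at_x0[OF AC_Fs lim_Fs]])

text \<open>By \<open>imp_int_phi1_L\<close> the factor a2 - f2s t is the value of the inner
  integral of L[f], so the double integral is the one of (I) with the opposite sign.\<close>

lemma iterated_phi1:
  assumes "x \<in> I"
  shows "imp_int x0 (\<lambda>t. deriv (\<lambda>s. \<phi>2 s / \<phi>1 s) t * (a2 - f2s t)) x (R x / \<phi>1 x)"
proof (rule imp_int_R_phi1'[OF assms])
  fix t assume "t \<in> OIvl T x0"
  from DERIV_imp_deriv[OF der_phi2_phi1[OF this]]
  show "deriv (\<lambda>s. \<phi>2 s / \<phi>1 s) t * (a2 - f2s t) = - (W t / (\<phi>1 t)\<^sup>2 * (f2s t - a2))"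
    by (simp only: mult_minus_right[symmetric] minus_diff_eq)
qed

text \<open>The factor f1s t - a1 is the inner integral, by \<open>imp_int_phi2_L\<close>; the
  boundary term at \<open>x0\<close> disappears by \<open>lim_R_phi2\<close>.\<close>

lemma iterated_phi2:
  assumes "x \<in> I"
  shows "imp_int x0 (\<lambda>t. deriv (\<lambda>s. \<phi>1 s / \<phi>2 s) t * (f1s t - a1)) x (- (R x / \<phi>2 x))"
proof -
  have "((\<lambda>s. R s / \<phi>2 s) has_real_derivative deriv (\<lambda>s. \<phi>1 s / \<phi>2 s) t * (f1s t - a1)) (at t)"
    if "t \<in> OIvl T x0" "t \<notin> N" for t
    using der_R_phi2[OF that] DERIV_imp_deriv[OF der_phi1_phi2[OF that(1)]] by (simp only:)
  from imp_int_AC_on[OF AC_R_phi2[unfolded I_def] negligible_N this lim_R_phi2 assms[unfolded I_def]]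
  show ?thesis by simp
qed

lemma iterated_Phi:
  assumes x: "x \<in> OIvl T x0"
  shows "imp_int x0 (\<lambda>t. W t / (\<Phi> t)\<^sup>2 * (\<gamma> - Fs t)) x (R x / \<Phi> x)"
proof -
  have "((\<lambda>s. - (R s / \<Phi> s)) has_real_derivative W t / (\<Phi> t)\<^sup>2 * (\<gamma> - Fs t)) (at t)"
    if "t \<in> OIvl x x0" "t \<notin> N" for t
  proof -
    have "t \<in> OIvl T x0" using that OIvl_sub[OF OIvl_I[OF x]] by blast
    from DERIV_minus[OF der_R_Phi[OF this that(2)]] show ?thesis
      by (simp only: mult_minus_right[symmetric] minus_diff_eq)
  qed
  moreover have "x \<in> Ivl x x0" using x by (simp add: OIvl_def Ivl_def)
  ultimately show ?thesis
    using imp_int_AC_on[OF AC_on_minus[OF AC_R_Phi[OF x]] negligible_N _ tendsto_minus[OF lim_R_Phi]] by fastforce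
qed

text \<open>f2s t - a2 is minus the integral of \<phi>1 / W L[f] from \<open>t\<close> to
  \<open>x0\<close>, so the Lebesgue integral of the modulus over \<open>OIvl x x0\<close> bounds it
  for every t beyond x, as \<open>bound_f2s\<close> demands.\<close>

lemma nn_bound_phi1:
  assumes x: "x \<in> I"
  shows "ennreal \<bar>R x\<bar> \<le> ennreal \<bar>\<phi>2 x\<bar> * (\<integral>\<^sup>+ t \<in> OIvl x x0. ennreal \<bar>\<phi>1 t / W t * Lf t\<bar> \<partial>lebesgue)"
proof (rule ennreal_le_mult_bound)
  show "0 < \<bar>\<phi>2 x\<bar>" using phi2_nz[OF x] by simp
  fix s assume s: "0 \<le> s" "(\<integral>\<^sup>+ t \<in> OIvl x x0. ennreal \<bar>\<phi>1 t / W t * Lf t\<bar> \<partial>lebesgue) \<le> ennreal s"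
  show "\<bar>R x\<bar> \<le> \<bar>\<phi>2 x\<bar> * s"
  proof (rule bound_f2s[OF x negligible_empty])
    fix t assume t: "t \<in> OIvl x x0"
    then have "t \<in> I" using OIvl_sub[OF x] OIvl_I by blast
    from imp_int_abs_le[OF imp_int_phi1_L[OF this] t s] show "\<bar>f2s t - a2\<bar> \<le> s" by simp
  qed
qed

lemma nn_bound_Phi:
  assumes x: "x \<in> I"
  shows "ennreal \<bar>R x\<bar> \<le> ennreal \<bar>\<phi>2 x / \<phi>2 T\<bar> * (\<integral>\<^sup>+ t \<in> OIvl x x0. ennreal \<bar>\<Phi> t / W t * Lf t\<bar> \<partial>lebesgue)"
proof (rule ennreal_le_mult_bound)
  show "0 < \<bar>\<phi>2 x / \<phi>2 T\<bar>" using phi2_nz[OF x] phi2_nz[OF T_in_I] by simp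
  fix s assume s: "0 \<le> s" "(\<integral>\<^sup>+ t \<in> OIvl x x0. ennreal \<bar>\<Phi> t / W t * Lf t\<bar> \<partial>lebesgue) \<le> ennreal s"
  show "\<bar>R x\<bar> \<le> \<bar>\<phi>2 x / \<phi>2 T\<bar> * s"
  proof (rule bound_Fs[OF x negligible_empty])
    fix t assume t: "t \<in> OIvl x x0"
    then have "t \<in> I" using OIvl_sub[OF x] OIvl_I by blast
    from imp_int_abs_le[OF imp_int_Phi_L[OF this] t s] show "\<bar>Fs t - \<gamma>\<bar> \<le> s" by simp
  qed
qed

end

theorem theorem5p3:
  fixes T :: real and x0 :: ereal
    and \<phi>1 \<phi>2 \<phi>1' \<phi>2' f f' :: "real \<Rightarrow> real" and a1 a2 :: real
  defines "I \<equiv> Ivl T x0"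
  defines "W \<equiv> Wr \<phi>1 \<phi>1' \<phi>2 \<phi>2'"
  defines "D \<equiv> {t \<in> I. f differentiable (at t within I)}"
  defines "f1s \<equiv> (\<lambda>t. Wr f f' \<phi>2 \<phi>2' t / W t)"
  defines "f2s \<equiv> (\<lambda>t. - Wr f f' \<phi>1 \<phi>1' t / W t)"
  defines "\<Phi> \<equiv> (\<lambda>x. \<phi>2 T * \<phi>1 x - \<phi>1 T * \<phi>2 x)"
  defines "Fs \<equiv> (\<lambda>t. \<phi>1 T * f1s t + \<phi>2 T * f2s t)"
  defines "R \<equiv> (\<lambda>x. f x - a1 * \<phi>1 x - a2 * \<phi>2 x)"
  defines "Lf \<equiv> Lop \<phi>1 W f"
  assumes T_lt: "ereal T < x0"
    and phi1_C1: "C1_on I \<phi>1 \<phi>1'" and phi2_C1: "C1_on I \<phi>2 \<phi>2'"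
    and small_o: "\<phi>2 \<in> o[at_x0 x0](\<phi>1)"
    and phi1_nz: "\<forall>x\<in>I. \<phi>1 x \<noteq> 0" and phi2_nz: "\<forall>x\<in>I. \<phi>2 x \<noteq> 0"
    and W_nz: "\<forall>x\<in>I. W x \<noteq> 0"
    and f_AC: "AC_on I f"
    and f'_deriv: "\<forall>t\<in>D. (f has_real_derivative f' t) (at t within I)"
    and lim1: "(f1s \<longlongrightarrow> a1) (inf (at_x0 x0) (principal D))"
    and lim2: "(f2s \<longlongrightarrow> a2) (inf (at_x0 x0) (principal D))"
  shows "\<exists>\<gamma>. (Fs \<longlongrightarrow> \<gamma>) (inf (at_x0 x0) (principal D)) \<and>
    \<comment> \<open>(I)\<close>
    (\<forall>x\<in>I. \<exists>v. imp_int x0 (\<lambda>t. W t / \<phi>1 t ^ 2 * (f2s t - a2)) x v \<and> R x = - \<phi>1 x * v) \<and>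
    (\<forall>x\<in>I. \<exists>v. imp_int x0 (\<lambda>t. deriv (\<lambda>s. \<phi>2 s / \<phi>1 s) t * (f2s t - a2)) x v \<and> R x = - \<phi>1 x * v) \<and>
    (\<forall>x\<in>OIvl T x0. \<exists>v. imp_int x0 (\<lambda>t. W t / \<Phi> t ^ 2 * (Fs t - \<gamma>)) x v \<and> R x = - \<Phi> x * v) \<and>
    (AC1_on I \<phi>1 \<phi>1' \<and> AC1_on I \<phi>2 \<phi>2' \<and> AC1_on I f f' \<longrightarrow>
      (\<forall>x\<in>I. \<exists>G. (\<forall>t. x \<le> t \<and> ereal t < x0 \<longrightarrow> imp_int x0 (\<lambda>s. \<phi>1 s / W s * Lf s) t (G t)) \<and>
          (\<exists>v. imp_int x0 (\<lambda>t. deriv (\<lambda>s. \<phi>2 s / \<phi>1 s) t * G t) x v \<and> R x = \<phi>1 x * v)) \<and>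
      (\<forall>x\<in>I. \<exists>G. (\<forall>t. x \<le> t \<and> ereal t < x0 \<longrightarrow> imp_int x0 (\<lambda>s. \<phi>2 s / W s * Lf s) t (G t)) \<and>
          (\<exists>v. imp_int x0 (\<lambda>t. deriv (\<lambda>s. \<phi>1 s / \<phi>2 s) t * G t) x v \<and> R x = - \<phi>2 x * v)) \<and>
      (\<forall>x\<in>OIvl T x0. \<exists>G. (\<forall>t. x \<le> t \<and> ereal t < x0 \<longrightarrow> imp_int x0 (\<lambda>s. \<Phi> s / W s * Lf s) t (G t)) \<and>
          (\<exists>v. imp_int x0 (\<lambda>t. W t / \<Phi> t ^ 2 * G t) x v \<and> R x = \<Phi> x * v))) \<and>
    \<comment> \<open>(II)\<close>
    (\<forall>x\<in>I. ereal \<bar>R x\<bar> \<le> ereal \<bar>\<phi>2 x\<bar> * ess_sup_on (OIvl x x0) (\<lambda>t. \<bar>f2s t - a2\<bar>)) \<and>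
    (\<forall>x\<in>I. ereal \<bar>R x\<bar> \<le> ereal \<bar>\<phi>2 x / \<phi>2 T\<bar> * ess_sup_on (OIvl x x0) (\<lambda>t. \<bar>Fs t - \<gamma>\<bar>)) \<and>
    (AC1_on I \<phi>1 \<phi>1' \<and> AC1_on I \<phi>2 \<phi>2' \<and> AC1_on I f f' \<longrightarrow>
      (\<forall>x\<in>I. ennreal \<bar>R x\<bar> \<le>
          ennreal \<bar>\<phi>2 x\<bar> * (\<integral>\<^sup>+ t \<in> OIvl x x0. ennreal \<bar>\<phi>1 t / W t * Lf t\<bar> \<partial>lebesgue)) \<and>
      (\<forall>x\<in>OIvl T x0. ennreal \<bar>R x\<bar> \<le>
          ennreal \<bar>\<phi>2 x / \<phi>2 T\<bar> * (\<integral>\<^sup>+ t \<in> OIvl x x0. ennreal \<bar>\<Phi> t / W t * Lf t\<bar> \<partial>lebesgue))) \<and>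
    \<comment> \<open>(III)\<close>
    (C1_on I f f' \<longrightarrow>
      (\<forall>x\<in>I. \<exists>\<xi>. ereal x \<le> \<xi> \<and> \<xi> \<le> x0 \<and> R x = \<phi>2 x * (ext_at x0 f2s a2 \<xi> - a2)) \<and>
      (\<forall>x\<in>OIvl T x0. \<exists>\<xi>. ereal x \<le> \<xi> \<and> \<xi> \<le> x0 \<and>
          R x = \<phi>2 x / \<phi>2 T * (ext_at x0 Fs \<gamma> \<xi> - \<gamma>))) \<and>
    (AC1_on I \<phi>1 \<phi>1' \<and> AC1_on I \<phi>2 \<phi>2' \<and> AC1_on I f f' \<longrightarrow>
      (\<forall>x\<in>OIvl T x0. \<exists>\<xi> v. ereal x \<le> \<xi> \<and> \<xi> \<le> x0 \<and>
          R x = \<phi>2 x * (ext_at x0 f2s a2 \<xi> - a2) \<and>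
          imp_int_ext x0 (\<lambda>t. \<phi>1 t / W t * Lf t) \<xi> v \<and> R x = - \<phi>2 x * v) \<and>
      (\<forall>x\<in>OIvl T x0. \<exists>\<xi> v. ereal x \<le> \<xi> \<and> \<xi> \<le> x0 \<and>
          R x = \<phi>2 x / \<phi>2 T * (ext_at x0 Fs \<gamma> \<xi> - \<gamma>) \<and>
          imp_int_ext x0 (\<lambda>t. \<Phi> t / W t * Lf t) \<xi> v \<and> R x = - (\<phi>2 x / \<phi>2 T) * v))"
proof -
  have wp: "wronskian_pair T x0 \<phi>1 \<phi>2 \<phi>1' \<phi>2' f f' a1 a2"
    using T_lt phi1_C1 phi2_C1 small_o phi1_nz phi2_nz W_nz f_AC f'_deriv lim1 lim2
    unfolding wronskian_pair_def I_def D_def f1s_def f2s_def W_def by (intro conjI allI impI) blast+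
  define \<gamma> where "\<gamma> \<equiv> \<phi>1 T * a1 + \<phi>2 T * a2"
  interpret wronskian_pair T x0 \<phi>1 \<phi>2 \<phi>1' \<phi>2' f f' a1 a2 I W D f1s f2s \<Phi> Fs R \<gamma>
    by (rule wp) (rule I_def W_def D_def f1s_def f2s_def \<Phi>_def Fs_def R_def \<gamma>_def)+
  \<comment> \<open>This hypothesis guards only some of the conclusions, so the second locale is
    interpreted separately inside their proofs.\<close>
  let ?AC1 = "AC1_on I \<phi>1 \<phi>1' \<and> AC1_on I \<phi>2 \<phi>2' \<and> AC1_on I f f'"
  have AC1: "wronskian_pair_AC1 T x0 \<phi>1 \<phi>2 \<phi>1' \<phi>2' f f' a1 a2" if ?AC1
    using wp that unfolding wronskian_pair_AC1_def wronskian_pair_AC1_axioms_def I_def by blast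
  have I1: "\<forall>x\<in>I. \<exists>v. imp_int x0 (\<lambda>t. W t / \<phi>1 t ^ 2 * (f2s t - a2)) x v \<and> R x = - \<phi>1 x * v"
  proof
    fix x assume x: "x \<in> I"
    have "imp_int x0 (\<lambda>t. W t / \<phi>1 t ^ 2 * (f2s t - a2)) x (- (R x / \<phi>1 x))"
      by (rule imp_int_R_phi1[OF x]) simp
    then show "\<exists>v. imp_int x0 (\<lambda>t. W t / \<phi>1 t ^ 2 * (f2s t - a2)) x v \<and> R x = - \<phi>1 x * v"
      using phi1_nz x by (intro exI conjI) auto
  qed
  have I2: "\<forall>x\<in>I. \<exists>v. imp_int x0 (\<lambda>t. deriv (\<lambda>s. \<phi>2 s / \<phi>1 s) t * (f2s t - a2)) x v \<and> R x = - \<phi>1 x * v"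
  proof
    fix x assume x: "x \<in> I"
    have "imp_int x0 (\<lambda>t. deriv (\<lambda>s. \<phi>2 s / \<phi>1 s) t * (f2s t - a2)) x (- (R x / \<phi>1 x))"
      by (rule imp_int_R_phi1[OF x]) (simp add: DERIV_imp_deriv[OF der_phi2_phi1])
    then show "\<exists>v. imp_int x0 (\<lambda>t. deriv (\<lambda>s. \<phi>2 s / \<phi>1 s) t * (f2s t - a2)) x v \<and> R x = - \<phi>1 x * v"
      using phi1_nz x by (intro exI conjI) auto
  qed
  have I3: "\<forall>x\<in>OIvl T x0. \<exists>v. imp_int x0 (\<lambda>t. W t / \<Phi> t ^ 2 * (Fs t - \<gamma>)) x v \<and> R x = - \<Phi> x * v"
  proof
    fix x assume x: "x \<in> OIvl T x0"
    have "imp_int x0 (\<lambda>t. W t / \<Phi> t ^ 2 * (Fs t - \<gamma>)) x (- (R x / \<Phi> x))"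
      by (rule imp_int_R_Phi[OF x]) simp
    then show "\<exists>v. imp_int x0 (\<lambda>t. W t / \<Phi> t ^ 2 * (Fs t - \<gamma>)) x v \<and> R x = - \<Phi> x * v"
      using Phi_nz[OF x] by (intro exI conjI) auto
  qed
  have I4: "(\<forall>x\<in>I. \<exists>G. (\<forall>t. x \<le> t \<and> ereal t < x0 \<longrightarrow> imp_int x0 (\<lambda>s. \<phi>1 s / W s * Lf s) t (G t)) \<and>
          (\<exists>v. imp_int x0 (\<lambda>t. deriv (\<lambda>s. \<phi>2 s / \<phi>1 s) t * G t) x v \<and> R x = \<phi>1 x * v)) \<and>
      (\<forall>x\<in>I. \<exists>G. (\<forall>t. x \<le> t \<and> ereal t < x0 \<longrightarrow> imp_int x0 (\<lambda>s. \<phi>2 s / W s * Lf s) t (G t)) \<and>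
          (\<exists>v. imp_int x0 (\<lambda>t. deriv (\<lambda>s. \<phi>1 s / \<phi>2 s) t * G t) x v \<and> R x = - \<phi>2 x * v)) \<and>
      (\<forall>x\<in>OIvl T x0. \<exists>G. (\<forall>t. x \<le> t \<and> ereal t < x0 \<longrightarrow> imp_int x0 (\<lambda>s. \<Phi> s / W s * Lf s) t (G t)) \<and>
          (\<exists>v. imp_int x0 (\<lambda>t. W t / \<Phi> t ^ 2 * G t) x v \<and> R x = \<Phi> x * v))" if ?AC1
  proof -
    interpret L: wronskian_pair_AC1 T x0 \<phi>1 \<phi>2 \<phi>1' \<phi>2' f f' a1 a2 I W D f1s f2s \<Phi> Fs R \<gamma> Lf
      by (rule AC1[OF that]) (rule I_def W_def D_def f1s_def f2s_def \<Phi>_def Fs_def R_def \<gamma>_def Lf_def)+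
    have tI: "t \<in> I" if "x \<in> I" "x \<le> t \<and> ereal t < x0" for x t
      using that by (auto simp: I_def Ivl_def)
    show ?thesis
    proof (intro conjI ballI)
      fix x assume x: "x \<in> I"
      \<comment> \<open>The inner integral is known in closed form, and its value is the witness
        \<open>G\<close>.\<close>
      have "imp_int x0 (\<lambda>s. \<phi>1 s / W s * Lf s) t (a2 - f2s t)" if "x \<le> t \<and> ereal t < x0" for t
        by (rule L.imp_int_phi1_L[OF tI[OF x that]])
      moreover have "R x = \<phi>1 x * (R x / \<phi>1 x)" using phi1_nz x by simp
      ultimately show "\<exists>G. (\<forall>t. x \<le> t \<and> ereal t < x0 \<longrightarrow> imp_int x0 (\<lambda>s. \<phi>1 s / W s * Lf s) t (G t)) \<and>
          (\<exists>v. imp_int x0 (\<lambda>t. deriv (\<lambda>s. \<phi>2 s / \<phi>1 s) t * G t) x v \<and> R x = \<phi>1 x * v)"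
        by (intro exI[of _ "\<lambda>t. a2 - f2s t"] exI[of _ "R x / \<phi>1 x"] conjI allI impI L.iterated_phi1[OF x])
      have "imp_int x0 (\<lambda>s. \<phi>2 s / W s * Lf s) t (f1s t - a1)" if "x \<le> t \<and> ereal t < x0" for t
        by (rule L.imp_int_phi2_L[OF tI[OF x that]])
      moreover have "R x = - \<phi>2 x * - (R x / \<phi>2 x)" using phi2_nz x by simp
      ultimately show "\<exists>G. (\<forall>t. x \<le> t \<and> ereal t < x0 \<longrightarrow> imp_int x0 (\<lambda>s. \<phi>2 s / W s * Lf s) t (G t)) \<and>
          (\<exists>v. imp_int x0 (\<lambda>t. deriv (\<lambda>s. \<phi>1 s / \<phi>2 s) t * G t) x v \<and> R x = - \<phi>2 x * v)"
        by (intro exI[of _ "\<lambda>t. f1s t - a1"] exI[of _ "- (R x / \<phi>2 x)"] conjI allI impI L.iterated_phi2[OF x])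
    next
      fix x assume x: "x \<in> OIvl T x0"
      have "imp_int x0 (\<lambda>s. \<Phi> s / W s * Lf s) t (\<gamma> - Fs t)" if "x \<le> t \<and> ereal t < x0" for t
        by (rule L.imp_int_Phi_L[OF tI[OF OIvl_I[OF x] that]])
      moreover have "R x = \<Phi> x * (R x / \<Phi> x)" using Phi_nz[OF x] by simp
      ultimately show "\<exists>G. (\<forall>t. x \<le> t \<and> ereal t < x0 \<longrightarrow> imp_int x0 (\<lambda>s. \<Phi> s / W s * Lf s) t (G t)) \<and>
          (\<exists>v. imp_int x0 (\<lambda>t. W t / \<Phi> t ^ 2 * G t) x v \<and> R x = \<Phi> x * v)"
        by (intro exI[of _ "\<lambda>t. \<gamma> - Fs t"] exI[of _ "R x / \<Phi> x"] conjI allI impI L.iterated_Phi[OF x])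
    qed
  qed
  have II3: "(\<forall>x\<in>I. ennreal \<bar>R x\<bar> \<le>
          ennreal \<bar>\<phi>2 x\<bar> * (\<integral>\<^sup>+ t \<in> OIvl x x0. ennreal \<bar>\<phi>1 t / W t * Lf t\<bar> \<partial>lebesgue)) \<and>
      (\<forall>x\<in>OIvl T x0. ennreal \<bar>R x\<bar> \<le>
          ennreal \<bar>\<phi>2 x / \<phi>2 T\<bar> * (\<integral>\<^sup>+ t \<in> OIvl x x0. ennreal \<bar>\<Phi> t / W t * Lf t\<bar> \<partial>lebesgue))" if ?AC1
  proof -
    interpret L: wronskian_pair_AC1 T x0 \<phi>1 \<phi>2 \<phi>1' \<phi>2' f f' a1 a2 I W D f1s f2s \<Phi> Fs R \<gamma> Lf
      by (rule AC1[OF that]) (rule I_def W_def D_def f1s_def f2s_def \<Phi>_def Fs_def R_def \<gamma>_def Lf_def)+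
    show ?thesis using L.nn_bound_phi1 L.nn_bound_Phi OIvl_I by blast
  qed
  \<comment> \<open>The intermediate points found lie strictly below \<open>x0\<close>, so
    \<open>ext_at\<close> returns the value of the function and \<open>imp_int_ext\<close> reduces
    to \<open>imp_int\<close>.\<close>
  have ext: "ext_at x0 g c (ereal \<xi>) = g \<xi>" "ereal x \<le> ereal \<xi>" "ereal \<xi> \<le> x0" "ereal \<xi> < x0"
    if "\<xi> \<in> OIvl x x0" for g c x \<xi>
    using that by (auto simp: ext_at_def OIvl_def)
  have III1: "(\<forall>x\<in>I. \<exists>\<xi>. ereal x \<le> \<xi> \<and> \<xi> \<le> x0 \<and> R x = \<phi>2 x * (ext_at x0 f2s a2 \<xi> - a2)) \<and>
      (\<forall>x\<in>OIvl T x0. \<exists>\<xi>. ereal x \<le> \<xi> \<and> \<xi> \<le> x0 \<and>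
          R x = \<phi>2 x / \<phi>2 T * (ext_at x0 Fs \<gamma> \<xi> - \<gamma>))" if C1: "C1_on I f f'"
  proof (intro conjI ballI)
    fix x assume "x \<in> I"
    from mean_value_f2s[OF C1 this] obtain \<xi> where \<xi>: "\<xi> \<in> OIvl x x0" "R x = \<phi>2 x * (f2s \<xi> - a2)" by blast
    then show "\<exists>\<xi>. ereal x \<le> \<xi> \<and> \<xi> \<le> x0 \<and> R x = \<phi>2 x * (ext_at x0 f2s a2 \<xi> - a2)"
      using ext[OF \<xi>(1)] by (intro exI[of _ "ereal \<xi>"]) auto
  next
    fix x assume "x \<in> OIvl T x0"
    from mean_value_Fs[OF C1 this] obtain \<xi> where \<xi>: "\<xi> \<in> OIvl x x0" "R x = \<phi>2 x / \<phi>2 T * (Fs \<xi> - \<gamma>)" by blast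
    then show "\<exists>\<xi>. ereal x \<le> \<xi> \<and> \<xi> \<le> x0 \<and> R x = \<phi>2 x / \<phi>2 T * (ext_at x0 Fs \<gamma> \<xi> - \<gamma>)"
      using ext[OF \<xi>(1)] by (intro exI[of _ "ereal \<xi>"]) auto
  qed
  have III2: "(\<forall>x\<in>OIvl T x0. \<exists>\<xi> v. ereal x \<le> \<xi> \<and> \<xi> \<le> x0 \<and>
          R x = \<phi>2 x * (ext_at x0 f2s a2 \<xi> - a2) \<and>
          imp_int_ext x0 (\<lambda>t. \<phi>1 t / W t * Lf t) \<xi> v \<and> R x = - \<phi>2 x * v) \<and>
      (\<forall>x\<in>OIvl T x0. \<exists>\<xi> v. ereal x \<le> \<xi> \<and> \<xi> \<le> x0 \<and>
          R x = \<phi>2 x / \<phi>2 T * (ext_at x0 Fs \<gamma> \<xi> - \<gamma>) \<and>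
          imp_int_ext x0 (\<lambda>t. \<Phi> t / W t * Lf t) \<xi> v \<and> R x = - (\<phi>2 x / \<phi>2 T) * v)" if ?AC1
  proof -
    interpret L: wronskian_pair_AC1 T x0 \<phi>1 \<phi>2 \<phi>1' \<phi>2' f f' a1 a2 I W D f1s f2s \<Phi> Fs R \<gamma> Lf
      by (rule AC1[OF that]) (rule I_def W_def D_def f1s_def f2s_def \<Phi>_def Fs_def R_def \<gamma>_def Lf_def)+
    have \<xi>I: "\<xi> \<in> I" if "\<xi> \<in> OIvl x x0" "x \<in> I" for \<xi> x
      using that OIvl_sub OIvl_I by blast
    show ?thesis
    proof (intro conjI ballI)
      fix x assume x: "x \<in> OIvl T x0"
      from mean_value_f2s[OF L.f_C1 OIvl_I[OF x]]
      obtain \<xi> where \<xi>: "\<xi> \<in> OIvl x x0" "R x = \<phi>2 x * (f2s \<xi> - a2)" by blast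
      have "imp_int_ext x0 (\<lambda>t. \<phi>1 t / W t * Lf t) (ereal \<xi>) (a2 - f2s \<xi>)"
        using L.imp_int_phi1_L[OF \<xi>I[OF \<xi>(1) OIvl_I[OF x]]] ext(4)[OF \<xi>(1)] by (simp add: imp_int_ext_def)
      moreover have "R x = - \<phi>2 x * (a2 - f2s \<xi>)" unfolding \<xi>(2) by (simp add: algebra_simps)
      ultimately show "\<exists>\<xi> v. ereal x \<le> \<xi> \<and> \<xi> \<le> x0 \<and> R x = \<phi>2 x * (ext_at x0 f2s a2 \<xi> - a2) \<and>
          imp_int_ext x0 (\<lambda>t. \<phi>1 t / W t * Lf t) \<xi> v \<and> R x = - \<phi>2 x * v"
        using ext[OF \<xi>(1)] \<xi>(2) by (intro exI[of _ "ereal \<xi>"] exI[of _ "a2 - f2s \<xi>"] conjI) simp_all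
    next
      fix x assume x: "x \<in> OIvl T x0"
      from mean_value_Fs[OF L.f_C1 x]
      obtain \<xi> where \<xi>: "\<xi> \<in> OIvl x x0" "R x = \<phi>2 x / \<phi>2 T * (Fs \<xi> - \<gamma>)" by blast
      have "imp_int_ext x0 (\<lambda>t. \<Phi> t / W t * Lf t) (ereal \<xi>) (\<gamma> - Fs \<xi>)"
        using L.imp_int_Phi_L[OF \<xi>I[OF \<xi>(1) OIvl_I[OF x]]] ext(4)[OF \<xi>(1)] by (simp add: imp_int_ext_def)
      moreover have "R x = - (\<phi>2 x / \<phi>2 T) * (\<gamma> - Fs \<xi>)"
        unfolding \<xi>(2) by (simp only: minus_mult_commute minus_diff_eq)
      ultimately show "\<exists>\<xi> v. ereal x \<le> \<xi> \<and> \<xi> \<le> x0 \<and> R x = \<phi>2 x / \<phi>2 T * (ext_at x0 Fs \<gamma> \<xi> - \<gamma>) \<and>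
          imp_int_ext x0 (\<lambda>t. \<Phi> t / W t * Lf t) \<xi> v \<and> R x = - (\<phi>2 x / \<phi>2 T) * v"
        using ext[OF \<xi>(1)] \<xi>(2) by (intro exI[of _ "ereal \<xi>"] exI[of _ "\<gamma> - Fs \<xi>"] conjI) (simp_all only: ext[OF \<xi>(1)])
    qed
  qed
  have II1: "\<forall>x\<in>I. ereal \<bar>R x\<bar> \<le> ereal \<bar>\<phi>2 x\<bar> * ess_sup_on (OIvl x x0) (\<lambda>t. \<bar>f2s t - a2\<bar>)"
    by (rule ballI) (rule esssup_f2s)
  have II2: "\<forall>x\<in>I. ereal \<bar>R x\<bar> \<le> ereal \<bar>\<phi>2 x / \<phi>2 T\<bar> * ess_sup_on (OIvl x x0) (\<lambda>t. \<bar>Fs t - \<gamma>\<bar>)"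
    by (rule ballI) (rule esssup_Fs)
  show ?thesis
    by (rule exI[of _ \<gamma>], rule conjI[OF lim_Fs conjI[OF I1 conjI[OF I2 conjI[OF I3 conjI[OF impI[OF I4]
      conjI[OF II1 conjI[OF II2 conjI[OF impI[OF II3] conjI[OF impI[OF III1] impI[OF III2]]]]]]]]]])
qed

end
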